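(* Let $\varphi_0,\varphi\in L^2(\mathbb{R}^2)$ satisfy the window assumptions (i)–(iii) of the context, with covering constants $0<A\le B<\infty$ and decay parameters $\delta>0$, $\varsigma>2$. Then there are constants $C,\tau>0$, depending on $\delta$ and $\varsigma$, such that, for a lattice $\Lambda=P\mathbb{Z}^2$ with lattice parameters $a,b>0$ (the singular values of the invertible matrix $P\in\mathbb{R}^{2\times 2}$), the system $\mathcal{C}_\Lambda=\{\varphi_{0,\lambda}:\lambda\in\Lambda\}\cup\{\varphi_{j,k,\lambda}:\lambda\in\Lambda,\ j\ge1,\ 0\le k\le 2^j-1\}$ is a frame of $L^2(\mathbb{R}^2)$ whenever $$\kappa:=e^{-\tau/a^2}+e^{-\tau/b^2}\le CA.$$ Moreover, in this case, $|\Lambda|^{-1}(A-C^{-1}\kappa)$ and $|\Lambda|^{-1}(B+C^{-1}\kappa)$ are (lower and upper) frame bounds for $\mathcal{C}_\Lambda$.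
   Context: Notation. $|x|$ is the Euclidean norm on $\mathbb{R}^2$. The Fourier transform is $\widehat f(\xi)=\int_{\mathbb{R}^2} f(x)e^{-2\pi i \xi\cdot x}\,dx$ (extended to $L^2$). Let $$D_j=\begin{bmatrix}4^j&0\\0&2^j\end{bmatrix},\quad R_\theta=\begin{bmatrix}\cos\theta&-\sin\theta\\ \sin\theta&\cos\theta\end{bmatrix},\quad A_{j,k}=D_jR_{2k\pi/2^j},\quad B_{j,k}=(A_{j,k}^* )^{-1}=D_j^{-1}R_{2k\pi/2^j}.$$ For a lattice $\Lambda=P\mathbb{Z}^2$ ($P$ invertible), the volume is $|\Lambda|=|\det P|$; the singular values $a,b$ of $P$ are called the lattice parameters of $\Lambda$. Window assumptions on $\varphi_0,\varphi\in L^2(\mathbb{R}^2)$: (i) there are constants $A,B$ with $0<A\le |\widehat{\varphi_0}(\xi)|^2+\sum_{j\ge1}\sum_{k=0}^{2^j-1}|\widehat{\varphi}(B_{j,k}\xi)|^2\le B<\infty$ for (almost) every $\xi\in\mathbb{R}^2$; (ii) $|\widehat{\varphi_0}(\xi)|\lesssim e^{-\delta|\xi|^2}$; (iii) $|\widehat{\varphi}(\xi)|\lesssim \min(1,|\xi_1|^{\varsigma})e^{-\delta|\xi|^2}$, for some $\delta>0$ and $\varsigma>2$. Here $X\lesssim Y$ means $X\le cY$ for a constant $c>0$ independent of $\xi$. Wavepackets: $\varphi_{0,\lambda}(x)=\varphi_0(x-\lambda)$ and $\varphi_{j,k,\lambda}(x)=8^{j/2}\varphi(A_{j,k}x-\lambda)$.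 A countable family $\{g_i\}$ is a frame of $L^2(\mathbb{R}^2)$ with bounds $c_1,c_2$ if $c_1\|f\|_2^2\le\sum_i|\langle f,g_i\rangle|^2\le c_2\|f\|_2^2$ for all $f\in L^2(\mathbb{R}^2)$.
   Formalization: The constant C depends on δ, ς and also on the implied constant in the decay bounds (ii)–(iii) (τ depends on δ and ς only); with C depending on δ and ς alone the claim fails, as multiplying both windows by a large factor shows. *)

theory Defs
  imports "HOL-Analysis.Analysis"
begin

section \<open>Square-integrable functions on the plane\<close>

text \<open>
  Elements of \<open>L\<^sup>2(\<real>\<^sup>2)\<close> are represented by Borel functions (every class has a Borel
  representative). Consequently everything below that refers to values of Fourier
  transforms is required only almost everywhere.
\<close>

definition square_integrable :: "(real^2 \<Rightarrow> complex) \<Rightarrow> bool" where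
  "square_integrable f \<longleftrightarrow>
     f \<in> borel_measurable lborel \<and> integrable lborel (\<lambda>x. (cmod (f x))\<^sup>2)"

definition l2_norm :: "(real^2 \<Rightarrow> complex) \<Rightarrow> real" where
  "l2_norm f = sqrt (\<integral>x. (cmod (f x))\<^sup>2 \<partial>lborel)"

definition l2_inner :: "(real^2 \<Rightarrow> complex) \<Rightarrow> (real^2 \<Rightarrow> complex) \<Rightarrow> complex" where
  "l2_inner f g = (\<integral>x. f x * cnj (g x) \<partial>lborel)"


section \<open>The Fourier transform\<close>

definition fourier_L1 :: "(real^2 \<Rightarrow> complex) \<Rightarrow> real^2 \<Rightarrow> complex" where
  "fourier_L1 f \<xi> = (\<integral>x. f x * cis (- 2 * pi * (\<xi> \<bullet> x)) \<partial>lborel)"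

text \<open>
  \<open>is_fourier_L2 f g\<close>: \<open>g\<close> is (a representative of) the value at \<open>f\<close> of the continuous
  extension to \<open>L\<^sup>2\<close> of the integral transform on \<open>L\<^sup>1 \<inter> L\<^sup>2\<close>. For square-integrable \<open>f\<close>,
  Plancherel's theorem yields such a \<open>g\<close>, unique up to null sets.
\<close>

definition is_fourier_L2 :: "(real^2 \<Rightarrow> complex) \<Rightarrow> (real^2 \<Rightarrow> complex) \<Rightarrow> bool" where
  "is_fourier_L2 f g \<longleftrightarrow> square_integrable g \<and>
     (\<forall>u. (\<forall>n. integrable lborel (u n) \<and> square_integrable (u n)) \<longrightarrow>
          (\<lambda>n. l2_norm (\<lambda>x. u n x - f x)) \<longlonglongrightarrow> 0 \<longrightarrow>
          (\<forall>n. square_integrable (fourier_L1 (u n))) \<and>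
          (\<lambda>n. l2_norm (\<lambda>\<xi>. fourier_L1 (u n) \<xi> - g \<xi>)) \<longlonglongrightarrow> 0)"

definition fourier :: "(real^2 \<Rightarrow> complex) \<Rightarrow> real^2 \<Rightarrow> complex" where
  "fourier f = (SOME g. is_fourier_L2 f g)"


section \<open>Dilations and rotations\<close>

definition dil_mat :: "nat \<Rightarrow> real^2^2" where
  "dil_mat j = vector [vector [4 ^ j, 0], vector [0, 2 ^ j]]"

definition rot_mat :: "real \<Rightarrow> real^2^2" where
  "rot_mat \<theta> = vector [vector [cos \<theta>, - sin \<theta>], vector [sin \<theta>, cos \<theta>]]"

definition A_mat :: "nat \<Rightarrow> nat \<Rightarrow> real^2^2" where
  "A_mat j k = dil_mat j ** rot_mat (2 * real k * pi / 2 ^ j)"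

definition B_mat :: "nat \<Rightarrow> nat \<Rightarrow> real^2^2" where
  "B_mat j k = matrix_inv (transpose (A_mat j k))"


section \<open>Lattices\<close>

definition lattice_of :: "real^2^2 \<Rightarrow> (real^2) set" where
  "lattice_of P = {P *v z | z. \<forall>i. z $ i \<in> \<int>}"

definition lattice_volume :: "real^2^2 \<Rightarrow> real" where
  "lattice_volume P = \<bar>det P\<bar>"

text \<open>
  The singular values of \<open>P\<close>, listed with multiplicity in either order: the square roots of
  the roots of the characteristic polynomial of \<open>P\<^sup>T P\<close>.
\<close>

definition singular_values :: "real^2^2 \<Rightarrow> real \<Rightarrow> real \<Rightarrow> bool" where
  "singular_values P a b \<longleftrightarrow> 0 \<le> a \<and> 0 \<le> b \<and>
     (\<forall>x. det (mat x - transpose P ** P) = (x - a\<^sup>2) * (x - b\<^sup>2))"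


section \<open>Frames\<close>

text \<open>
  Frames are indexed families, so coinciding members at different indices are counted
  separately. The bounds in \<open>has_frame_bounds\<close> need not be positive, whereas a frame has a
  positive lower bound.
\<close>

definition has_frame_bounds ::
  "'i set \<Rightarrow> ('i \<Rightarrow> real^2 \<Rightarrow> complex) \<Rightarrow> real \<Rightarrow> real \<Rightarrow> bool" where
  "has_frame_bounds I g c1 c2 \<longleftrightarrow>
     countable I \<and> (\<forall>i\<in>I. square_integrable (g i)) \<and>
     (\<forall>f. square_integrable f \<longrightarrow>
        (\<lambda>i. (cmod (l2_inner f (g i)))\<^sup>2) summable_on I \<and>
        c1 * (l2_norm f)\<^sup>2 \<le> (\<Sum>\<^sub>\<infinity>i\<in>I. (cmod (l2_inner f (g i)))\<^sup>2) \<and>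
        (\<Sum>\<^sub>\<infinity>i\<in>I. (cmod (l2_inner f (g i)))\<^sup>2) \<le> c2 * (l2_norm f)\<^sup>2)"

definition is_frame :: "'i set \<Rightarrow> ('i \<Rightarrow> real^2 \<Rightarrow> complex) \<Rightarrow> bool" where
  "is_frame I g \<longleftrightarrow> (\<exists>c1 c2. 0 < c1 \<and> c1 \<le> c2 \<and> has_frame_bounds I g c1 c2)"


section \<open>Wavepackets\<close>

datatype wp_index = Coarse "real^2" | Fine nat nat "real^2"

definition wp_indices :: "(real^2) set \<Rightarrow> wp_index set" where
  "wp_indices L = {Coarse l | l. l \<in> L} \<union> {Fine j k l | j k l. 1 \<le> j \<and> k \<le> 2 ^ j - 1 \<and> l \<in> L}"

fun wavepacket ::
  "(real^2 \<Rightarrow> complex) \<Rightarrow> (real^2 \<Rightarrow> complex) \<Rightarrow> wp_index \<Rightarrow> real^2 \<Rightarrow> complex" where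
  "wavepacket \<phi>0 \<phi> (Coarse l) x = \<phi>0 (x - l)"
| "wavepacket \<phi>0 \<phi> (Fine j k l) x = of_real (8 powr (real j / 2)) * \<phi> (A_mat j k *v x - l)"

text \<open>
  \<open>c\<close> is a common implied constant for the two decay bounds.
\<close>

definition window_assumptions ::
  "(real^2 \<Rightarrow> complex) \<Rightarrow> (real^2 \<Rightarrow> complex) \<Rightarrow> real \<Rightarrow> real \<Rightarrow> real \<Rightarrow> real \<Rightarrow> real \<Rightarrow> bool" where
  "window_assumptions \<phi>0 \<phi> A B \<delta> \<sigma> c \<longleftrightarrow>
     square_integrable \<phi>0 \<and> square_integrable \<phi> \<and> 0 < A \<and> A \<le> B \<and>
     (AE \<xi> in lborel.
        (\<lambda>j. \<Sum>k = 0..2 ^ j - 1. (cmod (fourier \<phi> (B_mat j k *v \<xi>)))\<^sup>2) summable_on {1..} \<and>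
        A \<le> (cmod (fourier \<phi>0 \<xi>))\<^sup>2 +
            (\<Sum>\<^sub>\<infinity>j\<in>{1..}. \<Sum>k = 0..2 ^ j - 1. (cmod (fourier \<phi> (B_mat j k *v \<xi>)))\<^sup>2) \<and>
        (cmod (fourier \<phi>0 \<xi>))\<^sup>2 +
            (\<Sum>\<^sub>\<infinity>j\<in>{1..}. \<Sum>k = 0..2 ^ j - 1. (cmod (fourier \<phi> (B_mat j k *v \<xi>)))\<^sup>2) \<le> B) \<and>
     (AE \<xi> in lborel. cmod (fourier \<phi>0 \<xi>) \<le> c * exp (- \<delta> * (norm \<xi>)\<^sup>2)) \<and>
     (AE \<xi> in lborel. cmod (fourier \<phi> \<xi>)
        \<le> c * (min 1 (\<bar>\<xi> $ 1\<bar> powr \<sigma>) * exp (- \<delta> * (norm \<xi>)\<^sup>2)))"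

end

theory Submission
  imports Defs "HOL-Complex_Analysis.Cauchy_Integral_Theorem"
begin

text \<open>
  By Plancherel's theorem a coefficient \<open>\<langle>f, \<phi>\<^sub>j\<^sub>k\<^sub>\<lambda>\<rangle>\<close> is, up to a factor, a Fourier coefficient of
  \<open>F(\<eta>) = f'(B\<^sup>-\<^sup>1 \<eta>) cnj (\<phi>'(\<eta>))\<close>, where primes denote Fourier transforms. Summing squares over
  \<open>\<lambda> \<in> \<Lambda>\<close> and applying Parseval's identity to the periodization of \<open>F\<close> over the dual lattice
  gives the diagonal term \<open>\<integral>\<bar>F\<bar>\<^sup>2\<close> and terms \<open>\<integral>F(\<eta>) cnj (F(\<eta> + \<gamma>))\<close> with \<open>\<gamma> \<noteq> 0\<close> dual. Summed over
  \<open>j, k\<close>, the diagonal terms lie between \<open>A \<parallel>f\<parallel>\<^sup>2\<close> and \<open>B \<parallel>f\<parallel>\<^sup>2\<close> by the covering assumption. The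
  Gaussian factors of the window make the off-diagonal part at most a constant times
  \<open>\<kappa> \<parallel>f\<parallel>\<^sup>2\<close>, by a Schur test, as soon as \<open>max a b \<le> 1\<close>; this last condition is forced by
  \<open>\<kappa> \<le> C A\<close> for small \<open>C\<close>, because \<open>A\<close> is bounded in terms of \<open>c\<close>, \<open>\<delta>\<close> and \<open>\<sigma>\<close>. The sum over \<open>j, k\<close>
  is uniformly bounded because \<open>\<sigma> > 2\<close>. Plancherel's theorem is itself deduced from Parseval's
  identity on the torus by averaging over translates of a rescaled lattice.
\<close>


section \<open>Square-integrable functions\<close>

text \<open>The Gaussians of a window at x and x + \<gamma> have to pay for three things. Since
  |\<gamma>|^2 <= 2|x|^2 + 2|x + \<gamma>|^2, their joint exponent yields
  \<open>exp (- (\<delta> / 8 * m))\<close> with m = min (1/a^2) (1/b^2), a Gaussian in the integer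
  coordinates of \<gamma>, whose sum is the same for every lattice, and half of the exponent at x,
  kept for the sum over scales and rotations. Separating the first two is where m >= 1, that is max
  a b <= 1, enters; the first is at most \<kappa> for \<tau> = \<delta>/8. The condition \<sigma> >
  2 pays for the rotations: at radius r and scale j, with t = r/4^j, the Gaussian sum over the
  rotations is bounded by a multiple of 1 + 1/t^2. For t <= 1 the factor t^\<sigma> turns this into
  t^(\<sigma>-2), which must be summable over j. The lower bound in the statement vanishes when
  \<kappa> = C A, so the frame property is drawn from a sharper pair of bounds, whose error is at
  most A/2. Sums of squares are taken in \<open>ennreal\<close>. Each estimate is therefore a pair
  of one-sided inequalities, and summability of the frame coefficients is read off the upper
  one.\<close>

lemma borel_measurable_cnj [measurable (raw)]:
  "f \<in> borel_measurable M \<Longrightarrow> (\<lambda>x. cnj (f x)) \<in> borel_measurable M"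
  by (rule borel_measurable_continuous_on) (intro continuous_intros)

lemma square_integrable_measurable [measurable_dest]:
  "square_integrable f \<Longrightarrow> f \<in> borel_measurable borel"
  by (simp add: square_integrable_def)

lemma square_integrableI_nn:
  assumes "f \<in> borel_measurable borel" "(\<integral>\<^sup>+x. ennreal ((cmod (f x))\<^sup>2) \<partial>lborel) < \<infinity>"
  shows "square_integrable f"
  using assms by (auto simp: square_integrable_def intro!: integrableI_nonneg)

lemma square_integrable_mono:
  assumes "square_integrable g" "f \<in> borel_measurable borel" "AE x in lborel. cmod (f x) \<le> c * cmod (g x)"
  shows "square_integrable f"
  unfolding square_integrable_def
proof (intro conjI)
  have "integrable lborel (\<lambda>x. c\<^sup>2 * (cmod (g x))\<^sup>2)"
    using assms(1) by (simp add: square_integrable_def)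
  then show "integrable lborel (\<lambda>x. (cmod (f x))\<^sup>2)"
  proof (rule Bochner_Integration.integrable_bound)
    show "AE x in lborel. norm ((cmod (f x))\<^sup>2) \<le> norm (c\<^sup>2 * (cmod (g x))\<^sup>2)"
      using assms(3)
    proof eventually_elim
      case (elim x)
      have "(cmod (f x))\<^sup>2 \<le> (c * cmod (g x))\<^sup>2"
        using elim by (intro power_mono) auto
      then show ?case by (simp add: power_mult_distrib)
    qed
  qed (use assms in measurable)
qed (use assms in simp)

lemma square_integrable_cmult:
  assumes "square_integrable f" shows "square_integrable (\<lambda>x. c * f x)"
  using assms by (intro square_integrable_mono[OF assms, where c = "cmod c"]) (auto simp: norm_mult)

lemma square_integrable_add:
  assumes "square_integrable f" "square_integrable g"
  shows "square_integrable (\<lambda>x. f x + g x)"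
  unfolding square_integrable_def
proof (intro conjI)
  have "integrable lborel (\<lambda>x. 2 * (cmod (f x))\<^sup>2 + 2 * (cmod (g x))\<^sup>2)"
    using assms by (simp add: square_integrable_def)
  then show "integrable lborel (\<lambda>x. (cmod (f x + g x))\<^sup>2)"
  proof (rule Bochner_Integration.integrable_bound)
    show "AE x in lborel. norm ((cmod (f x + g x))\<^sup>2) \<le> norm (2 * (cmod (f x))\<^sup>2 + 2 * (cmod (g x))\<^sup>2)"
    proof (intro AE_I2)
      fix x
      have "(cmod (f x + g x))\<^sup>2 \<le> (cmod (f x) + cmod (g x))\<^sup>2"
        by (intro power_mono norm_triangle_ineq) auto
      also have "\<dots> \<le> 2 * (cmod (f x))\<^sup>2 + 2 * (cmod (g x))\<^sup>2"
        using sum_squares_bound[of "cmod (f x)" "cmod (g x)"] by (simp add: power2_sum)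
      finally show "norm ((cmod (f x + g x))\<^sup>2) \<le> norm (2 * (cmod (f x))\<^sup>2 + 2 * (cmod (g x))\<^sup>2)"
        by simp
    qed
  qed (use assms in measurable)
qed (use assms in simp)

lemma square_integrable_diff:
  assumes "square_integrable f" "square_integrable g"
  shows "square_integrable (\<lambda>x. f x - g x)"
  using square_integrable_add[OF assms(1) square_integrable_cmult[OF assms(2), of "-1"]] by simp

lemma square_integrable_zero [simp]: "square_integrable (\<lambda>x. 0)"
  by (simp add: square_integrable_def)

lemma square_integrable_sum:
  assumes "\<And>i. i \<in> I \<Longrightarrow> square_integrable (f i)"
  shows "square_integrable (\<lambda>x. \<Sum>i\<in>I. f i x)"
  using assms by (induction I rule: infinite_finite_induct) (auto intro: square_integrable_add)

section \<open>Norm and inner product\<close>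

lemma l2_norm_nonneg [simp]: "0 \<le> l2_norm f"
  by (simp add: l2_norm_def)

lemma l2_norm_power2: "(l2_norm f)\<^sup>2 = (\<integral>x. (cmod (f x))\<^sup>2 \<partial>lborel)"
  by (simp add: l2_norm_def)

lemma nn_integral_l2_norm:
  assumes "square_integrable f"
  shows "(\<integral>\<^sup>+x. ennreal ((cmod (f x))\<^sup>2) \<partial>lborel) = ennreal ((l2_norm f)\<^sup>2)"
  using assms unfolding l2_norm_power2 square_integrable_def
  by (intro nn_integral_eq_integral) auto

lemma l2_norm_cong_AE:
  assumes "f \<in> borel_measurable borel" "g \<in> borel_measurable borel"
    and "AE x in lborel. f x = g x"
  shows "l2_norm f = l2_norm g"
  unfolding l2_norm_def using assms by (intro arg_cong[where f = sqrt] integral_cong_AE) auto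

lemma square_integrable_cong_AE:
  assumes "square_integrable f" "g \<in> borel_measurable borel"
    and "AE x in lborel. f x = g x"
  shows "square_integrable g"
  using assms(3) by (intro square_integrable_mono[OF assms(1,2), where c = 1]) auto

lemma integrable_l2_product:
  assumes "square_integrable f" "square_integrable g"
  shows "integrable lborel (\<lambda>x. f x * cnj (g x))"
proof (rule Bochner_Integration.integrable_bound)
  show "integrable lborel (\<lambda>x. (cmod (f x))\<^sup>2 + (cmod (g x))\<^sup>2)"
    using assms by (simp add: square_integrable_def)
  show "AE x in lborel. norm (f x * cnj (g x)) \<le> norm ((cmod (f x))\<^sup>2 + (cmod (g x))\<^sup>2)"
  proof (intro AE_I2)
    fix x
    have "2 * (cmod (f x) * cmod (g x)) \<le> (cmod (f x))\<^sup>2 + (cmod (g x))\<^sup>2"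
      using sum_squares_bound[of "cmod (f x)" "cmod (g x)"] by simp
    moreover have "0 \<le> cmod (f x) * cmod (g x)" by simp
    ultimately have "cmod (f x) * cmod (g x) \<le> (cmod (f x))\<^sup>2 + (cmod (g x))\<^sup>2"
      by linarith
    then show "norm (f x * cnj (g x)) \<le> norm ((cmod (f x))\<^sup>2 + (cmod (g x))\<^sup>2)"
      by (simp add: norm_mult)
  qed
qed (use assms in measurable)

lemma l2_inner_add_left:
  "square_integrable f \<Longrightarrow> square_integrable g \<Longrightarrow> square_integrable h \<Longrightarrow>
   l2_inner (\<lambda>x. f x + g x) h = l2_inner f h + l2_inner g h"
  by (simp add: l2_inner_def distrib_right integrable_l2_product)

lemma l2_inner_diff_left:
  "square_integrable f \<Longrightarrow> square_integrable g \<Longrightarrow> square_integrable h \<Longrightarrow>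
   l2_inner (\<lambda>x. f x - g x) h = l2_inner f h - l2_inner g h"
  by (simp add: l2_inner_def left_diff_distrib integrable_l2_product)

lemma l2_inner_cmult_left: "l2_inner (\<lambda>x. c * f x) g = c * l2_inner f g"
  by (simp add: l2_inner_def mult.assoc)

lemma l2_inner_commute: "l2_inner g f = cnj (l2_inner f g)"
proof -
  have "cnj (l2_inner f g) = (\<integral>x. cnj (f x * cnj (g x)) \<partial>lborel)"
    unfolding l2_inner_def by (rule Bochner_Integration.integral_cnj[symmetric])
  then show ?thesis by (simp add: l2_inner_def mult.commute)
qed

lemma l2_inner_self: "l2_inner f f = of_real ((l2_norm f)\<^sup>2)"
  by (simp only: l2_inner_def l2_norm_power2 complex_norm_square[symmetric] integral_complex_of_real)

lemma l2_inner_sum_left: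
  assumes "\<And>i. i \<in> I \<Longrightarrow> square_integrable (f i)" "square_integrable g"
  shows "l2_inner (\<lambda>x. \<Sum>i\<in>I. f i x) g = (\<Sum>i\<in>I. l2_inner (f i) g)"
  using assms
proof (induction I rule: infinite_finite_induct)
  case (insert i I)
  then show ?case by (simp add: l2_inner_add_left square_integrable_sum)
qed (simp_all add: l2_inner_def)

lemma l2_norm_power2_add:
  assumes "square_integrable f" "square_integrable g"
  shows "(l2_norm (\<lambda>x. f x + g x))\<^sup>2 = (l2_norm f)\<^sup>2 + 2 * Re (l2_inner f g) + (l2_norm g)\<^sup>2"
proof -
  have s: "square_integrable (\<lambda>x. f x + g x)" using assms by (rule square_integrable_add)
  have "complex_of_real ((l2_norm (\<lambda>x. f x + g x))\<^sup>2) = l2_inner (\<lambda>x. f x + g x) (\<lambda>x. f x + g x)"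
    by (rule l2_inner_self[symmetric])
  also have "\<dots> = l2_inner f (\<lambda>x. f x + g x) + l2_inner g (\<lambda>x. f x + g x)"
    using assms s by (simp add: l2_inner_add_left)
  also have "\<dots> = cnj (l2_inner f f + l2_inner g f) + cnj (l2_inner f g + l2_inner g g)"
    using assms by (simp only: l2_inner_commute[of _ "\<lambda>x. f x + g x"] l2_inner_add_left)
  finally have "Re (complex_of_real ((l2_norm (\<lambda>x. f x + g x))\<^sup>2)) =
    Re (cnj (l2_inner f f + l2_inner g f) + cnj (l2_inner f g + l2_inner g g))" by simp
  then show ?thesis
    by (simp add: l2_inner_self l2_inner_commute[of g f])
qed

lemma l2_norm_cmult: "l2_norm (\<lambda>x. c * f x) = cmod c * l2_norm f"
  by (simp add: l2_norm_def norm_mult power_mult_distrib real_sqrt_mult)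

lemma l2_norm_minus_commute: "l2_norm (\<lambda>x. f x - g x) = l2_norm (\<lambda>x. g x - f x)"
  by (simp add: l2_norm_def norm_minus_commute)

text \<open>Expand the squared norm of f - t <f,g> g for real t. With the inner product itself in
  the coefficient the cross term is real, and t = 1/|g|^2 is the minimising choice.\<close>

lemma l2_inner_bound:
  assumes "square_integrable f" "square_integrable g"
  shows "cmod (l2_inner f g) \<le> l2_norm f * l2_norm g"
proof -
  let ?a = "l2_norm f" and ?b = "l2_norm g" and ?w = "l2_inner f g"
  have quad: "0 \<le> ?a\<^sup>2 - 2 * t * (cmod ?w)\<^sup>2 + t\<^sup>2 * (cmod ?w)\<^sup>2 * ?b\<^sup>2" for t :: real
  proof -
    have "0 \<le> (l2_norm (\<lambda>x. f x + (- of_real t * ?w) * g x))\<^sup>2" by simp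
    also have "\<dots> = ?a\<^sup>2 + 2 * Re (l2_inner f (\<lambda>x. (- of_real t * ?w) * g x)) +
        (l2_norm (\<lambda>x. (- of_real t * ?w) * g x))\<^sup>2"
      using assms by (intro l2_norm_power2_add square_integrable_cmult)
    also have "l2_inner f (\<lambda>x. (- of_real t * ?w) * g x) = - of_real t * (?w * cnj ?w)"
      by (subst l2_inner_commute, subst l2_inner_cmult_left, subst l2_inner_commute) simp
    also have "\<dots> = of_real (- t * (cmod ?w)\<^sup>2)"
      by (simp only: complex_norm_square[symmetric] of_real_mult of_real_minus)
    finally show ?thesis
      unfolding l2_norm_cmult by (simp add: norm_mult power_mult_distrib)
  qed
  show ?thesis
  proof (cases "?b = 0")
    case True
    have "(cmod ?w)\<^sup>2 = 0"
    proof (rule ccontr)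
      assume "(cmod ?w)\<^sup>2 \<noteq> 0"
      \<comment> \<open>For a null \<open>g\<close> the polynomial is linear in t, and this t gives
        it the value -1.\<close>
      then show False
        using quad[of "(?a\<^sup>2 + 1) / (2 * (cmod ?w)\<^sup>2)"] True by (simp add: field_simps)
    qed
    then show ?thesis by simp
  next
    case False
    then have "0 < ?b\<^sup>2" by simp
    then have b: "(1 / ?b\<^sup>2)\<^sup>2 * (cmod ?w)\<^sup>2 * ?b\<^sup>2 = (cmod ?w)\<^sup>2 / ?b\<^sup>2"
      by (simp add: power2_eq_square)
    have "(cmod ?w)\<^sup>2 / ?b\<^sup>2 \<le> ?a\<^sup>2"
      using quad[of "1 / ?b\<^sup>2"] unfolding b by simp
    then have "(cmod ?w)\<^sup>2 \<le> (?a * ?b)\<^sup>2"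
      using \<open>0 < ?b\<^sup>2\<close> by (simp add: pos_divide_le_eq power_mult_distrib)
    then show ?thesis by (rule power2_le_imp_le) simp
  qed
qed

lemma l2_norm_triangle:
  assumes "square_integrable f" "square_integrable g"
  shows "l2_norm (\<lambda>x. f x + g x) \<le> l2_norm f + l2_norm g"
proof (rule power2_le_imp_le)
  have "Re (l2_inner f g) \<le> l2_norm f * l2_norm g"
    using l2_inner_bound[OF assms] complex_Re_le_cmod[of "l2_inner f g"] by linarith
  then show "(l2_norm (\<lambda>x. f x + g x))\<^sup>2 \<le> (l2_norm f + l2_norm g)\<^sup>2"
    unfolding l2_norm_power2_add[OF assms] by (simp add: power2_sum)
qed simp

lemma l2_norm_triangle_diff:
  assumes "square_integrable f" "square_integrable g" "square_integrable h"
  shows "l2_norm (\<lambda>x. f x - h x) \<le> l2_norm (\<lambda>x. f x - g x) + l2_norm (\<lambda>x. g x - h x)"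
  using l2_norm_triangle[of "\<lambda>x. f x - g x" "\<lambda>x. g x - h x"] assms
  by (simp add: square_integrable_diff)

lemma l2_norm_diff_ineq:
  assumes "square_integrable f" "square_integrable g"
  shows "\<bar>l2_norm f - l2_norm g\<bar> \<le> l2_norm (\<lambda>x. f x - g x)"
  using l2_norm_triangle_diff[OF assms(1) assms(2) square_integrable_zero]
    l2_norm_triangle_diff[OF assms(2) assms(1) square_integrable_zero]
  by (simp add: l2_norm_minus_commute[of g f])

section \<open>Convergence in norm and completeness\<close>

lemma l2_norm_tendsto:
  assumes "\<And>n. square_integrable (u n)" "square_integrable f"
    and "(\<lambda>n. l2_norm (\<lambda>x. u n x - f x)) \<longlonglongrightarrow> 0"
  shows "(\<lambda>n. l2_norm (u n)) \<longlonglongrightarrow> l2_norm f"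
proof (rule LIM_zero_cancel)
  show "(\<lambda>n. l2_norm (u n) - l2_norm f) \<longlonglongrightarrow> 0"
    by (rule Lim_null_comparison[OF _ assms(3)]) (use l2_norm_diff_ineq assms in auto)
qed

lemma l2_inner_tendsto_left:
  assumes "\<And>n. square_integrable (u n)" "square_integrable f" "square_integrable g"
    and "(\<lambda>n. l2_norm (\<lambda>x. u n x - f x)) \<longlonglongrightarrow> 0"
  shows "(\<lambda>n. l2_inner (u n) g) \<longlonglongrightarrow> l2_inner f g"
proof (rule LIM_zero_cancel)
  have "(\<lambda>n. l2_norm (\<lambda>x. u n x - f x) * l2_norm g) \<longlonglongrightarrow> 0"
    using tendsto_mult_left_zero[OF assms(4)] by simp
  then show "(\<lambda>n. l2_inner (u n) g - l2_inner f g) \<longlonglongrightarrow> 0"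
  proof (rule Lim_null_comparison[rotated], intro always_eventually allI)
    fix n
    show "norm (l2_inner (u n) g - l2_inner f g) \<le> l2_norm (\<lambda>x. u n x - f x) * l2_norm g"
      using l2_inner_bound[of "\<lambda>x. u n x - f x" g] assms
      by (simp add: l2_inner_diff_left square_integrable_diff)
  qed
qed

text \<open>Fatou's lemma carries a norm bound to an almost everywhere limit. Comparing with
  \<open>h\<close> instead of 0 lets the same lemma give membership in L2 and the rate of
  convergence, both in the completeness proof and in Plancherel's theorem.\<close>

lemma square_integrable_Fatou:
  assumes "\<And>n. square_integrable (v n)" "g \<in> borel_measurable borel" "square_integrable h"
    and "AE x in lborel. (\<lambda>n. v n x) \<longlonglongrightarrow> g x"
    and "\<forall>\<^sub>F n in sequentially. l2_norm (\<lambda>x. v n x - h x) \<le> e"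
  shows "square_integrable g" "l2_norm (\<lambda>x. g x - h x) \<le> e"
proof -
  note assms(1)[THEN square_integrable_measurable, measurable]
    assms(3)[THEN square_integrable_measurable, measurable] assms(2)[measurable]
  obtain n where "l2_norm (\<lambda>x. v n x - h x) \<le> e"
    using eventually_happens[OF assms(5)] by auto
  then have e: "0 \<le> e"
    by (rule order_trans[OF l2_norm_nonneg])
  have "(\<integral>\<^sup>+x. ennreal ((cmod (g x - h x))\<^sup>2) \<partial>lborel) =
        (\<integral>\<^sup>+x. liminf (\<lambda>n. ennreal ((cmod (v n x - h x))\<^sup>2)) \<partial>lborel)"
  proof (rule nn_integral_cong_AE)
    show "AE x in lborel. ennreal ((cmod (g x - h x))\<^sup>2) = liminf (\<lambda>n. ennreal ((cmod (v n x - h x))\<^sup>2))"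
      using assms(4)
    proof eventually_elim
      case (elim x)
      have "(\<lambda>n. ennreal ((cmod (v n x - h x))\<^sup>2)) \<longlonglongrightarrow> ennreal ((cmod (g x - h x))\<^sup>2)"
        by (intro tendsto_intros tendsto_ennrealI elim)
      from lim_imp_Liminf[OF _ this] show ?case by simp
    qed
  qed
  also have "\<dots> \<le> liminf (\<lambda>n. \<integral>\<^sup>+x. ennreal ((cmod (v n x - h x))\<^sup>2) \<partial>lborel)"
    by (intro nn_integral_liminf) measurable
  also have "\<dots> \<le> liminf (\<lambda>n. ennreal (e\<^sup>2))"
  proof (rule Liminf_mono)
    show "\<forall>\<^sub>F n in sequentially. (\<integral>\<^sup>+x. ennreal ((cmod (v n x - h x))\<^sup>2) \<partial>lborel) \<le> ennreal (e\<^sup>2)"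
      using assms(5)
    proof eventually_elim
      case (elim n)
      then show ?case
        using assms e
        by (subst nn_integral_l2_norm) (auto intro!: square_integrable_diff ennreal_leI power_mono)
    qed
  qed
  also have "\<dots> = ennreal (e\<^sup>2)" by (simp add: Liminf_const)
  finally have le: "(\<integral>\<^sup>+x. ennreal ((cmod (g x - h x))\<^sup>2) \<partial>lborel) \<le> ennreal (e\<^sup>2)" .
  have s: "square_integrable (\<lambda>x. g x - h x)"
    using assms le by (intro square_integrableI_nn) (auto simp: order_le_less_trans)
  show "square_integrable g"
    using square_integrable_add[OF s assms(3)] by simp
  show "l2_norm (\<lambda>x. g x - h x) \<le> e"
  proof (rule power2_le_imp_le[OF _ e])
    show "(l2_norm (\<lambda>x. g x - h x))\<^sup>2 \<le> e\<^sup>2"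
      using le unfolding nn_integral_l2_norm[OF s] by (simp only: ennreal_le_iff zero_le_power2)
  qed
qed

text \<open>Either |d n| <= 2^(-n), or 2^n |d n| >= 1 and then |d n| <= 2^n |d n|^2. Weighted
  squares can be integrated term by term, which turns L2 bounds on increments into pointwise
  convergence.\<close>

lemma convergent_of_weighted_square_bound:
  fixes d :: "nat \<Rightarrow> complex"
  assumes "summable (\<lambda>n. 2 ^ n * (cmod (d n))\<^sup>2)"
  shows "summable d"
proof (rule summable_norm_cancel, rule summable_comparison_test)
  show "summable (\<lambda>n. (1 / 2) ^ n + 2 ^ n * (cmod (d n))\<^sup>2)"
    using assms by (intro summable_add summable_geometric) auto
  have "cmod (d n) \<le> (1 / 2) ^ n + 2 ^ n * (cmod (d n))\<^sup>2" for n
  proof (cases "cmod (d n) \<le> (1 / 2) ^ n")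
    case False
    then have "1 \<le> 2 ^ n * cmod (d n)" by (simp add: field_simps)
    then have "1 * cmod (d n) \<le> 2 ^ n * cmod (d n) * cmod (d n)"
      by (intro mult_right_mono) auto
    moreover have "0 \<le> (1 / 2 :: real) ^ n" by simp
    ultimately show ?thesis by (simp only: power2_eq_square mult.assoc)
  qed (simp add: add_increasing2)
  then show "\<exists>N. \<forall>n\<ge>N. norm (norm (d n)) \<le> (1 / 2) ^ n + 2 ^ n * (cmod (d n))\<^sup>2" by simp
qed

theorem l2_complete:
  assumes u: "\<And>n. square_integrable (u n)"
    and cauchy: "\<And>e. e > 0 \<Longrightarrow> \<exists>N. \<forall>m\<ge>N. \<forall>n\<ge>N. l2_norm (\<lambda>x. u m x - u n x) < e"
  obtains g where "square_integrable g" "(\<lambda>n. l2_norm (\<lambda>x. u n x - g x)) \<longlonglongrightarrow> 0"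
proof -
  have "\<exists>N. \<forall>m\<ge>N. \<forall>n\<ge>N. l2_norm (\<lambda>x. u m x - u n x) < (1 / 2) ^ k" for k
    by (rule cauchy) simp
  then obtain N where N: "\<And>k m n. N k \<le> m \<Longrightarrow> N k \<le> n \<Longrightarrow> l2_norm (\<lambda>x. u m x - u n x) < (1 / 2) ^ k"
    by metis
  \<comment> \<open>The maximum dominates every \<open>N i\<close> with i <= k, which controls the
    increments; the summand \<open>k\<close> makes the indices tend to infinity.\<close>
  define r where "r = (\<lambda>k. Max (N ` {..k}) + k)"
  have rN: "N i \<le> r k" if "i \<le> k" for i k
    unfolding r_def using that by (intro trans_le_add1 Max_ge) auto
  have r_ge: "k \<le> r k" for k by (simp add: r_def)
  define d where "d = (\<lambda>k x. u (r (Suc k)) x - u (r k) x)"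
  have d: "square_integrable (d k)" for k
    unfolding d_def by (intro square_integrable_diff u)
  have dn: "l2_norm (d k) \<le> (1 / 2) ^ k" for k
    unfolding d_def using N[OF rN[of k "Suc k"] rN[of k k]] by simp
  note d[THEN square_integrable_measurable, measurable] u[THEN square_integrable_measurable, measurable]
  have "(\<integral>\<^sup>+x. (\<Sum>k. ennreal (2 ^ k * (cmod (d k x))\<^sup>2)) \<partial>lborel) =
        (\<Sum>k. \<integral>\<^sup>+x. ennreal (2 ^ k * (cmod (d k x))\<^sup>2) \<partial>lborel)"
    by (rule nn_integral_suminf) measurable
  also have "\<dots> \<le> (\<Sum>k. ennreal ((1 / 2) ^ k))"
  proof (intro suminf_le summableI)
    fix k
    have "(\<integral>\<^sup>+x. ennreal (2 ^ k * (cmod (d k x))\<^sup>2) \<partial>lborel) =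
        (\<integral>\<^sup>+x. ennreal (2 ^ k) * ennreal ((cmod (d k x))\<^sup>2) \<partial>lborel)"
      by (intro nn_integral_cong ennreal_mult) auto
    also have "\<dots> = ennreal (2 ^ k) * ennreal ((l2_norm (d k))\<^sup>2)"
      by (subst nn_integral_cmult) (auto simp only: nn_integral_l2_norm[OF d], measurable)
    also have "\<dots> = ennreal (2 ^ k * (l2_norm (d k))\<^sup>2)"
      by (rule ennreal_mult[symmetric]) auto
    also have "\<dots> \<le> ennreal ((1 / 2) ^ k)"
    proof (rule ennreal_leI)
      have "2 ^ k * (l2_norm (d k))\<^sup>2 \<le> 2 ^ k * ((1 / 2) ^ k)\<^sup>2"
        by (intro mult_left_mono power_mono dn) auto
      also have "\<dots> = (1 / 2 :: real) ^ k"
        by (simp add: power2_eq_square power_one_over)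
      finally show "2 ^ k * (l2_norm (d k))\<^sup>2 \<le> (1 / 2) ^ k" .
    qed
    finally show "(\<integral>\<^sup>+x. ennreal (2 ^ k * (cmod (d k x))\<^sup>2) \<partial>lborel) \<le> ennreal ((1 / 2) ^ k)" .
  qed
  also have "\<dots> = ennreal (\<Sum>k. (1 / 2) ^ k)"
    by (intro suminf_ennreal2 summable_geometric) auto
  also have "\<dots> < \<infinity>" by simp
  finally have "AE x in lborel. (\<Sum>k. ennreal (2 ^ k * (cmod (d k x))\<^sup>2)) \<noteq> \<infinity>"
    by (intro nn_integral_noteq_infinite) auto
  then have conv: "AE x in lborel. convergent (\<lambda>k. u (r k) x)"
  proof eventually_elim
    case (elim x)
    have "summable (\<lambda>k. 2 ^ k * (cmod (d k x))\<^sup>2)"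
      using elim by (intro summable_suminf_not_top) auto
    then have "summable (\<lambda>k. d k x)" by (rule convergent_of_weighted_square_bound)
    then have "convergent (\<lambda>n. \<Sum>k<n. d k x)" by (simp add: summable_iff_convergent)
    moreover have "(\<Sum>k<n. d k x) = u (r n) x - u (r 0) x" for n
      unfolding d_def by (rule sum_lessThan_telescope)
    ultimately have "convergent (\<lambda>n. u (r 0) x + (u (r n) x - u (r 0) x))"
      by (intro convergent_add convergent_const) simp
    then show ?case by simp
  qed
  define g where "g = (\<lambda>x. lim (\<lambda>k. u (r k) x))"
  have g [measurable]: "g \<in> borel_measurable borel"
    unfolding g_def by measurable
  have lim: "AE x in lborel. (\<lambda>k. u (r k) x) \<longlonglongrightarrow> g x"
    using conv by eventually_elim (simp add: g_def convergent_LIMSEQ_iff)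
  \<comment> \<open>The index \<open>n\<close> stays fixed while the subsequence tends to
    \<open>g\<close>, so a Cauchy bound for the whole sequence passes to the limit.\<close>
  have est: "l2_norm (\<lambda>x. g x - u n x) \<le> e \<and> square_integrable g"
    if "\<And>m. m \<ge> M \<Longrightarrow> l2_norm (\<lambda>x. u m x - u n x) < e" for M n e
  proof -
    have "\<forall>\<^sub>F k in sequentially. l2_norm (\<lambda>x. u (r k) x - u n x) \<le> e"
      using eventually_ge_at_top[of M]
    proof eventually_elim
      case (elim k)
      then show ?case using that[of "r k"] r_ge[of k] by simp
    qed
    from square_integrable_Fatou[OF u g u lim this] show ?thesis by blast
  qed
  show thesis
  proof (rule that)
    show "square_integrable g"
    proof -
      obtain M where "\<forall>m\<ge>M. \<forall>n\<ge>M. l2_norm (\<lambda>x. u m x - u n x) < 1"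
        using cauchy[of 1] by auto
      then show ?thesis using est[of M M 1] by simp
    qed
    show "(\<lambda>n. l2_norm (\<lambda>x. u n x - g x)) \<longlonglongrightarrow> 0"
    proof (rule LIMSEQ_I)
      fix e :: real assume "0 < e"
      then obtain M where M: "\<forall>m\<ge>M. \<forall>n\<ge>M. l2_norm (\<lambda>x. u m x - u n x) < e / 2"
        using cauchy[of "e / 2"] by auto
      have "norm (l2_norm (\<lambda>x. u n x - g x) - 0) < e" if "n \<ge> M" for n
        using est[of M n "e / 2"] M that \<open>0 < e\<close> by (simp add: l2_norm_minus_commute[of "u n" g])
      then show "\<exists>M. \<forall>n\<ge>M. norm (l2_norm (\<lambda>x. u n x - g x) - 0) < e" by blast
    qed
  qed
qed


section \<open>Linear changes of variables and the tiling by unit cells\<close>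

lemma borel_measurable_matrix_vector_mult [measurable (raw)]:
  fixes M :: "real^'n^'m"
  shows "f \<in> borel_measurable N \<Longrightarrow> (\<lambda>x. M *v f x) \<in> borel_measurable N"
  by (rule borel_measurable_continuous_on) (auto intro: linear_continuous_on matrix_vector_mul_bounded_linear)

text \<open>Lebesgue measure is determined by its values on boxes. The preimage of a box under
  \<open>M\<close> is its image under the inverse matrix, whose measure is scaled by the inverse
  determinant; the density cancels this factor.\<close>

lemma lborel_density_distr_matrix:
  fixes M :: "real^2^2"
  assumes "invertible M"
  shows "lborel = density (distr lborel borel ((*v) M)) (\<lambda>_. ennreal \<bar>det M\<bar>)"
proof (rule lborel_eqI)
  obtain N where N: "M ** N = mat 1" "N ** M = mat 1"
    using assms by (auto simp: invertible_def)
  have det: "det M * det N = 1"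
    using arg_cong[OF N(1), of det] by (simp add: det_mul)
  have [measurable]: "(*v) M \<in> borel_measurable borel" by measurable
  fix l u :: "real^2" assume lu: "\<And>b. b \<in> Basis \<Longrightarrow> l \<bullet> b \<le> u \<bullet> b"
  have NM: "N *v (M *v x) = x" "M *v (N *v x) = x" for x
    by (simp_all add: matrix_vector_mul_assoc N)
  have vim: "(*v) M -` box l u = (*v) N ` box l u"
  proof (intro equalityI subsetI)
    fix x assume "x \<in> (*v) M -` box l u"
    then show "x \<in> (*v) N ` box l u"
      using NM(1)[of x] by (intro image_eqI[of _ _ "M *v x"]) auto
  qed (auto simp: NM)
  have lin: "linear ((*v) N)" by simp
  have meas: "(*v) N ` box l u \<in> lmeasurable"
    by (intro measurable_linear_image lin) auto
  have [measurable]: "(*v) N ` box l u \<in> sets borel"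
    using measurable_sets[of "(*v) M" borel borel "box l u"] by (simp add: vim)
  have "emeasure lborel ((*v) N ` box l u) = emeasure lebesgue ((*v) N ` box l u)"
    by (simp add: emeasure_completion)
  also have "\<dots> = ennreal (measure lebesgue ((*v) N ` box l u))"
    using meas by (simp add: emeasure_eq_measure2 fmeasurableD fmeasurableD2)
  also have "measure lebesgue ((*v) N ` box l u) = \<bar>det N\<bar> * measure lebesgue (box l u)"
    using measure_linear_image[OF lin, of "box l u"] by simp
  also have "measure lebesgue (box l u) = (\<Prod>b\<in>Basis. (u - l) \<bullet> b)"
    using lu by (simp add: measure_completion)
  finally have e: "emeasure lborel ((*v) N ` box l u) = ennreal (\<bar>det N\<bar> * (\<Prod>b\<in>Basis. (u - l) \<bullet> b))" .
  have "emeasure (density (distr lborel borel ((*v) M)) (\<lambda>_. ennreal \<bar>det M\<bar>)) (box l u)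
      = ennreal \<bar>det M\<bar> * emeasure lborel ((*v) N ` box l u)"
    by (simp add: emeasure_density nn_integral_cmult_indicator emeasure_distr vim)
  also have "\<dots> = ennreal (\<bar>det M * det N\<bar> * (\<Prod>b\<in>Basis. (u - l) \<bullet> b))"
    unfolding e by (simp add: abs_mult ennreal_mult mult.assoc prod_nonneg lu inner_diff_left)
  finally show "emeasure (density (distr lborel borel ((*v) M)) (\<lambda>_. ennreal \<bar>det M\<bar>)) (box l u)
      = (\<Prod>b\<in>Basis. (u - l) \<bullet> b)"
    using det by simp
qed simp

lemma nn_integral_matrix:
  fixes M :: "real^2^2"
  assumes "invertible M" and [measurable]: "f \<in> borel_measurable borel"
  shows "(\<integral>\<^sup>+x. f x \<partial>lborel) = ennreal \<bar>det M\<bar> * (\<integral>\<^sup>+x. f (M *v x) \<partial>lborel)"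
proof -
  have [measurable]: "(*v) M \<in> borel_measurable borel" by measurable
  show ?thesis
    by (subst lborel_density_distr_matrix[OF assms(1)])
       (simp add: nn_integral_density nn_integral_distr nn_integral_cmult)
qed

lemma integral_matrix:
  fixes M :: "real^2^2" and f :: "real^2 \<Rightarrow> complex"
  assumes "invertible M" and [measurable]: "f \<in> borel_measurable borel"
  shows "(\<integral>x. f x \<partial>lborel) = \<bar>det M\<bar> * (\<integral>x. f (M *v x) \<partial>lborel)"
proof -
  have [measurable]: "(*v) M \<in> borel_measurable borel" by measurable
  show ?thesis
    by (subst lborel_density_distr_matrix[OF assms(1)])
       (simp add: integral_density integral_distr scaleR_conv_of_real)
qed

lemma integrable_matrix:
  fixes M :: "real^2^2" and f :: "real^2 \<Rightarrow> complex"
  assumes "invertible M" "integrable lborel f"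
  shows "integrable lborel (\<lambda>x. f (M *v x))"
proof (rule integrableI_bounded)
  have f [measurable]: "f \<in> borel_measurable borel" using assms(2) by auto
  show "(\<lambda>x. f (M *v x)) \<in> borel_measurable lborel" by measurable
  have "det M \<noteq> 0" using assms(1) by (simp add: invertible_det_nz)
  moreover have "(\<integral>\<^sup>+x. norm (f x) \<partial>lborel) < \<infinity>"
    using assms(2) by (simp add: integrable_iff_bounded)
  ultimately show "(\<integral>\<^sup>+x. norm (f (M *v x)) \<partial>lborel) < \<infinity>"
    using nn_integral_matrix[OF assms(1), of "\<lambda>x. ennreal (norm (f x))"]
    by (auto simp: ennreal_mult_less_top)
qed

lemma AE_matrix:
  fixes M :: "real^2^2"
  assumes "invertible M" "AE x in lborel. P x"
  shows "AE x in lborel. P (M *v x)"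
proof -
  have [measurable]: "(*v) M \<in> borel_measurable borel" by measurable
  have "det M \<noteq> 0" using assms(1) by (simp add: invertible_det_nz)
  then have "AE x in distr lborel borel ((*v) M). P x"
    using assms(2) by (subst (asm) lborel_density_distr_matrix[OF assms(1)]) (auto simp: AE_density)
  then show ?thesis by (rule AE_distrD[rotated]) simp
qed

lemma nn_integral_translation:
  fixes c :: "'a::euclidean_space"
  assumes [measurable]: "f \<in> borel_measurable borel"
  shows "(\<integral>\<^sup>+x. f (x + c) \<partial>lborel) = (\<integral>\<^sup>+x. f x \<partial>lborel)"
  by (subst (2) lborel_distr_plus[of c, symmetric]) (simp add: nn_integral_distr add.commute)

lemma integral_translation:
  fixes c :: "'a::euclidean_space" and f :: "'a \<Rightarrow> complex"
  assumes [measurable]: "f \<in> borel_measurable borel"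
  shows "(\<integral>x. f (x + c) \<partial>lborel) = (\<integral>x. f x \<partial>lborel)"
  by (subst (2) lborel_distr_plus[of c, symmetric]) (simp add: integral_distr add.commute)


section \<open>The integer lattice, its unit cell and its characters\<close>

definition unit_cell :: "(real^2) set" where
  "unit_cell = {x. \<forall>i. - 1 / 2 < x $ i \<and> x $ i \<le> 1 / 2}"

definition int_lattice :: "(real^2) set" where
  "int_lattice = {z. \<forall>i. z $ i \<in> \<int>}"

definition char_fun :: "real^2 \<Rightarrow> real^2 \<Rightarrow> complex" where
  "char_fun z x = cis (2 * pi * (z \<bullet> x))"

definition cell_part :: "real^2 \<Rightarrow> real^2" where
  "cell_part x = (\<chi> i. real_of_int \<lceil>x $ i - 1 / 2\<rceil>)"

lemma int_lattice_simps [simp]: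
  "0 \<in> int_lattice"
  "a \<in> int_lattice \<Longrightarrow> b \<in> int_lattice \<Longrightarrow> a + b \<in> int_lattice"
  "a \<in> int_lattice \<Longrightarrow> b \<in> int_lattice \<Longrightarrow> a - b \<in> int_lattice"
  "a \<in> int_lattice \<Longrightarrow> - a \<in> int_lattice"
  by (auto simp: int_lattice_def)

lemma axis_in_int_lattice [simp]: "axis i 1 \<in> int_lattice"
  by (auto simp: int_lattice_def axis_def)

lemma int_lattice_inner: "a \<in> int_lattice \<Longrightarrow> b \<in> int_lattice \<Longrightarrow> a \<bullet> b \<in> \<int>"
  by (auto simp: int_lattice_def inner_vec_def sum_2 intro!: Ints_mult Ints_add)

lemma int_lattice_image: "int_lattice = range (\<lambda>p :: int \<times> int. vector [of_int (fst p), of_int (snd p)])"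
proof (intro equalityI subsetI)
  fix z assume "z \<in> int_lattice"
  then obtain m n where "z $ 1 = of_int m" "z $ 2 = of_int n"
    by (auto simp: int_lattice_def elim!: Ints_cases) (metis Ints_cases)
  then have "z = vector [of_int (fst (m, n)), of_int (snd (m, n))]"
    by (simp add: vec_eq_iff forall_2)
  then show "z \<in> range (\<lambda>p :: int \<times> int. vector [of_int (fst p), of_int (snd p)])" by blast
qed (auto simp: int_lattice_def forall_2)

lemma countable_int_lattice [simp]: "countable int_lattice"
  by (simp add: int_lattice_image)

lemma char_fun_add: "char_fun z (x + y) = char_fun z x * char_fun z y"
  by (simp add: char_fun_def cis_mult inner_add_right ring_distribs)

lemma char_fun_add_left: "char_fun (z + w) x = char_fun z x * char_fun w x"
  by (simp add: char_fun_def cis_mult inner_add_left ring_distribs)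

lemma char_fun_uminus: "char_fun (- z) x = cnj (char_fun z x)"
  by (simp add: char_fun_def cis_cnj)

lemma char_fun_lattice [simp]:
  assumes "z \<in> int_lattice" "g \<in> int_lattice"
  shows "char_fun z g = 1"
proof -
  obtain n where "z \<bullet> g = of_int n"
    using int_lattice_inner[OF assms] by (auto elim: Ints_cases)
  then show ?thesis
    unfolding char_fun_def by (metis cis_multiple_2pi mult.commute mult.assoc Ints_of_int)
qed

lemma norm_char_fun [simp]: "cmod (char_fun z x) = 1"
  by (simp add: char_fun_def)

lemma char_fun_0 [simp]: "char_fun 0 x = 1"
  by (simp add: char_fun_def)

lemma char_fun_measurable [measurable]: "char_fun z \<in> borel_measurable borel"
  unfolding char_fun_def[abs_def]
  by (intro borel_measurable_continuous_onI continuous_intros)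

lemma unit_cell_measurable [measurable]: "unit_cell \<in> sets borel"
proof -
  have "unit_cell = {x. (- 1 / 2 < x $ 1 \<and> x $ 1 \<le> 1 / 2) \<and> (- 1 / 2 < x $ 2 \<and> x $ 2 \<le> 1 / 2)}"
    by (auto simp: unit_cell_def forall_2)
  also have "\<dots> \<in> sets borel" by measurable
  finally show ?thesis .
qed

lemma emeasure_unit_cell: "emeasure lborel unit_cell = 1"
proof (rule antisym)
  let ?l = "(\<chi> i. - 1 / 2) :: real^2" and ?u = "(\<chi> i. 1 / 2) :: real^2"
  have "?l \<bullet> b \<le> ?u \<bullet> b" if "b \<in> Basis" for b
    using that by (auto simp: Basis_vec_def inner_axis)
  moreover have "(\<Prod>b\<in>Basis. (?u - ?l) \<bullet> b) = 1"
    by (rule prod.neutral) (auto simp: Basis_vec_def inner_axis)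
  ultimately have 1: "emeasure lborel (box ?l ?u) = 1" "emeasure lborel (cbox ?l ?u) = 1"
    unfolding emeasure_lborel_box_eq emeasure_lborel_cbox_eq by (simp_all only: if_True ennreal_1 simp_thms ball_simps) simp_all
  have "box ?l ?u \<subseteq> unit_cell" "unit_cell \<subseteq> cbox ?l ?u"
    by (auto simp: unit_cell_def mem_box_cart less_imp_le)
  then show "emeasure lborel unit_cell \<le> 1" "1 \<le> emeasure lborel unit_cell"
    using emeasure_mono[of "box ?l ?u" unit_cell lborel] emeasure_mono[of unit_cell "cbox ?l ?u" lborel]
    unfolding 1 by simp_all
qed

lemma cell_part_iff:
  assumes "g \<in> int_lattice"
  shows "x - g \<in> unit_cell \<longleftrightarrow> g = cell_part x"
proof -
  have "- 1 / 2 < x $ i - g $ i \<and> x $ i - g $ i \<le> 1 / 2 \<longleftrightarrow> g $ i = real_of_int \<lceil>x $ i - 1 / 2\<rceil>" for i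
  proof -
    obtain n where n: "g $ i = of_int n"
      using assms by (auto simp: int_lattice_def elim: Ints_cases)
    show ?thesis unfolding n of_int_eq_iff by linarith
  qed
  then show ?thesis by (auto simp: unit_cell_def cell_part_def vec_eq_iff)
qed

lemma cell_part_in_lattice [simp]: "cell_part x \<in> int_lattice"
  by (simp add: cell_part_def int_lattice_def)

text \<open>Exactly one lattice point \<open>g\<close> has x - g in the cell. Insert this count as a
  factor 1, exchange sum and integral by Tonelli, and translate each summand back to the
  cell.\<close>

lemma nn_integral_tiling:
  assumes [measurable]: "f \<in> borel_measurable borel"
  shows "(\<integral>\<^sup>+x. f x \<partial>lborel) =
    (\<integral>\<^sup>+x. (\<integral>\<^sup>+g. f (x + g) \<partial>count_space int_lattice) * indicator unit_cell x \<partial>lborel)"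
proof -
  have one: "(\<integral>\<^sup>+g. f x * indicator unit_cell (x - g) \<partial>count_space int_lattice) = f x" for x
  proof -
    have "(\<integral>\<^sup>+g. f x * indicator unit_cell (x - g) \<partial>count_space int_lattice) =
      (\<integral>\<^sup>+g. f x * indicator {cell_part x} g \<partial>count_space int_lattice)"
      by (intro nn_integral_cong) (simp add: cell_part_iff indicator_def)
    then show ?thesis by (simp add: nn_integral_cmult_indicator)
  qed
  have "(\<integral>\<^sup>+x. f x \<partial>lborel) =
      (\<integral>\<^sup>+x. \<integral>\<^sup>+g. f x * indicator unit_cell (x - g) \<partial>count_space int_lattice \<partial>lborel)"
    by (simp add: one)
  also have "\<dots> = (\<integral>\<^sup>+g. \<integral>\<^sup>+x. f x * indicator unit_cell (x - g) \<partial>lborel \<partial>count_space int_lattice)"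
    by (intro nn_integral_count_space_nn_integral) auto
  also have "\<dots> = (\<integral>\<^sup>+g. \<integral>\<^sup>+x. f (x + g) * indicator unit_cell x \<partial>lborel \<partial>count_space int_lattice)"
  proof (rule nn_integral_cong)
    fix g
    show "(\<integral>\<^sup>+x. f x * indicator unit_cell (x - g) \<partial>lborel) =
          (\<integral>\<^sup>+x. f (x + g) * indicator unit_cell x \<partial>lborel)"
      using nn_integral_translation[of "\<lambda>x. f x * indicator unit_cell (x - g)" g] by simp
  qed
  also have "\<dots> = (\<integral>\<^sup>+x. \<integral>\<^sup>+g. f (x + g) * indicator unit_cell x \<partial>count_space int_lattice \<partial>lborel)"
    by (intro nn_integral_count_space_nn_integral[symmetric]) auto
  also have "\<dots> = (\<integral>\<^sup>+x. (\<integral>\<^sup>+g. f (x + g) \<partial>count_space int_lattice) * indicator unit_cell x \<partial>lborel)"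
    by (intro nn_integral_cong nn_integral_multc) auto
  finally show ?thesis .
qed

lemma nn_integral_lattice_shift:
  assumes "a \<in> int_lattice"
  shows "(\<integral>\<^sup>+g. f (g + a) \<partial>count_space int_lattice) = (\<integral>\<^sup>+g. f g \<partial>count_space int_lattice)"
proof (rule nn_integral_bij_count_space)
  show "bij_betw (\<lambda>g. g + a) int_lattice int_lattice"
    by (rule bij_betw_byWitness[where f' = "\<lambda>g. g - a"]) (use assms in auto)
qed

text \<open>Tile the integral over the shifted cell: periodicity takes \<open>f\<close> out of the
  lattice sum, and every point has exactly one translate in the shifted cell.\<close>

lemma nn_integral_unit_cell_shift:
  assumes [measurable]: "f \<in> borel_measurable borel"
    and periodic: "\<And>x g. g \<in> int_lattice \<Longrightarrow> f (x + g) = f x"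
  shows "(\<integral>\<^sup>+x. f (x + t) * indicator unit_cell x \<partial>lborel) = (\<integral>\<^sup>+x. f x * indicator unit_cell x \<partial>lborel)"
proof -
  have one: "(\<integral>\<^sup>+g. f x * indicator unit_cell (x + g - t) \<partial>count_space int_lattice) = f x" for x
  proof -
    have "(\<integral>\<^sup>+g. f x * indicator unit_cell (x + g - t) \<partial>count_space int_lattice) =
      (\<integral>\<^sup>+g. f x * indicator {- cell_part (x - t)} g \<partial>count_space int_lattice)"
    proof (intro nn_integral_cong)
      fix g assume "g \<in> space (count_space int_lattice)"
      then have "x + g - t \<in> unit_cell \<longleftrightarrow> - g = cell_part (x - t)"
        using cell_part_iff[of "- g" "x - t"] by (simp add: algebra_simps)
      also have "\<dots> \<longleftrightarrow> g = - cell_part (x - t)" by (metis minus_minus)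
      finally show "f x * indicator unit_cell (x + g - t) = f x * indicator {- cell_part (x - t)} g"
        by (simp add: indicator_def)
    qed
    then show ?thesis by (simp add: nn_integral_cmult_indicator)
  qed
  have "(\<integral>\<^sup>+x. f (x + t) * indicator unit_cell x \<partial>lborel) = (\<integral>\<^sup>+x. f x * indicator unit_cell (x - t) \<partial>lborel)"
    using nn_integral_translation[of "\<lambda>x. f x * indicator unit_cell (x - t)" t] by simp
  also have "\<dots> = (\<integral>\<^sup>+x. (\<integral>\<^sup>+g. f (x + g) * indicator unit_cell (x + g - t) \<partial>count_space int_lattice) *
      indicator unit_cell x \<partial>lborel)"
    by (rule nn_integral_tiling) measurable
  also have "\<dots> = (\<integral>\<^sup>+x. (\<integral>\<^sup>+g. f x * indicator unit_cell (x + g - t) \<partial>count_space int_lattice) *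
      indicator unit_cell x \<partial>lborel)"
    by (intro nn_integral_cong arg_cong2[where f = "(*)"] refl) (simp add: periodic)
  finally show ?thesis by (simp add: one)
qed

lemma integrable_unit_cell_bounded:
  fixes f :: "real^2 \<Rightarrow> 'a::{banach, second_countable_topology}"
  assumes [measurable]: "f \<in> borel_measurable borel" and "\<And>x. norm (f x) \<le> B"
  shows "integrable lborel (\<lambda>x. indicator unit_cell x *\<^sub>R f x)"
proof (rule Bochner_Integration.integrable_bound)
  show "integrable lborel (\<lambda>x. B * indicator unit_cell x :: real)"
    by (intro integrable_mult_right integrable_real_indicator) (auto simp: emeasure_unit_cell)
  show "AE x in lborel. norm (indicator unit_cell x *\<^sub>R f x) \<le> norm (B * indicator unit_cell x :: real)"
    using order_trans[OF assms(2) abs_ge_self] by (auto simp: indicator_def)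
qed measurable

lemma integral_unit_cell_shift:
  fixes f :: "real^2 \<Rightarrow> real"
  assumes [measurable]: "f \<in> borel_measurable borel" and f: "\<And>x. 0 \<le> f x"
    and periodic: "\<And>x g. g \<in> int_lattice \<Longrightarrow> f (x + g) = f x"
  shows "(\<integral>x. indicator unit_cell x * f (x + t) \<partial>lborel) = (\<integral>x. indicator unit_cell x * f x \<partial>lborel)"
proof -
  have *: "ennreal (indicator unit_cell x * f y) = ennreal (f y) * indicator unit_cell x" for x y
    by (simp add: indicator_def)
  have "(\<integral>\<^sup>+x. ennreal (indicator unit_cell x * f (x + t)) \<partial>lborel) =
        (\<integral>\<^sup>+x. ennreal (indicator unit_cell x * f x) \<partial>lborel)"
    unfolding * by (rule nn_integral_unit_cell_shift) (auto simp: periodic)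
  then show ?thesis
    by (simp add: integral_eq_nn_integral f)
qed

text \<open>Orthogonality comes from shift invariance, because \<open>t r\<close> moves z \<bullet>
  x by exactly r. A half period shows that the cosine integral equals its own negative, and a
  quarter period turns cosine into sine. The summand 1 keeps the integrands nonnegative, as
  \<open>integral_unit_cell_shift\<close> demands.\<close>

lemma integral_char_fun:
  assumes z: "z \<in> int_lattice" "z \<noteq> 0"
  shows "(\<integral>x. indicator unit_cell x *\<^sub>R char_fun z x \<partial>lborel) = 0"
proof -
  let ?I = "\<lambda>f :: real \<Rightarrow> real. \<integral>x. indicator unit_cell x * (1 + f (2 * pi * (z \<bullet> x))) \<partial>lborel"
  have int: "integrable lborel (\<lambda>x. indicator unit_cell x * f x :: real)"
    if "f \<in> borel_measurable borel" "\<And>x. norm (f x) \<le> B" for f B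
    using integrable_unit_cell_bounded[OF that] by simp
  define t where "t = (\<lambda>r :: real. (r / (z \<bullet> z)) *\<^sub>R z)"
  have zt: "z \<bullet> (x + t r) = z \<bullet> x + r" for x r
    using z by (simp add: t_def inner_add_right)
  have per: "cos (2 * pi * (z \<bullet> (x + g))) = cos (2 * pi * (z \<bullet> x))"
            "sin (2 * pi * (z \<bullet> (x + g))) = sin (2 * pi * (z \<bullet> x))" if "g \<in> int_lattice" for x g
    using char_fun_add[of z x g] char_fun_lattice[OF z(1) that]
    by (simp_all add: char_fun_def complex_eq_iff)
  have ge: "0 \<le> 1 + cos y" "0 \<le> 1 + sin y" for y :: real
    using cos_ge_minus_one[of y] sin_ge_minus_one[of y] by linarith+
  have cos: "?I (\<lambda>y. cos (y + 2 * pi * r)) = ?I cos" for r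
    using integral_unit_cell_shift[of "\<lambda>x. 1 + cos (2 * pi * (z \<bullet> x))" "t r"] per ge
    by (simp add: zt ring_distribs)
  have half: "?I (\<lambda>y. - cos y) = ?I cos"
    using cos[of "1/2"] by (simp add: cos_add)
  have quarter: "?I sin = ?I cos"
  proof -
    have "cos (y + 2 * pi * (- 1 / 4)) = sin y" for y
      by (simp add: cos_diff)
    then show ?thesis using cos[of "- 1 / 4"] by simp
  qed
  have split: "?I (\<lambda>y. c * f y) = measure lborel unit_cell + c * (\<integral>x. indicator unit_cell x * f (2 * pi * (z \<bullet> x)) \<partial>lborel)"
    if f: "f \<in> borel_measurable borel" "\<And>x. norm (f x) \<le> 1" for f :: "real \<Rightarrow> real" and c
  proof -
    have "integrable lborel (\<lambda>x. indicator unit_cell x * f (2 * pi * (z \<bullet> x)) :: real)"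
      using f by (intro int[where B = 1]) auto
    moreover have "integrable lborel (indicator unit_cell :: _ \<Rightarrow> real)"
      using int[of "\<lambda>_. 1" 1] by simp
    ultimately show ?thesis by (simp add: ring_distribs mult.left_commute)
  qed
  have c0: "(\<integral>x. indicator unit_cell x * cos (2 * pi * (z \<bullet> x)) \<partial>lborel) = 0"
    using half split[of cos 1] split[of cos "-1"] by simp
  have s0: "(\<integral>x. indicator unit_cell x * sin (2 * pi * (z \<bullet> x)) \<partial>lborel) = 0"
    using quarter c0 split[of cos 1] split[of sin 1] by simp
  have i: "integrable lborel (\<lambda>x. indicator unit_cell x *\<^sub>R char_fun z x)"
    by (rule integrable_unit_cell_bounded[where B = 1]) auto
  show ?thesis
    using c0 s0 integral_Re[OF i] integral_Im[OF i]
    by (simp add: complex_eq_iff char_fun_def)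
qed


section \<open>Parseval's identity on the unit cell\<close>

text \<open>The image lies in a compact set, where Stone-Weierstrass applies, and the two
  coordinates are the characters of the unit vectors.\<close>

definition torus_map :: "real^2 \<Rightarrow> complex \<times> complex" where
  "torus_map x = (cis (2 * pi * x $ 1), cis (2 * pi * x $ 2))"

abbreviation torus :: "(complex \<times> complex) set" where
  "torus \<equiv> sphere 0 1 \<times> sphere 0 1"

lemma torus_map_in_torus [simp]: "torus_map x \<in> torus"
  by (simp add: torus_map_def)

lemma torus_map_measurable [measurable]: "torus_map \<in> borel_measurable borel"
  unfolding torus_map_def[abs_def] by (intro borel_measurable_continuous_onI continuous_intros)

lemma integrable_mult_bounded:
  fixes h g :: "real^2 \<Rightarrow> complex"
  assumes "integrable lborel h" "g \<in> borel_measurable borel" "\<And>x. cmod (g x) \<le> B"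
  shows "integrable lborel (\<lambda>x. h x * g x)"
proof (rule Bochner_Integration.integrable_bound)
  show "integrable lborel (\<lambda>x. of_real B * h x)" using assms(1) by simp
  have [measurable]: "h \<in> borel_measurable borel" "g \<in> borel_measurable borel" using assms by auto
  show "(\<lambda>x. h x * g x) \<in> borel_measurable lborel" by measurable
  show "AE x in lborel. norm (h x * g x) \<le> norm (of_real B * h x)"
  proof (intro AE_I2)
    fix x
    have "cmod (h x) * cmod (g x) \<le> cmod (h x) * B"
      using assms(3) by (intro mult_left_mono) auto
    also have "\<dots> \<le> \<bar>B\<bar> * cmod (h x)"
      by (simp add: mult.commute mult_right_mono)
    finally show "norm (h x * g x) \<le> norm (of_real B * h x)"
      by (simp add: norm_mult)
  qed
qed

text \<open>The integrals run over the whole plane, so these are the coefficients of the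
  periodization of \<open>h\<close>. Support in the unit cell is added only where \<open>h\<close>
  itself has to be recovered.\<close>

definition vanishing_coefs :: "(real^2 \<Rightarrow> complex) \<Rightarrow> bool" where
  "vanishing_coefs h \<longleftrightarrow> integrable lborel h \<and>
     (\<forall>z\<in>int_lattice. (\<integral>x. h x * char_fun z x \<partial>lborel) = 0)"

lemma vanishing_coefs_add:
  assumes "vanishing_coefs f" "vanishing_coefs g"
  shows "vanishing_coefs (\<lambda>x. f x + g x)"
proof -
  have "integrable lborel (\<lambda>x. f x * char_fun z x)" "integrable lborel (\<lambda>x. g x * char_fun z x)" for z
    using assms by (auto simp: vanishing_coefs_def intro!: integrable_mult_bounded[where B = 1])
  then show ?thesis using assms by (simp add: vanishing_coefs_def ring_distribs)
qed

lemma vanishing_coefs_cmult: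
  assumes "vanishing_coefs f" shows "vanishing_coefs (\<lambda>x. f x * c)"
  using assms by (simp add: vanishing_coefs_def mult.commute[of _ c] mult.assoc)

lemma vanishing_coefs_char:
  assumes "vanishing_coefs f" "w \<in> int_lattice" shows "vanishing_coefs (\<lambda>x. f x * char_fun w x)"
  using assms
  by (auto simp: vanishing_coefs_def mult.assoc char_fun_add_left[symmetric]
      intro!: integrable_mult_bounded[where B = 1])

text \<open>
  Uniqueness of Fourier coefficients: multiplication by a polynomial in the coordinates of the
  torus preserves vanishing of all coefficients, and Stone-Weierstrass passes from polynomials to
  continuous functions, then to indicators of Borel sets.
\<close>

lemma vanishing_coefs_polynomial:
  assumes "real_polynomial_function p" "vanishing_coefs h"
  shows "vanishing_coefs (\<lambda>x. h x * of_real (p (torus_map x)))"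
  using assms
proof (induction arbitrary: h)
  case (linear p)
  define e where "e = (\<lambda>i. axis i 1 :: real^2)"
  have e: "e i \<in> int_lattice" "- e i \<in> int_lattice" for i by (simp_all add: e_def)
  \<comment> \<open>Euler's formulas reduce the real coordinates to characters, and multiplication
    by a character only permutes the coefficients.\<close>
  have cs: "complex_of_real (cos (2 * pi * x $ i)) = char_fun (e i) x * (1/2) + char_fun (- e i) x * (1/2)"
    "complex_of_real (sin (2 * pi * x $ i)) = char_fun (e i) x * (- \<i>/2) + char_fun (- e i) x * (\<i>/2)" for x i
    by (simp_all add: char_fun_def e_def inner_axis inner_axis' complex_eq_iff)
  have van: "vanishing_coefs (\<lambda>x. h x * of_real (cos (2 * pi * x $ i)))"
       "vanishing_coefs (\<lambda>x. h x * of_real (sin (2 * pi * x $ i)))" for i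
    unfolding cs distrib_left mult.assoc[symmetric]
    by (intro vanishing_coefs_add vanishing_coefs_cmult vanishing_coefs_char linear e)+
  interpret p: bounded_linear p by (rule linear(1))
  \<comment> \<open>\<open>p\<close> is merely real-linear on C x C, so the expansion uses four real
    directions.\<close>
  have "torus_map x = cos (2 * pi * x $ 1) *\<^sub>R (1, 0) + sin (2 * pi * x $ 1) *\<^sub>R (\<i>, 0)
      + cos (2 * pi * x $ 2) *\<^sub>R (0, 1) + sin (2 * pi * x $ 2) *\<^sub>R (0, \<i>)" for x
    by (simp add: torus_map_def complex_eq_iff)
  then have "p (torus_map x) = cos (2 * pi * x $ 1) * p (1, 0) + sin (2 * pi * x $ 1) * p (\<i>, 0)
      + cos (2 * pi * x $ 2) * p (0, 1) + sin (2 * pi * x $ 2) * p (0, \<i>)" for x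
    by (simp only: p.add p.scaleR real_scaleR_def)
  then have "(\<lambda>x. h x * of_real (p (torus_map x))) = (\<lambda>x.
        h x * of_real (cos (2 * pi * x $ 1)) * of_real (p (1, 0))
      + h x * of_real (sin (2 * pi * x $ 1)) * of_real (p (\<i>, 0))
      + h x * of_real (cos (2 * pi * x $ 2)) * of_real (p (0, 1))
      + h x * of_real (sin (2 * pi * x $ 2)) * of_real (p (0, \<i>)))"
    by (simp add: ring_distribs mult.assoc)
  then show ?case
    by (simp only:) (intro vanishing_coefs_add vanishing_coefs_cmult van)
next
  case (const c)
  then show ?case by (intro vanishing_coefs_cmult)
next
  case (add f g)
  then show ?case by (simp add: ring_distribs vanishing_coefs_add)
next
  \<comment> \<open>\<open>h\<close> times the first factor serves as the new \<open>h\<close> for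
    the second; hence the induction over arbitrary \<open>h\<close>.\<close>
  case (mult f g)
  then show ?case using mult.IH(2)[OF mult.IH(1)[OF mult.prems]] by (simp add: mult.assoc)
qed

lemma vanishing_coefs_continuous:
  assumes h: "vanishing_coefs h" and F: "continuous_on UNIV F"
  shows "(\<integral>x. h x * of_real (F (torus_map x)) \<partial>lborel) = 0"
proof -
  have hi: "integrable lborel h" using h by (simp add: vanishing_coefs_def)
  have [measurable]: "F \<in> borel_measurable borel" by (intro borel_measurable_continuous_onI F)
  have FT: "continuous_on torus F" using F continuous_on_subset by blast
  have cT: "compact torus" by (intro compact_Times) auto
  obtain B where B: "\<And>y. y \<in> torus \<Longrightarrow> norm (F y) \<le> B"
    using compact_imp_bounded[OF compact_continuous_image[OF FT cT]] by (auto simp: bounded_iff)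
  have iF: "integrable lborel (\<lambda>x. h x * of_real (F (torus_map x)))"
    by (rule integrable_mult_bounded[OF hi, where B = B]) (use B[OF torus_map_in_torus] in auto)
  have small: "cmod (\<integral>x. h x * of_real (F (torus_map x)) \<partial>lborel) \<le> e * (\<integral>x. cmod (h x) \<partial>lborel)"
    if "e > 0" for e
  proof -
    obtain g where g: "real_polynomial_function g" "\<And>y. y \<in> torus \<Longrightarrow> \<bar>F y - g y\<bar> < e"
      using Stone_Weierstrass_real_polynomial_function[OF cT FT \<open>e > 0\<close>] by metis
    have v: "vanishing_coefs (\<lambda>x. h x * of_real (g (torus_map x)))"
      by (rule vanishing_coefs_polynomial[OF g(1) h])
    then have "(\<integral>x. h x * of_real (g (torus_map x)) \<partial>lborel) = 0"
      and ig: "integrable lborel (\<lambda>x. h x * of_real (g (torus_map x)))"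
      by (auto simp: vanishing_coefs_def dest: bspec[where x = 0])
    then have "(\<integral>x. h x * of_real (F (torus_map x)) \<partial>lborel) =
        (\<integral>x. h x * of_real (F (torus_map x)) - h x * of_real (g (torus_map x)) \<partial>lborel)"
      using iF by simp
    also have "cmod \<dots> \<le> (\<integral>x. e * cmod (h x) \<partial>lborel)"
    proof (rule Bochner_Integration.integral_norm_bound_integral)
      fix x
      have "h x * of_real (F (torus_map x)) - h x * of_real (g (torus_map x)) =
          h x * of_real (F (torus_map x) - g (torus_map x))" by (simp add: ring_distribs)
      then have "cmod (h x * of_real (F (torus_map x)) - h x * of_real (g (torus_map x))) =
          cmod (h x) * \<bar>F (torus_map x) - g (torus_map x)\<bar>" by (simp only: norm_mult norm_of_real)
      also have "\<dots> \<le> cmod (h x) * e"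
        using g(2)[OF torus_map_in_torus, of x] by (intro mult_left_mono) auto
      finally show "cmod (h x * of_real (F (torus_map x)) - h x * of_real (g (torus_map x))) \<le> e * cmod (h x)"
        by (simp add: mult.commute)
    qed (use iF ig hi in auto)
    finally show ?thesis by simp
  qed
  have "cmod (\<integral>x. h x * of_real (F (torus_map x)) \<partial>lborel) \<le> 0"
  proof (rule tendsto_lowerbound[where F = "at_right 0"])
    show "((\<lambda>e. e * (\<integral>x. cmod (h x) \<partial>lborel)) \<longlongrightarrow> 0) (at_right 0)"
      by (auto intro!: tendsto_eq_intros)
    show "\<forall>\<^sub>F e in at_right 0. cmod (\<integral>x. h x * of_real (F (torus_map x)) \<partial>lborel) \<le> e * (\<integral>x. cmod (h x) \<partial>lborel)"
      using eventually_at_right_less[of "0::real"] by eventually_elim (rule small)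
  qed simp
  then show ?thesis by simp
qed

lemma vanishing_coefs_closed:
  assumes h: "vanishing_coefs h" and C: "closed C"
  shows "(\<integral>x. h x * indicator C (torus_map x) \<partial>lborel) = 0"
proof (cases "C = {}")
  case False
  have hi: "integrable lborel h" using h by (simp add: vanishing_coefs_def)
  then have [measurable]: "h \<in> borel_measurable borel" by auto
  have [measurable]: "C \<in> sets borel" using C by simp
  \<comment> \<open>These cut-offs tend to the indicator of \<open>C\<close>, since a point outside
    a closed set has positive distance from it. The empty set is treated apart because
    \<open>infdist\<close> to it is 0 by convention.\<close>
  define F where "F = (\<lambda>n y. max 0 (1 - real n * infdist y C))"
  have cF: "continuous_on UNIV (F n)" for n
    unfolding F_def by (intro continuous_intros)
  have [measurable]: "F n \<in> borel_measurable borel" for n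
    by (intro borel_measurable_continuous_onI cF)
  have F01: "\<bar>F n y\<bar> \<le> 1" for n y
    using infdist_nonneg[of y C] by (auto simp: F_def)
  have limF: "(\<lambda>n. F n y) \<longlonglongrightarrow> indicator C y" for y
  proof (cases "y \<in> C")
    case True
    then show ?thesis by (simp add: F_def)
  next
    case F: False
    then have pos: "0 < infdist y C"
      using in_closed_iff_infdist_zero[OF C False, of y] infdist_nonneg[of y C] by linarith
    then obtain N where N: "1 < real N * infdist y C"
      using reals_Archimedean3 by blast
    have "F n y = 0" if "n \<ge> N" for n
    proof -
      have "real N * infdist y C \<le> real n * infdist y C"
        using that pos by (intro mult_right_mono) auto
      with N show ?thesis by (simp add: F_def)
    qed
    then have "\<forall>\<^sub>F n in sequentially. F n y = indicator C y"
      using F by (auto simp: eventually_sequentially)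
    then show ?thesis by (rule tendsto_eventually)
  qed
  have "(\<lambda>n. \<integral>x. h x * of_real (F n (torus_map x)) \<partial>lborel) \<longlonglongrightarrow>
      (\<integral>x. h x * of_real (indicator C (torus_map x)) \<partial>lborel)"
  proof (rule integral_dominated_convergence)
    show "integrable lborel (\<lambda>x. cmod (h x))" using hi by simp
    show "AE x in lborel. (\<lambda>n. h x * of_real (F n (torus_map x))) \<longlonglongrightarrow> h x * of_real (indicator C (torus_map x))"
      by (intro AE_I2 tendsto_intros limF)
    show "AE x in lborel. norm (h x * of_real (F n (torus_map x))) \<le> cmod (h x)" for n
      using mult_left_mono[OF F01 norm_ge_zero, of "h _" n] by (simp add: norm_mult)
  qed measurable
  moreover have "(\<integral>x. h x * of_real (F n (torus_map x)) \<partial>lborel) = 0" for n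
    by (rule vanishing_coefs_continuous[OF h cF])
  ultimately have "(\<integral>x. h x * of_real (indicator C (torus_map x)) \<partial>lborel) = 0"
    by (simp add: LIMSEQ_const_iff)
  then show ?thesis by (simp add: of_real_indicator)
qed simp

text \<open>The sets over which the integral vanishes form a Dynkin system, and the closed sets are
  a generator stable under intersection. Complements are covered by the coefficient at 0, which is
  the integral of \<open>h\<close>.\<close>

lemma vanishing_coefs_borel:
  assumes h: "vanishing_coefs h" and A: "A \<in> sets borel"
  shows "(\<integral>x. h x * indicator A (torus_map x) \<partial>lborel) = 0"
proof -
  have hi: "integrable lborel h" using h by (simp add: vanishing_coefs_def)
  then have [measurable]: "h \<in> borel_measurable borel" by auto
  have h0: "(\<integral>x. h x \<partial>lborel) = 0"
    using h by (auto simp: vanishing_coefs_def dest: bspec[where x = 0])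
  have ind: "integrable lborel (\<lambda>x. h x * indicator A (torus_map x))" if [measurable]: "A \<in> sets borel" for A
    by (rule integrable_mult_bounded[OF hi, where B = 1]) (auto simp: indicator_def)
  have "Int_stable {C :: (complex \<times> complex) set. closed C}"
    "{C :: (complex \<times> complex) set. closed C} \<subseteq> Pow UNIV"
    "A \<in> sigma_sets UNIV {C :: (complex \<times> complex) set. closed C}"
    using A by (auto simp: borel_eq_closed Int_stable_def)
  then show ?thesis
  proof (induction rule: sigma_sets_induct_disjoint)
    case (basic C)
    then show ?case using vanishing_coefs_closed[OF h] by simp
  next
    case (compl A)
    have [measurable]: "A \<in> sets borel" using compl by (simp add: borel_eq_closed)
    have "(\<integral>x. h x * indicator (UNIV - A) (torus_map x) \<partial>lborel) =
        (\<integral>x. h x - h x * indicator A (torus_map x) \<partial>lborel)"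
      by (intro Bochner_Integration.integral_cong refl) (auto simp: indicator_def)
    then show ?case using compl by (simp add: hi ind h0)
  next
    case (union A)
    have [measurable]: "A i \<in> sets borel" for i
      using union by (auto simp: borel_eq_closed)
    have [measurable]: "(\<Union>i. A i) \<in> sets borel" "(\<Union>i<n. A i) \<in> sets borel" for n
      by (intro sets.countable_UN sets.finite_UN; auto)+
    have "(\<lambda>n. \<integral>x. h x * indicator (\<Union>i<n. A i) (torus_map x) \<partial>lborel) \<longlonglongrightarrow>
        (\<integral>x. h x * indicator (\<Union>i. A i) (torus_map x) \<partial>lborel)"
    proof (rule integral_dominated_convergence)
      show "integrable lborel (\<lambda>x. cmod (h x))" using hi by simp
      show "AE x in lborel. (\<lambda>n. h x * indicator (\<Union>i<n. A i) (torus_map x)) \<longlonglongrightarrow> h x * indicator (\<Union>i. A i) (torus_map x)"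
        by (intro AE_I2 tendsto_intros LIMSEQ_indicator_UN)
      show "AE x in lborel. norm (h x * indicator (\<Union>i<n. A i) (torus_map x)) \<le> cmod (h x)" for n
        by (auto simp: norm_mult indicator_def)
    qed measurable
    moreover have "(\<integral>x. h x * indicator (\<Union>i<n. A i) (torus_map x) \<partial>lborel) = 0" for n
    proof -
      have "indicator (\<Union>i<n. A i) y = (\<Sum>i<n. indicator (A i) y :: complex)" for y
        using indicator_UN_disjoint[of "{..<n}" A y] union(1)
        by (simp add: disjoint_family_on_def)
      then have "(\<integral>x. h x * indicator (\<Union>i<n. A i) (torus_map x) \<partial>lborel) =
          (\<integral>x. (\<Sum>i<n. h x * indicator (A i) (torus_map x)) \<partial>lborel)"
        by (simp only: sum_distrib_left)
      also have "\<dots> = (\<Sum>i<n. \<integral>x. h x * indicator (A i) (torus_map x) \<partial>lborel)"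
        by (intro Bochner_Integration.integral_sum ind) simp
      finally show ?thesis by (simp only: union(3) sum.neutral_const)
    qed
    ultimately show ?case by (simp add: LIMSEQ_const_iff)
  qed simp
qed

text \<open>On the unit cell \<open>torus_map\<close> has the Borel left inverse \<open>r\<close>.
  The integral of \<open>h\<close> over any Borel set \<open>S\<close> is therefore one over a
  preimage under \<open>torus_map\<close>, and all of those vanish.\<close>

theorem vanishing_coefs_AE_0:
  assumes h: "vanishing_coefs h" and supp: "\<And>x. x \<notin> unit_cell \<Longrightarrow> h x = 0"
  shows "AE x in lborel. h x = 0"
proof (rule sigma_finite_measure.density_zero[OF sigma_finite_lborel])
  show hi: "integrable lborel h" using h by (simp add: vanishing_coefs_def)
  fix S :: "(real^2) set" assume "S \<in> sets lborel"
  then have [measurable]: "S \<in> sets borel" by simp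
  define r where "r = (\<lambda>y :: complex \<times> complex.
    vector [Im (Ln (fst y)) / (2 * pi), Im (Ln (snd y)) / (2 * pi)] :: real^2)"
  have r: "r (torus_map x) = x" if "x \<in> unit_cell" for x
  proof -
    have "Ln (cis (2 * pi * x $ i)) = \<i> * of_real (2 * pi * x $ i)" for i
    proof -
      \<comment> \<open>The cell is half open at the same end as the range (-pi, pi] of the
        imaginary part of \<open>Ln\<close>, so the inversion is exact on the boundary too.\<close>
      have i: "- 1 / 2 < x $ i" "x $ i \<le> 1 / 2" using that by (auto simp: unit_cell_def)
      have "pi * (- 1 / 2) < pi * x $ i" "pi * x $ i \<le> pi * (1 / 2)"
        using i by (intro mult_strict_left_mono mult_left_mono; simp)+
      then show ?thesis
        unfolding cis_conv_exp by (intro Ln_exp) (simp_all add: mult.assoc)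
    qed
    then show ?thesis by (simp add: r_def torus_map_def vec_eq_iff forall_2)
  qed
  have rv: "r y = (Im (Ln (fst y)) / (2 * pi)) *\<^sub>R axis 1 1 + (Im (Ln (snd y)) / (2 * pi)) *\<^sub>R axis 2 1" for y
    by (simp add: r_def vec_eq_iff forall_2 axis_def)
  have [measurable]: "r \<in> borel_measurable borel"
    unfolding rv[abs_def] borel_prod[symmetric] by measurable
  have "r -` S \<in> sets borel"
    using measurable_sets[of r borel borel S] by simp
  then have "(\<integral>x. h x * indicator (r -` S) (torus_map x) \<partial>lborel) = 0"
    by (rule vanishing_coefs_borel[OF h])
  also have "(\<lambda>x. h x * indicator (r -` S) (torus_map x)) = (\<lambda>x. indicator S x *\<^sub>R h x)"
    using r supp by (fastforce simp: indicator_def fun_eq_iff)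
  finally show "set_lebesgue_integral lborel S h = 0"
    by (simp add: set_lebesgue_integral_def)
qed


section \<open>The orthonormal system of characters and its completeness\<close>

definition cell_char :: "real^2 \<Rightarrow> real^2 \<Rightarrow> complex" where
  "cell_char z x = indicator unit_cell x * char_fun (- z) x"

lemma cell_char_measurable [measurable]: "cell_char z \<in> borel_measurable borel"
  unfolding cell_char_def[abs_def] by measurable

lemma square_integrable_cell_char [simp]: "square_integrable (cell_char z)"
proof -
  have "(cmod (cell_char z x))\<^sup>2 = indicator unit_cell x" for x
    by (simp add: cell_char_def indicator_def)
  then show ?thesis
    by (simp add: square_integrable_def emeasure_unit_cell)
qed

text \<open>The sign in \<open>cell_char\<close> is chosen so that the conjugation in
  \<open>l2_inner\<close> produces \<open>char_fun z\<close>, the form in which coefficients appear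
  throughout.\<close>

lemma l2_inner_cell_char:
  assumes "\<And>x. x \<notin> unit_cell \<Longrightarrow> h x = 0"
  shows "l2_inner h (cell_char z) = (\<integral>x. h x * char_fun z x \<partial>lborel)"
  unfolding l2_inner_def
  by (intro Bochner_Integration.integral_cong refl)
     (use assms in \<open>auto simp: cell_char_def char_fun_uminus indicator_def\<close>)

lemma cell_char_orthonormal:
  assumes "z \<in> int_lattice" "w \<in> int_lattice"
  shows "l2_inner (cell_char z) (cell_char w) = (if z = w then 1 else 0)"
proof -
  have "l2_inner (cell_char z) (cell_char w) = (\<integral>x. cell_char z x * char_fun w x \<partial>lborel)"
    by (rule l2_inner_cell_char) (simp add: cell_char_def)
  also have "(\<lambda>x. cell_char z x * char_fun w x) = (\<lambda>x. indicator unit_cell x *\<^sub>R char_fun (w - z) x)"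
    using char_fun_add_left[of "- z" w]
    by (auto simp: cell_char_def indicator_def fun_eq_iff)
  finally show ?thesis
    using assms integral_char_fun[of "w - z"]
    by (auto simp: emeasure_unit_cell measure_def)
qed

lemma square_integrable_cell_integrable:
  assumes "square_integrable h" "\<And>x. x \<notin> unit_cell \<Longrightarrow> h x = 0"
  shows "integrable lborel h"
proof -
  have "integrable lborel (\<lambda>x. h x * cnj (cell_char 0 x))"
    by (intro integrable_l2_product assms) simp
  also have "(\<lambda>x. h x * cnj (cell_char 0 x)) = h"
    using assms(2) by (auto simp: cell_char_def indicator_def fun_eq_iff)
  finally show ?thesis .
qed

lemma infinite_int_lattice: "infinite int_lattice"
proof -
  have "inj (\<lambda>n::nat. real n *\<^sub>R axis 1 1 :: real^2)"
    by (auto simp: inj_on_def vec_eq_iff axis_def)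
  moreover have "range (\<lambda>n::nat. real n *\<^sub>R axis 1 1 :: real^2) \<subseteq> int_lattice"
    by (auto simp: int_lattice_def axis_def)
  ultimately show ?thesis
    using infinite_super range_inj_infinite by blast
qed

text \<open>Bessel's inequality makes the partial sums Cauchy. Their limit \<open>g\<close> has the
  same coefficients as \<open>h\<close>, so uniqueness of coefficients identifies the two on the
  cell, and the norms of the partial sums converge to that of \<open>h\<close>.\<close>

theorem Parseval_unit_cell:
  assumes h: "square_integrable h" and supp: "\<And>x. x \<notin> unit_cell \<Longrightarrow> h x = 0"
  shows "(\<integral>\<^sup>+z. ennreal ((cmod (\<integral>x. h x * char_fun z x \<partial>lborel))\<^sup>2) \<partial>count_space int_lattice) =
    ennreal ((l2_norm h)\<^sup>2)"
proof -
  define en where "en = from_nat_into int_lattice"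
  have bij: "bij_betw en UNIV int_lattice"
    unfolding en_def using infinite_int_lattice by (intro bij_betw_from_nat_into) auto
  have en: "en k \<in> int_lattice" and en_eq: "en j = en k \<longleftrightarrow> j = k" for j k
    using bij by (auto simp: bij_betw_def inj_on_def)
  define c where "c = (\<lambda>k. cell_char (en k))"
  have c [simp]: "square_integrable (c k)" for k by (simp add: c_def)
  have cc: "l2_inner (c j) (c k) = (if j = k then 1 else 0)" for j k
    by (simp add: c_def cell_char_orthonormal en en_eq)
  define a where "a = (\<lambda>k. l2_inner h (c k))"
  have a: "a k = (\<integral>x. h x * char_fun (en k) x \<partial>lborel)" for k
    unfolding a_def c_def by (rule l2_inner_cell_char[OF supp])
  define S where "S = (\<lambda>I x. \<Sum>k\<in>I. a k * c k x)"
  have S: "square_integrable (S I)" for I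
    unfolding S_def by (intro square_integrable_sum square_integrable_cmult c)
  have Sc: "l2_inner (S I) (c k) = (if k \<in> I then a k else 0)" if "finite I" for I k
  proof -
    have "l2_inner (S I) (c k) = (\<Sum>j\<in>I. a j * l2_inner (c j) (c k))"
      unfolding S_def by (simp add: l2_inner_sum_left square_integrable_cmult l2_inner_cmult_left)
    also have "\<dots> = (\<Sum>j\<in>I. if j = k then a j else 0)"
      by (intro sum.cong refl) (simp add: cc)
    finally show ?thesis using that by (simp add: sum.delta)
  qed
  have Sinner: "l2_inner f (S I) = (\<Sum>k\<in>I. cnj (a k) * l2_inner f (c k))" if "square_integrable f" for f I
  proof -
    have "l2_inner (S I) f = (\<Sum>k\<in>I. a k * l2_inner (c k) f)"
      unfolding S_def using that
      by (simp add: l2_inner_sum_left square_integrable_cmult l2_inner_cmult_left)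
    then show ?thesis by (simp add: l2_inner_commute[of f])
  qed
  have Snorm: "(l2_norm (S I))\<^sup>2 = (\<Sum>k\<in>I. (cmod (a k))\<^sup>2)" if "finite I" for I
  proof -
    have "complex_of_real ((l2_norm (S I))\<^sup>2) = (\<Sum>k\<in>I. cnj (a k) * a k)"
      using that by (subst l2_inner_self[symmetric]) (simp add: Sinner[OF S] Sc)
    also have "\<dots> = complex_of_real (\<Sum>k\<in>I. (cmod (a k))\<^sup>2)"
      unfolding of_real_sum complex_norm_square by (simp add: mult.commute)
    finally show ?thesis by (simp only: of_real_eq_iff)
  qed
  have hS: "l2_inner h (S I) = of_real (\<Sum>k\<in>I. (cmod (a k))\<^sup>2)" for I
    unfolding Sinner[OF h] of_real_sum complex_norm_square a_def by (simp add: mult.commute)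
  have bessel: "(\<Sum>k\<in>I. (cmod (a k))\<^sup>2) \<le> (l2_norm h)\<^sup>2" if "finite I" for I
  proof -
    have "0 \<le> (l2_norm (\<lambda>x. h x + (-1) * S I x))\<^sup>2" by simp
    also have "\<dots> = (l2_norm h)\<^sup>2 + 2 * Re (l2_inner h (\<lambda>x. (-1) * S I x)) + (l2_norm (\<lambda>x. (-1) * S I x))\<^sup>2"
      by (intro l2_norm_power2_add h square_integrable_cmult S)
    also have "l2_inner h (\<lambda>x. (-1) * S I x) = - l2_inner h (S I)"
      by (subst l2_inner_commute, subst l2_inner_cmult_left, subst l2_inner_commute) simp
    finally show ?thesis
      unfolding l2_norm_cmult using that by (simp add: Snorm hS)
  qed
  have sm: "summable (\<lambda>k. (cmod (a k))\<^sup>2)"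
    by (rule bounded_imp_summable[where B = "(l2_norm h)\<^sup>2"]) (auto intro: bessel)
  have S_diff: "l2_norm (\<lambda>x. S {..<m} x - S {..<n} x) < e"
    if N: "\<And>m n. m \<ge> N \<Longrightarrow> norm (\<Sum>k=m..<n. (cmod (a k))\<^sup>2) < e\<^sup>2" and "0 < e" and nm: "N \<le> n" "n \<le> m" for N m n e
  proof -
    have "(\<lambda>x. S {..<m} x - S {..<n} x) = S {n..<m}"
      unfolding S_def using nm by (simp add: fun_eq_iff sum_diff_nat_ivl lessThan_atLeast0)
    then have "(l2_norm (\<lambda>x. S {..<m} x - S {..<n} x))\<^sup>2 < e\<^sup>2"
      using N[OF nm(1), of m] by (simp add: Snorm sum_nonneg)
    then show ?thesis by (rule power2_less_imp_less) (use \<open>0 < e\<close> in simp)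
  qed
  obtain g where g: "square_integrable g" and gl: "(\<lambda>n. l2_norm (\<lambda>x. S {..<n} x - g x)) \<longlonglongrightarrow> 0"
  proof (rule l2_complete[of "\<lambda>n. S {..<n}"])
    fix e :: real assume "0 < e"
    then have "0 < e\<^sup>2" by simp
    then obtain N where N: "\<And>m n. m \<ge> N \<Longrightarrow> norm (\<Sum>k=m..<n. (cmod (a k))\<^sup>2) < e\<^sup>2"
      using sm unfolding summable_Cauchy by blast
    have "l2_norm (\<lambda>x. S {..<m} x - S {..<n} x) < e" if "N \<le> m" "N \<le> n" for m n
    proof (cases "n \<le> m")
      case True
      show ?thesis by (rule S_diff[OF N \<open>0 < e\<close> that(2) True])
    next
      case False
      then have "m \<le> n" by simp
      from S_diff[OF N \<open>0 < e\<close> that(1) this] show ?thesis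
        by (subst l2_norm_minus_commute)
    qed
    then show "\<exists>N. \<forall>m\<ge>N. \<forall>n\<ge>N. l2_norm (\<lambda>x. S {..<m} x - S {..<n} x) < e" by blast
  qed (use S in auto)
  have gc: "l2_inner g (c k) = a k" for k
  proof (rule LIMSEQ_unique)
    show "(\<lambda>n. l2_inner (S {..<n}) (c k)) \<longlonglongrightarrow> l2_inner g (c k)"
      by (rule l2_inner_tendsto_left[OF S g c gl])
    have "\<forall>\<^sub>F n in sequentially. l2_inner (S {..<n}) (c k) = a k"
      using eventually_gt_at_top[of k] by eventually_elim (simp add: Sc)
    then show "(\<lambda>n. l2_inner (S {..<n}) (c k)) \<longlonglongrightarrow> a k"
      by (rule tendsto_eventually)
  qed
  \<comment> \<open>\<open>g\<close> is only an L2 limit and need not vanish pointwise outside the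
    cell, while uniqueness asks for exact support.\<close>
  define d where "d = (\<lambda>x. (h x - g x) * indicator unit_cell x)"
  have dm [measurable]: "d \<in> borel_measurable borel"
    using h g unfolding d_def square_integrable_def by auto
  have d: "square_integrable d"
    by (rule square_integrable_mono[OF square_integrable_diff[OF h g] dm, where c = 1])
       (auto simp: d_def indicator_def)
  have d_supp: "x \<notin> unit_cell \<Longrightarrow> d x = 0" for x by (simp add: d_def)
  have "vanishing_coefs d"
    unfolding vanishing_coefs_def
  proof (intro conjI ballI)
    show "integrable lborel d" by (rule square_integrable_cell_integrable[OF d d_supp])
    fix z assume "z \<in> int_lattice"
    then obtain k where k: "z = en k" using bij by (auto simp: bij_betw_def)
    have "(\<integral>x. d x * char_fun z x \<partial>lborel) = l2_inner (\<lambda>x. h x - g x) (c k)"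
      unfolding l2_inner_def
      by (intro Bochner_Integration.integral_cong refl)
         (auto simp: d_def c_def k cell_char_def char_fun_uminus indicator_def)
    then show "(\<integral>x. d x * char_fun z x \<partial>lborel) = 0"
      using h g by (simp add: l2_inner_diff_left gc a_def)
  qed
  then have "AE x in lborel. d x = 0"
    by (rule vanishing_coefs_AE_0) (rule d_supp)
  then have dAE: "AE x in lborel. x \<in> unit_cell \<longrightarrow> h x = g x"
    by eventually_elim (auto simp: d_def)
  \<comment> \<open>Outside the cell the partial sums and \<open>h\<close> are both 0, and inside
    \<open>h\<close> equals \<open>g\<close> almost everywhere; replacing \<open>g\<close> by
    \<open>h\<close> cannot increase the error.\<close>
  have le: "l2_norm (\<lambda>x. S {..<n} x - h x) \<le> l2_norm (\<lambda>x. S {..<n} x - g x)" for n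
  proof -
    have "(\<integral>x. (cmod (S {..<n} x - h x))\<^sup>2 \<partial>lborel) \<le> (\<integral>x. (cmod (S {..<n} x - g x))\<^sup>2 \<partial>lborel)"
    proof (rule integral_mono_AE)
      have S0: "S {..<n} x = 0" if "x \<notin> unit_cell" for x
        using that by (simp add: S_def c_def cell_char_def)
      show "AE x in lborel. (cmod (S {..<n} x - h x))\<^sup>2 \<le> (cmod (S {..<n} x - g x))\<^sup>2"
        using dAE
      proof eventually_elim
        case (elim x)
        then show ?case by (cases "x \<in> unit_cell") (auto simp: S0 supp)
      qed
    qed (use square_integrable_diff[OF S h] square_integrable_diff[OF S g] in \<open>auto simp: square_integrable_def\<close>)
    then show ?thesis by (simp add: l2_norm_def)
  qed
  have "(\<lambda>n. l2_norm (\<lambda>x. S {..<n} x - h x)) \<longlonglongrightarrow> 0"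
    by (rule Lim_null_comparison[OF _ gl]) (use le in auto)
  from l2_norm_tendsto[OF S h this]
  have "(\<lambda>n. (l2_norm (S {..<n}))\<^sup>2) \<longlonglongrightarrow> (l2_norm h)\<^sup>2"
    by (intro tendsto_intros)
  then have sums: "(\<lambda>k. (cmod (a k))\<^sup>2) sums (l2_norm h)\<^sup>2"
    by (simp add: Snorm sums_def)
  have "(\<integral>\<^sup>+z. ennreal ((cmod (\<integral>x. h x * char_fun z x \<partial>lborel))\<^sup>2) \<partial>count_space int_lattice) =
      (\<integral>\<^sup>+k. ennreal ((cmod (a k))\<^sup>2) \<partial>count_space UNIV)"
    unfolding a by (rule nn_integral_bij_count_space[OF bij, symmetric])
  also have "\<dots> = (\<Sum>k. ennreal ((cmod (a k))\<^sup>2))"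
    by (rule nn_integral_count_space_nat)
  also have "\<dots> = ennreal ((l2_norm h)\<^sup>2)"
    using sums by (intro suminf_ennreal_eq) auto
  finally show ?thesis .
qed


section \<open>Periodization\<close>

lemma nn_integral_count_space_finite_term:
  fixes a :: "'i \<Rightarrow> complex"
  assumes "integrable (count_space I) a" "i \<in> I"
  shows "ennreal (cmod (a i)) \<le> (\<integral>\<^sup>+j. ennreal (cmod (a j)) \<partial>count_space I)"
  using assms(2) nn_integral_ge_point[of i I "\<lambda>j. ennreal (cmod (a j))"] by simp

text \<open>With T the sum of all \<open>a i\<close>, the difference of |T|^2 and the sum of |a i|^2
  is the sum of a i * cnj (T - a i), and |T - a i| is at most the sum of the other moduli. Two
  one-sided inequalities express this because \<open>D\<close> may be infinite.\<close>

lemma norm_square_sum_count_space: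
  fixes a :: "'i \<Rightarrow> complex"
  assumes a: "integrable (count_space I) a"
  defines "D \<equiv> \<integral>\<^sup>+i. ennreal (cmod (a i)) *
      (\<integral>\<^sup>+j. ennreal (cmod (a j)) * indicator (- {i}) j \<partial>count_space I) \<partial>count_space I"
  shows "ennreal ((cmod (\<integral>i. a i \<partial>count_space I))\<^sup>2)
      \<le> (\<integral>\<^sup>+i. ennreal ((cmod (a i))\<^sup>2) \<partial>count_space I) + D" (is ?upper)
    and "(\<integral>\<^sup>+i. ennreal ((cmod (a i))\<^sup>2) \<partial>count_space I)
      \<le> ennreal ((cmod (\<integral>i. a i \<partial>count_space I))\<^sup>2) + D" (is ?lower)
proof -
  let ?C = "count_space I"
  define T where "T = (\<integral>i. a i \<partial>?C)"
  have one: "integrable ?C (\<lambda>j. a j * indicator (- {i}) j)" for i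
    by (rule Bochner_Integration.integrable_bound[OF a]) (auto simp: norm_mult indicator_def)
  have rest: "T - a i = (\<integral>j. a j * indicator (- {i}) j \<partial>?C)" if "i \<in> I" for i
  proof -
    have single: "integrable ?C (\<lambda>j. a j * indicator {i} j)"
      by (rule Bochner_Integration.integrable_bound[OF a]) (auto simp: norm_mult indicator_def)
    have "T = (\<integral>j. a j * indicator (- {i}) j + a j * indicator {i} j \<partial>?C)"
      unfolding T_def by (intro Bochner_Integration.integral_cong refl) (auto simp: indicator_def)
    also have "\<dots> = (\<integral>j. a j * indicator (- {i}) j \<partial>?C) + (\<integral>j. a j * indicator {i} j \<partial>?C)"
      by (rule Bochner_Integration.integral_add[OF one single])
    also have "(\<integral>j. a j * indicator {i} j \<partial>?C) = (\<integral>j. (if j = i then a i else 0) \<partial>?C)"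
      by (intro Bochner_Integration.integral_cong refl) (auto simp: indicator_def)
    also have "\<dots> = (\<Sum>j | j \<in> I \<and> (if j = i then a i else 0) \<noteq> 0. if j = i then a i else 0)"
      by (subst lebesgue_integral_count_space_finite_support) auto
    also have "\<dots> = a i"
    proof (cases "a i = 0")
      case False
      then have "{j. j \<in> I \<and> (if j = i then a i else 0) \<noteq> 0} = {i}" using that by auto
      then show ?thesis by simp
    qed (auto intro: sum.neutral)
    finally show ?thesis by simp
  qed
  have rest_le: "ennreal (cmod (T - a i)) \<le> (\<integral>\<^sup>+j. ennreal (cmod (a j)) * indicator (- {i}) j \<partial>?C)"
    if "i \<in> I" for i
  proof -
    have "ennreal (cmod (T - a i)) \<le> (\<integral>\<^sup>+j. ennreal (cmod (a j * indicator (- {i}) j)) \<partial>?C)"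
      unfolding rest[OF that] by (rule integral_norm_bound_ennreal[OF one])
    also have "\<dots> = (\<integral>\<^sup>+j. ennreal (cmod (a j)) * indicator (- {i}) j \<partial>?C)"
      by (intro nn_integral_cong) (auto simp: norm_mult indicator_def)
    finally show ?thesis .
  qed
  \<comment> \<open>A bound for every single term, which makes the squares summable along with the
    terms.\<close>
  define N where "N = (\<integral>i. cmod (a i) \<partial>?C)"
  have an: "integrable ?C (\<lambda>i. cmod (a i))" using a by simp
  have N: "cmod (a i) \<le> N" if "i \<in> I" for i
  proof -
    have "ennreal (cmod (a i)) \<le> ennreal N"
      using nn_integral_count_space_finite_term[OF a that] nn_integral_eq_integral[OF an]
      by (simp add: N_def)
    then show ?thesis
      by (subst (asm) ennreal_le_iff) (auto simp: N_def)
  qed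
  have aT: "integrable ?C (\<lambda>i. a i * cnj T)" using a by simp
  have sq: "integrable ?C (\<lambda>i. complex_of_real ((cmod (a i))\<^sup>2))"
  proof (rule Bochner_Integration.integrable_bound)
    show "integrable ?C (\<lambda>i. N * cmod (a i))" using an by simp
    show "AE i in ?C. norm (complex_of_real ((cmod (a i))\<^sup>2)) \<le> norm (N * cmod (a i))"
    proof (rule AE_I2)
      fix i assume "i \<in> space ?C"
      then have i: "cmod (a i) \<le> N" using N by simp
      then have "0 \<le> N" using norm_ge_zero order_trans by blast
      then show "norm (complex_of_real ((cmod (a i))\<^sup>2)) \<le> norm (N * cmod (a i))"
        using mult_right_mono[OF i norm_ge_zero[of "a i"]]
        by (simp add: norm_mult norm_power power2_eq_square)
    qed
  qed simp
  define Q where "Q = (\<integral>i. (cmod (a i))\<^sup>2 \<partial>?C)"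
  have sqr: "integrable ?C (\<lambda>i. (cmod (a i))\<^sup>2)"
    using sq complex_of_real_integrable_eq by blast
  have nnQ: "(\<integral>\<^sup>+i. ennreal ((cmod (a i))\<^sup>2) \<partial>?C) = ennreal Q"
    unfolding Q_def by (rule nn_integral_eq_integral[OF sqr]) simp
  have "complex_of_real Q = (\<integral>i. complex_of_real ((cmod (a i))\<^sup>2) \<partial>?C)"
    unfolding Q_def by (rule integral_complex_of_real[symmetric])
  moreover have "complex_of_real ((cmod T)\<^sup>2) = (\<integral>i. a i * cnj T \<partial>?C)"
    unfolding complex_norm_square using a by (simp add: T_def)
  ultimately have "complex_of_real ((cmod T)\<^sup>2) - complex_of_real Q =
      (\<integral>i. a i * cnj T \<partial>?C) - (\<integral>i. complex_of_real ((cmod (a i))\<^sup>2) \<partial>?C)"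
    by simp
  also have "\<dots> = (\<integral>i. a i * cnj T - complex_of_real ((cmod (a i))\<^sup>2) \<partial>?C)"
    by (rule Bochner_Integration.integral_diff[OF aT sq, symmetric])
  also have "\<dots> = (\<integral>i. a i * cnj (T - a i) \<partial>?C)"
    unfolding complex_norm_square by (simp add: algebra_simps)
  finally have eq: "complex_of_real ((cmod T)\<^sup>2 - Q) = (\<integral>i. a i * cnj (T - a i) \<partial>?C)" by simp
  have int: "integrable ?C (\<lambda>i. a i * cnj (T - a i))"
    using Bochner_Integration.integrable_diff[OF aT sq]
    unfolding complex_norm_square by (simp add: algebra_simps)
  have "ennreal \<bar>(cmod T)\<^sup>2 - Q\<bar> \<le> (\<integral>\<^sup>+i. ennreal (cmod (a i * cnj (T - a i))) \<partial>?C)"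
    using integral_norm_bound_ennreal[OF int] unfolding eq[symmetric] norm_of_real .
  also have "\<dots> \<le> D"
    unfolding D_def
  proof (rule nn_integral_mono)
    fix i assume "i \<in> space ?C"
    then show "ennreal (cmod (a i * cnj (T - a i))) \<le>
        ennreal (cmod (a i)) * (\<integral>\<^sup>+j. ennreal (cmod (a j)) * indicator (- {i}) j \<partial>?C)"
      using rest_le[of i] by (simp add: norm_mult ennreal_mult mult_left_mono del: complex_cnj_diff)
  qed
  finally have D: "ennreal \<bar>(cmod T)\<^sup>2 - Q\<bar> \<le> D" .
  have Q0: "0 \<le> Q" unfolding Q_def by simp
  have "ennreal ((cmod T)\<^sup>2) \<le> ennreal (Q + \<bar>(cmod T)\<^sup>2 - Q\<bar>)"
    by (intro ennreal_leI) simp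
  also have "\<dots> \<le> ennreal Q + D"
    using D Q0 by (simp add: add_left_mono)
  finally show ?upper unfolding nnQ T_def .
  have "ennreal Q \<le> ennreal ((cmod T)\<^sup>2 + \<bar>(cmod T)\<^sup>2 - Q\<bar>)"
    by (intro ennreal_leI) simp
  also have "\<dots> \<le> ennreal ((cmod T)\<^sup>2) + D"
    using D by (simp add: add_left_mono)
  finally show ?lower unfolding nnQ T_def .
qed

section \<open>Fubini's theorem on the product of lattice and plane\<close>

interpretation lattice_sf: sigma_finite_measure "count_space int_lattice"
  by (rule sigma_finite_measure_count_space_countable) simp

interpretation lattice_pair: pair_sigma_finite "count_space int_lattice" "lborel :: (real^2) measure"
  by unfold_locales

lemma nn_integral_lattice_pair:
  fixes f :: "(real^2) \<times> (real^2) \<Rightarrow> ennreal"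
  assumes "\<And>g. g \<in> int_lattice \<Longrightarrow> (\<lambda>x. f (g, x)) \<in> borel_measurable borel"
  shows "(\<integral>\<^sup>+p. f p \<partial>(count_space int_lattice \<Otimes>\<^sub>M lborel)) =
    (\<integral>\<^sup>+x. \<integral>\<^sup>+g. f (g, x) \<partial>count_space int_lattice \<partial>lborel)"
proof -
  have "f \<in> borel_measurable (count_space int_lattice \<Otimes>\<^sub>M (lborel :: (real^2) measure))"
    using assms by (intro measurable_pair_measure_countable1) auto
  from lattice_pair.nn_integral_snd[OF this] show ?thesis by simp
qed

lemma integral_tiling:
  fixes f :: "real^2 \<Rightarrow> complex"
  assumes f: "integrable lborel f"
  shows "AE x in lborel. x \<in> unit_cell \<longrightarrow> integrable (count_space int_lattice) (\<lambda>g. f (x + g))"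
    and "(\<lambda>x. indicator unit_cell x * (\<integral>g. f (x + g) \<partial>count_space int_lattice)) \<in> borel_measurable borel"
    and "(\<integral>x. f x \<partial>lborel) = (\<integral>x. indicator unit_cell x * (\<integral>g. f (x + g) \<partial>count_space int_lattice) \<partial>lborel)"
proof -
  let ?C = "count_space int_lattice"
  have [measurable]: "f \<in> borel_measurable borel" using f by auto
  \<comment> \<open>For each \<open>g\<close> the two kernels are translates of one another. Summed
    over \<open>g\<close>, \<open>k'\<close> returns \<open>f\<close> and \<open>k\<close> returns
    the periodization on the cell, so Fubini is applied once to each.\<close>
  define k where "k = (\<lambda>(g, x). indicator unit_cell x * f (x + g))"
  define k' where "k' = (\<lambda>(g, x). f x * indicator unit_cell (x - g))"
  have km: "k \<in> borel_measurable (?C \<Otimes>\<^sub>M lborel)" "k' \<in> borel_measurable (?C \<Otimes>\<^sub>M lborel)"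
    unfolding k_def k'_def by (intro measurable_pair_measure_countable1; simp)+
  have fin: "(\<integral>\<^sup>+x. norm (f x) \<partial>lborel) < \<infinity>"
    using f by (simp add: integrable_iff_bounded)
  have one: "(\<integral>\<^sup>+g. norm (k' (g, x)) \<partial>?C) = norm (f x)" for x
  proof -
    have "(\<integral>\<^sup>+g. norm (k' (g, x)) \<partial>?C) = (\<integral>\<^sup>+g. norm (f x) * indicator {cell_part x} g \<partial>?C)"
      by (intro nn_integral_cong) (simp add: k'_def cell_part_iff norm_mult indicator_def)
    then show ?thesis by (simp add: nn_integral_cmult_indicator)
  qed
  have "(\<integral>\<^sup>+p. norm (k p) \<partial>(?C \<Otimes>\<^sub>M lborel)) = (\<integral>\<^sup>+x. \<integral>\<^sup>+g. norm (k (g, x)) \<partial>?C \<partial>lborel)"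
    by (rule nn_integral_lattice_pair) (simp add: k_def)
  also have "\<dots> = (\<integral>\<^sup>+x. (\<integral>\<^sup>+g. norm (f (x + g)) \<partial>?C) * indicator unit_cell x \<partial>lborel)"
    by (intro nn_integral_cong) (simp add: k_def norm_mult indicator_def)
  also have "\<dots> = (\<integral>\<^sup>+x. norm (f x) \<partial>lborel)"
    by (rule nn_integral_tiling[symmetric]) simp
  finally have ik: "integrable (?C \<Otimes>\<^sub>M lborel) k"
    using fin km by (intro integrableI_bounded) auto
  have "(\<integral>\<^sup>+p. norm (k' p) \<partial>(?C \<Otimes>\<^sub>M lborel)) = (\<integral>\<^sup>+x. \<integral>\<^sup>+g. norm (k' (g, x)) \<partial>?C \<partial>lborel)"
    by (rule nn_integral_lattice_pair) (simp add: k'_def)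
  then have ik': "integrable (?C \<Otimes>\<^sub>M lborel) k'"
    using fin km by (intro integrableI_bounded) (auto simp: one)
  show "AE x in lborel. x \<in> unit_cell \<longrightarrow> integrable ?C (\<lambda>g. f (x + g))"
    using lattice_pair.AE_integrable_snd[of "\<lambda>g x. k (g, x)"] ik
    by (simp add: k_def split_beta') (auto elim!: eventually_mono)
  have eq: "(\<integral>g. k (g, x) \<partial>?C) = indicator unit_cell x * (\<integral>g. f (x + g) \<partial>?C)" for x
    by (cases "x \<in> unit_cell") (simp_all add: k_def)
  have "(\<lambda>x. \<integral>g. k (g, x) \<partial>?C) \<in> borel_measurable lborel"
    by (rule borel_measurable_integrable[OF lattice_pair.integrable_snd[of "\<lambda>g x. k (g, x)"]])
       (use ik in \<open>simp add: split_beta'\<close>)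
  then show "(\<lambda>x. indicator unit_cell x * (\<integral>g. f (x + g) \<partial>?C)) \<in> borel_measurable borel"
    by (simp add: eq)
  have "(\<integral>x. f x \<partial>lborel) = (\<integral>x. (\<integral>g. k' (g, x) \<partial>?C) \<partial>lborel)"
  proof (intro Bochner_Integration.integral_cong refl)
    fix x
    have "(\<integral>g. k' (g, x) \<partial>?C) = (\<integral>g. (if g = cell_part x then f x else 0) \<partial>?C)"
      by (intro Bochner_Integration.integral_cong refl) (simp add: k'_def cell_part_iff indicator_def)
    also have "\<dots> = (\<Sum>g\<in>{cell_part x}. if g = cell_part x then f x else 0)"
      by (subst lebesgue_integral_count_space_finite_support)
         (auto intro!: sum.mono_neutral_left split: if_splits)
    finally show "f x = (\<integral>g. k' (g, x) \<partial>?C)" by simp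
  qed
  also have "\<dots> = (\<integral>g. (\<integral>x. k' (g, x) \<partial>lborel) \<partial>?C)"
    by (rule lattice_pair.Fubini_integral[of "\<lambda>g x. k' (g, x)"]) (use ik' in \<open>simp add: split_beta'\<close>)
  also have "\<dots> = (\<integral>g. (\<integral>x. k (g, x) \<partial>lborel) \<partial>?C)"
  proof (rule Bochner_Integration.integral_cong[OF refl])
    fix g
    show "(\<integral>x. k' (g, x) \<partial>lborel) = (\<integral>x. k (g, x) \<partial>lborel)"
      using integral_translation[of "\<lambda>x. f x * indicator unit_cell (x - g)" g]
      by (simp add: k_def k'_def mult.commute)
  qed
  also have "\<dots> = (\<integral>x. (\<integral>g. k (g, x) \<partial>?C) \<partial>lborel)"
    by (rule lattice_pair.Fubini_integral[of "\<lambda>g x. k (g, x)", symmetric]) (use ik in \<open>simp add: split_beta'\<close>)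
  finally show "(\<integral>x. f x \<partial>lborel) = (\<integral>x. indicator unit_cell x * (\<integral>g. f (x + g) \<partial>?C) \<partial>lborel)"
    by (simp add: eq)
qed

text \<open>By the tiling identity this is the integral over the unit cell of the sum of |F(x+g)|
  |F(x+j)| over ordered pairs of distinct lattice points, the quantity \<open>D\<close> of
  \<open>norm_square_sum_count_space\<close>.\<close>

definition off_diagonal :: "(real^2 \<Rightarrow> complex) \<Rightarrow> ennreal" where
  "off_diagonal F = (\<integral>\<^sup>+x. ennreal (cmod (F x)) *
     (\<integral>\<^sup>+g. ennreal (cmod (F (x + g))) * indicator (- {0}) g \<partial>count_space int_lattice) \<partial>lborel)"

text \<open>Characters are lattice-periodic, so \<open>F\<close> and its periodization have the same
  coefficients and Parseval turns \<open>S\<close> into the squared norm of the periodization. At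
  each point of the cell that square is compared with the sum of |F|^2 over the lattice. Finiteness
  of the off-diagonal part is what makes the periodization square-integrable.\<close>

theorem periodization_bounds:
  assumes F: "integrable lborel F" "square_integrable F" and fin: "off_diagonal F < \<infinity>"
  defines "S \<equiv> \<integral>\<^sup>+z. ennreal ((cmod (\<integral>x. F x * char_fun z x \<partial>lborel))\<^sup>2) \<partial>count_space int_lattice"
  shows "S \<le> ennreal ((l2_norm F)\<^sup>2) + off_diagonal F"
    and "ennreal ((l2_norm F)\<^sup>2) \<le> S + off_diagonal F"
proof -
  let ?C = "count_space int_lattice"
  have [measurable]: "F \<in> borel_measurable borel" using F by auto
  define P where "P = (\<lambda>x. indicator unit_cell x * (\<integral>g. F (x + g) \<partial>?C))"
  note tile = integral_tiling[OF F(1)]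
  have [measurable]: "P \<in> borel_measurable borel" unfolding P_def by (rule tile(2))
  define G where "G = (\<lambda>x. ennreal (cmod (F x)) *
     (\<integral>\<^sup>+g. ennreal (cmod (F (x + g))) * indicator (- {0}) g \<partial>?C))"
  have inner_m: "(\<lambda>x. \<integral>\<^sup>+g. ennreal (cmod (F (x + g))) * indicator (- {0}) g \<partial>?C) \<in> borel_measurable borel"
  proof -
    have "(\<lambda>p. ennreal (cmod (F (snd p + fst p))) * indicator (- {0}) (fst p)) \<in> borel_measurable (?C \<Otimes>\<^sub>M lborel)"
      by (intro measurable_pair_measure_countable1; simp)
    then have "(\<lambda>p. ennreal (cmod (F (fst p + snd p))) * indicator (- {0}) (snd p)) \<in> borel_measurable (lborel \<Otimes>\<^sub>M ?C)"
      by (subst measurable_pair_swap_iff) (simp add: split_beta')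
    from lattice_sf.borel_measurable_nn_integral_fst[OF this] show ?thesis by simp
  qed
  have [measurable]: "G \<in> borel_measurable borel"
    unfolding G_def using inner_m by measurable
  define D where "D = (\<lambda>x. \<integral>\<^sup>+g. G (x + g) \<partial>?C)"
  have Dm: "(\<lambda>x. D x * indicator unit_cell x) \<in> borel_measurable borel"
  proof -
    have "(\<lambda>p. G (snd p + fst p)) \<in> borel_measurable (?C \<Otimes>\<^sub>M lborel)"
      by (intro measurable_pair_measure_countable1; simp)
    then have "(\<lambda>p. G (fst p + snd p)) \<in> borel_measurable (lborel \<Otimes>\<^sub>M ?C)"
      by (subst measurable_pair_swap_iff) (simp add: split_beta')
    from lattice_sf.borel_measurable_nn_integral_fst[OF this] show ?thesis
      unfolding D_def by simp
  qed
  have Sm: "(\<lambda>x. (\<integral>\<^sup>+g. ennreal ((cmod (F (x + g)))\<^sup>2) \<partial>?C) * indicator unit_cell x) \<in> borel_measurable borel"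
  proof -
    have "(\<lambda>p. ennreal ((cmod (F (snd p + fst p)))\<^sup>2)) \<in> borel_measurable (?C \<Otimes>\<^sub>M lborel)"
      by (intro measurable_pair_measure_countable1; simp)
    then have "(\<lambda>p. ennreal ((cmod (F (fst p + snd p)))\<^sup>2)) \<in> borel_measurable (lborel \<Otimes>\<^sub>M ?C)"
      by (subst measurable_pair_swap_iff) (simp add: split_beta')
    from lattice_sf.borel_measurable_nn_integral_fst[OF this] show ?thesis by simp
  qed
  \<comment> \<open>Re-centring the inner sum at \<open>g\<close> replaces differences of lattice
    points by pairs of distinct lattice points.\<close>
  have D_eq: "D x = (\<integral>\<^sup>+g. ennreal (cmod (F (x + g))) *
      (\<integral>\<^sup>+j. ennreal (cmod (F (x + j))) * indicator (- {g}) j \<partial>?C) \<partial>?C)" for x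
    unfolding D_def
  proof (rule nn_integral_cong)
    fix g assume "g \<in> space ?C"
    then have g: "g \<in> int_lattice" by simp
    have "(\<integral>\<^sup>+b. ennreal (cmod (F (x + g + b))) * indicator (- {0}) b \<partial>?C) =
        (\<integral>\<^sup>+b. ennreal (cmod (F (x + (b + g)))) * indicator (- {g}) (b + g) \<partial>?C)"
      by (intro nn_integral_cong) (simp add: indicator_def ac_simps)
    also have "\<dots> = (\<integral>\<^sup>+j. ennreal (cmod (F (x + j))) * indicator (- {g}) j \<partial>?C)"
      by (rule nn_integral_lattice_shift[OF g])
    finally show "G (x + g) = ennreal (cmod (F (x + g))) *
        (\<integral>\<^sup>+j. ennreal (cmod (F (x + j))) * indicator (- {g}) j \<partial>?C)"
      by (simp add: G_def)
  qed
  have D_int: "(\<integral>\<^sup>+x. D x * indicator unit_cell x \<partial>lborel) = off_diagonal F"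
    unfolding D_def off_diagonal_def G_def[symmetric] by (rule nn_integral_tiling[symmetric]) simp
  have F_int: "(\<integral>\<^sup>+x. (\<integral>\<^sup>+g. ennreal ((cmod (F (x + g)))\<^sup>2) \<partial>?C) * indicator unit_cell x \<partial>lborel) = ennreal ((l2_norm F)\<^sup>2)"
    unfolding nn_integral_l2_norm[OF F(2), symmetric] by (rule nn_integral_tiling[symmetric]) simp
  have up: "AE x in lborel. ennreal ((cmod (P x))\<^sup>2) \<le>
      (\<integral>\<^sup>+g. ennreal ((cmod (F (x + g)))\<^sup>2) \<partial>?C) * indicator unit_cell x + D x * indicator unit_cell x"
    using tile(1)
  proof eventually_elim
    case (elim x)
    then show ?case
      using norm_square_sum_count_space(1)[of int_lattice "\<lambda>g. F (x + g)"]
      by (cases "x \<in> unit_cell") (simp_all add: P_def D_eq)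
  qed
  have low: "AE x in lborel. (\<integral>\<^sup>+g. ennreal ((cmod (F (x + g)))\<^sup>2) \<partial>?C) * indicator unit_cell x \<le>
      ennreal ((cmod (P x))\<^sup>2) + D x * indicator unit_cell x"
    using tile(1)
  proof eventually_elim
    case (elim x)
    then show ?case
      using norm_square_sum_count_space(2)[of int_lattice "\<lambda>g. F (x + g)"]
      by (cases "x \<in> unit_cell") (simp_all add: P_def D_eq)
  qed
  have PU: "(\<integral>\<^sup>+x. ennreal ((cmod (P x))\<^sup>2) \<partial>lborel) \<le> ennreal ((l2_norm F)\<^sup>2) + off_diagonal F"
    unfolding F_int[symmetric] D_int[symmetric]
    by (subst nn_integral_add[symmetric]) (use Sm Dm up in \<open>auto intro: nn_integral_mono_AE\<close>)
  have PL: "ennreal ((l2_norm F)\<^sup>2) \<le> (\<integral>\<^sup>+x. ennreal ((cmod (P x))\<^sup>2) \<partial>lborel) + off_diagonal F"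
    unfolding F_int[symmetric] D_int[symmetric]
    by (subst nn_integral_add[symmetric]) (use Dm low in \<open>auto intro: nn_integral_mono_AE\<close>)
  have "(\<integral>\<^sup>+x. ennreal ((cmod (P x))\<^sup>2) \<partial>lborel) < \<infinity>"
    using fin by (intro order.strict_trans1[OF PU]) simp
  then have P: "square_integrable P"
    by (intro square_integrableI_nn) simp_all
  have coef: "(\<integral>x. P x * char_fun z x \<partial>lborel) = (\<integral>x. F x * char_fun z x \<partial>lborel)" if z: "z \<in> int_lattice" for z
  proof -
    have Fz: "integrable lborel (\<lambda>x. F x * char_fun z x)"
      by (rule integrable_mult_bounded[OF F(1), where B = 1]) auto
    have "(\<integral>g. F (x + g) * char_fun z (x + g) \<partial>?C) = (\<integral>g. F (x + g) \<partial>?C) * char_fun z x" for x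
    proof -
      have "(\<integral>g. F (x + g) * char_fun z (x + g) \<partial>?C) = (\<integral>g. F (x + g) * char_fun z x \<partial>?C)"
        by (intro Bochner_Integration.integral_cong refl) (simp add: char_fun_add z)
      then show ?thesis by simp
    qed
    then show ?thesis
      unfolding integral_tiling(3)[OF Fz] by (simp add: P_def mult.assoc)
  qed
  have "S = ennreal ((l2_norm P)\<^sup>2)"
  proof -
    have "S = (\<integral>\<^sup>+z. ennreal ((cmod (\<integral>x. P x * char_fun z x \<partial>lborel))\<^sup>2) \<partial>?C)"
      unfolding S_def by (intro nn_integral_cong) (simp add: coef)
    also have "\<dots> = ennreal ((l2_norm P)\<^sup>2)"
      by (rule Parseval_unit_cell[OF P]) (simp add: P_def)
    finally show ?thesis .
  qed
  then have "S = (\<integral>\<^sup>+x. ennreal ((cmod (P x))\<^sup>2) \<partial>lborel)"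
    by (simp add: nn_integral_l2_norm[OF P])
  with PU PL show "S \<le> ennreal ((l2_norm F)\<^sup>2) + off_diagonal F"
    "ennreal ((l2_norm F)\<^sup>2) \<le> S + off_diagonal F" by simp_all
qed


section \<open>Plancherel's theorem\<close>

lemma fourier_L1_char: "fourier_L1 f \<xi> = (\<integral>x. f x * char_fun (- \<xi>) x \<partial>lborel)"
  by (simp add: fourier_L1_def char_fun_def)

lemma fourier_L1_measurable [measurable]:
  assumes [measurable]: "f \<in> borel_measurable borel"
  shows "fourier_L1 f \<in> borel_measurable borel"
proof -
  have [measurable]: "(\<lambda>p. cis (- 2 * pi * (fst p \<bullet> snd p))) \<in> borel_measurable (borel \<Otimes>\<^sub>M (borel :: (real^2) measure))"
    unfolding borel_prod by (intro borel_measurable_continuous_onI continuous_intros)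
  have "(\<lambda>p. f (snd p) * cis (- 2 * pi * (fst p \<bullet> snd p))) \<in> borel_measurable (borel \<Otimes>\<^sub>M lborel)"
    by measurable
  then have "(\<lambda>\<xi>. \<integral>x. f (snd (\<xi>, x)) * cis (- 2 * pi * (fst (\<xi>, x) \<bullet> snd (\<xi>, x))) \<partial>lborel) \<in> borel_measurable borel"
    by (intro lborel.borel_measurable_lebesgue_integral) (simp add: split_beta')
  then show ?thesis unfolding fourier_L1_def[abs_def] by simp
qed

lemma integrable_mult_char:
  assumes "integrable lborel f" shows "integrable lborel (\<lambda>x. f x * char_fun z x)"
  by (rule integrable_mult_bounded[OF assms, where B = 1]) auto

lemma fourier_L1_diff:
  assumes "integrable lborel f" "integrable lborel g"
  shows "fourier_L1 (\<lambda>x. f x - g x) \<xi> = fourier_L1 f \<xi> - fourier_L1 g \<xi>"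
  unfolding fourier_L1_char left_diff_distrib
  by (rule Bochner_Integration.integral_diff) (intro integrable_mult_char assms)+

lemma fourier_L1_add:
  assumes "integrable lborel f" "integrable lborel g"
  shows "fourier_L1 (\<lambda>x. f x + g x) \<xi> = fourier_L1 f \<xi> + fourier_L1 g \<xi>"
  unfolding fourier_L1_char distrib_right
  by (rule Bochner_Integration.integral_add) (intro integrable_mult_char assms)+

lemma fourier_L1_cmult: "fourier_L1 (\<lambda>x. c * f x) \<xi> = c * fourier_L1 f \<xi>"
  by (simp add: fourier_L1_char mult.assoc)

lemma mat_mult_vec: "mat c *v x = c *\<^sub>R (x :: real^2)"
  by (simp add: vec_eq_iff matrix_vector_mult_def mat_def sum_2 forall_2)

lemma det_mat_2: "det (mat c :: real^2^2) = c\<^sup>2"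
  by (simp add: det_2 mat_def power2_eq_square)

lemma nn_integral_scale:
  assumes "f \<in> borel_measurable borel" "c \<noteq> 0"
  shows "(\<integral>\<^sup>+x. f x \<partial>lborel) = ennreal (c\<^sup>2) * (\<integral>\<^sup>+x. f (c *\<^sub>R (x :: real^2)) \<partial>lborel)"
  using nn_integral_matrix[of "mat c :: real^2^2" f] assms
  by (simp add: mat_mult_vec det_mat_2 invertible_det_nz)

lemma integral_scale:
  fixes f :: "real^2 \<Rightarrow> complex"
  assumes "f \<in> borel_measurable borel" "c \<noteq> 0"
  shows "(\<integral>x. f x \<partial>lborel) = of_real (c\<^sup>2) * (\<integral>x. f (c *\<^sub>R x) \<partial>lborel)"
  using integral_matrix[of "mat c :: real^2^2" f] assms
  by (simp add: mat_mult_vec det_mat_2 invertible_det_nz)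

lemma char_fun_scale: "char_fun (c *\<^sub>R z) x = char_fun z (c *\<^sub>R x)"
  by (simp add: char_fun_def)

lemma l2_norm_eqI_nn:
  assumes "square_integrable f" "(\<integral>\<^sup>+x. ennreal ((cmod (f x))\<^sup>2) \<partial>lborel) = ennreal (r\<^sup>2)" "0 \<le> r"
  shows "l2_norm f = r"
  using assms by (simp add: nn_integral_l2_norm power2_eq_iff_nonneg del: ennreal_power)

text \<open>
  For a function supported in a cube, Parseval's identity on the rescaled unit cell evaluates the
  sum of \<open>\<bar>fourier_L1 f\<bar>\<^sup>2\<close> over any translate of a lattice; integrating over the translates
  gives Plancherel's identity.
\<close>

lemma Plancherel_bounded_support:
  assumes f: "square_integrable f" and N: "N > 0"
    and supp: "\<And>x. f x \<noteq> 0 \<Longrightarrow> norm x < N / 2"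
  shows "(\<integral>\<^sup>+\<xi>. ennreal ((cmod (fourier_L1 f \<xi>))\<^sup>2) \<partial>lborel) = ennreal ((l2_norm f)\<^sup>2)"
proof -
  have [measurable]: "f \<in> borel_measurable borel" using f by measurable
  \<comment> \<open>Scaling by \<open>N\<close> brings the support into the unit cell; modulation by
    \<open>char_fun t\<close> moves the sampled frequencies to a translate of the lattice.\<close>
  define h where "h = (\<lambda>t x. f (N *\<^sub>R x) * char_fun t x)"
  have hm [measurable]: "h t \<in> borel_measurable borel" for t unfolding h_def by measurable
  have h_norm: "(\<integral>\<^sup>+x. ennreal ((cmod (h t x))\<^sup>2) \<partial>lborel) = ennreal ((l2_norm f)\<^sup>2 / N\<^sup>2)" for t
  proof -
    have "ennreal (N\<^sup>2) * (\<integral>\<^sup>+x. ennreal ((cmod (h t x))\<^sup>2) \<partial>lborel) = ennreal ((l2_norm f)\<^sup>2)"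
      using nn_integral_scale[of "\<lambda>x. ennreal ((cmod (f x))\<^sup>2)" N] N
      by (simp add: h_def norm_mult nn_integral_l2_norm[OF f] del: ennreal_power)
    then have "ennreal (1 / N\<^sup>2) * (ennreal (N\<^sup>2) * (\<integral>\<^sup>+x. ennreal ((cmod (h t x))\<^sup>2) \<partial>lborel)) =
        ennreal (1 / N\<^sup>2) * ennreal ((l2_norm f)\<^sup>2)" by (simp only:)
    moreover have "ennreal (1 / N\<^sup>2) * ennreal (N\<^sup>2) = 1"
      using N by (subst ennreal_mult[symmetric]) auto
    moreover have "ennreal (1 / N\<^sup>2) * ennreal ((l2_norm f)\<^sup>2) = ennreal ((l2_norm f)\<^sup>2 / N\<^sup>2)"
      by (subst ennreal_mult[symmetric]) auto
    ultimately show ?thesis by (simp only: mult.assoc[symmetric] mult_1_left)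
  qed
  have h: "square_integrable (h t)" for t
    by (rule square_integrableI_nn) (simp_all add: h_norm del: ennreal_power)
  have h_supp: "h t x = 0" if "x \<notin> unit_cell" for t x
  proof (rule ccontr)
    assume "h t x \<noteq> 0"
    then have "norm (N *\<^sub>R x) < N / 2" by (intro supp) (simp add: h_def)
    then have "norm x < 1 / 2" using N by simp
    then have "\<bar>x $ i\<bar> < 1 / 2" for i
      using component_le_norm_cart[of x i] by linarith
    then have "x \<in> unit_cell"
      unfolding unit_cell_def mem_Collect_eq by (metis abs_less_iff less_imp_le minus_less_iff minus_divide_left)
    with that show False by simp
  qed
  have coef: "(\<integral>x. h t x * char_fun z x \<partial>lborel) = fourier_L1 f ((- 1 / N) *\<^sub>R (t + z)) / N\<^sup>2" for t z
  proof -
    have "fourier_L1 f ((- 1 / N) *\<^sub>R (t + z)) = (\<integral>x. f x * char_fun ((1 / N) *\<^sub>R (t + z)) x \<partial>lborel)"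
      by (simp add: fourier_L1_char)
    also have "\<dots> = of_real (N\<^sup>2) * (\<integral>x. f (N *\<^sub>R x) * char_fun ((1 / N) *\<^sub>R (t + z)) (N *\<^sub>R x) \<partial>lborel)"
      by (rule integral_scale) (use N in auto)
    also have "(\<lambda>x. f (N *\<^sub>R x) * char_fun ((1 / N) *\<^sub>R (t + z)) (N *\<^sub>R x)) = (\<lambda>x. h t x * char_fun z x)"
      using N by (simp add: h_def char_fun_scale char_fun_add_left mult.assoc fun_eq_iff)
    finally show ?thesis using N by simp
  qed
  \<comment> \<open>The negative sign matches \<open>coef\<close>. The powers of \<open>N\<close>
    cancel: N^4 from the squared coefficients, N^(-2) from the norm of \<open>h t\<close>, and
    N^(-2) from rescaling the frequencies.\<close>
  let ?G = "\<lambda>\<xi>. ennreal ((cmod (fourier_L1 f ((- 1 / N) *\<^sub>R \<xi>)))\<^sup>2)"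
  have "(\<integral>\<^sup>+\<xi>. ennreal ((cmod (fourier_L1 f \<xi>))\<^sup>2) \<partial>lborel) =
      ennreal ((- 1 / N)\<^sup>2) * (\<integral>\<^sup>+\<xi>. ?G \<xi> \<partial>lborel)"
    by (rule nn_integral_scale) (use N in auto)
  also have "(\<integral>\<^sup>+\<xi>. ?G \<xi> \<partial>lborel) =
      (\<integral>\<^sup>+t. (\<integral>\<^sup>+z. ?G (t + z) \<partial>count_space int_lattice) * indicator unit_cell t \<partial>lborel)"
    by (rule nn_integral_tiling) measurable
  also have "\<dots> = (\<integral>\<^sup>+t. ennreal (N\<^sup>2 * (l2_norm f)\<^sup>2) * indicator unit_cell t \<partial>lborel)"
  proof (intro nn_integral_cong arg_cong2[where f = "(*)"] refl)
    fix t
    have "(\<integral>\<^sup>+z. ?G (t + z) \<partial>count_space int_lattice) =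
        (\<integral>\<^sup>+z. ennreal (N ^ 4) * ennreal ((cmod (\<integral>x. h t x * char_fun z x \<partial>lborel))\<^sup>2) \<partial>count_space int_lattice)"
    proof (rule nn_integral_cong)
      fix z
      have "(cmod (fourier_L1 f ((- 1 / N) *\<^sub>R (t + z))))\<^sup>2 = N ^ 4 * (cmod (\<integral>x. h t x * char_fun z x \<partial>lborel))\<^sup>2"
        unfolding coef using N by (simp add: norm_divide norm_power power_divide)
      then show "?G (t + z) = ennreal (N ^ 4) * ennreal ((cmod (\<integral>x. h t x * char_fun z x \<partial>lborel))\<^sup>2)"
        by (simp only:) (rule ennreal_mult, auto)
    qed
    also have "\<dots> = ennreal (N ^ 4) * ennreal ((l2_norm (h t))\<^sup>2)"
      by (subst nn_integral_cmult) (simp, subst Parseval_unit_cell[OF h h_supp], simp_all)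
    also have "ennreal ((l2_norm (h t))\<^sup>2) = ennreal ((l2_norm f)\<^sup>2 / N\<^sup>2)"
      by (simp only: nn_integral_l2_norm[OF h, symmetric] h_norm)
    also have "ennreal (N ^ 4) * \<dots> = ennreal (N ^ 4 * ((l2_norm f)\<^sup>2 / N\<^sup>2))"
      by (rule ennreal_mult[symmetric]) auto
    also have "N ^ 4 * ((l2_norm f)\<^sup>2 / N\<^sup>2) = N\<^sup>2 * (l2_norm f)\<^sup>2"
      using N by (simp add: field_simps flip: power_add)
    finally show "(\<integral>\<^sup>+z. ?G (t + z) \<partial>count_space int_lattice) = ennreal (N\<^sup>2 * (l2_norm f)\<^sup>2)" .
  qed
  also have "\<dots> = ennreal (N\<^sup>2 * (l2_norm f)\<^sup>2)"
    by (simp add: nn_integral_cmult_indicator emeasure_unit_cell)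
  also have "ennreal ((- 1 / N)\<^sup>2) * \<dots> = ennreal ((- 1 / N)\<^sup>2 * (N\<^sup>2 * (l2_norm f)\<^sup>2))"
    by (rule ennreal_mult[symmetric]) auto
  also have "(- 1 / N)\<^sup>2 * (N\<^sup>2 * (l2_norm f)\<^sup>2) = (l2_norm f)\<^sup>2"
    using N by (simp add: power_divide)
  finally show ?thesis .
qed

definition cut_off :: "(real^2 \<Rightarrow> complex) \<Rightarrow> nat \<Rightarrow> real^2 \<Rightarrow> complex" where
  "cut_off f n x = f x * indicator (ball 0 (real n)) x"

lemma cut_off_measurable [measurable]:
  assumes [measurable]: "f \<in> borel_measurable borel"
  shows "cut_off f n \<in> borel_measurable borel"
proof -
  have [measurable]: "ball 0 (real n) \<in> sets (borel :: (real^2) measure)" by simp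
  show ?thesis unfolding cut_off_def[abs_def] by measurable
qed

lemma square_integrable_cut_off:
  assumes "square_integrable f" shows "square_integrable (cut_off f n)"
  using assms by (intro square_integrable_mono[OF assms, where c = 1]) (auto simp: cut_off_def indicator_def)

lemma integrable_cut_off:
  assumes "square_integrable f" shows "integrable lborel (cut_off f n)"
proof -
  have [measurable]: "ball 0 (real n) \<in> sets (borel :: (real^2) measure)" by simp
  have "square_integrable (indicator (ball 0 (real n)))"
    unfolding square_integrable_def
  proof (intro conjI)
    have "(\<lambda>x. (cmod (indicator (ball 0 (real n)) x))\<^sup>2) = indicator (ball 0 (real n) :: (real^2) set)"
      by (auto simp: indicator_def)
    moreover have "integrable lborel (indicator (ball 0 (real n) :: (real^2) set) :: _ \<Rightarrow> real)"
      by (rule integrable_real_indicator) (use emeasure_bounded_finite[OF bounded_ball] in simp_all)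
    ultimately show "integrable lborel (\<lambda>x :: real^2. (cmod (indicator (ball 0 (real n)) x))\<^sup>2)"
      by (simp only:)
  qed measurable
  moreover have "cnj (indicator B x) = indicator B x" for B and x :: "real^2"
    by (simp add: indicator_def)
  ultimately show ?thesis
    using integrable_l2_product[OF assms, of "indicator (ball 0 (real n))"]
    by (simp only: cut_off_def[abs_def])
qed

lemma cut_off_tendsto:
  assumes f: "square_integrable f"
  shows "(\<lambda>n. l2_norm (\<lambda>x. cut_off f n x - f x)) \<longlonglongrightarrow> 0"
proof -
  have [measurable]: "f \<in> borel_measurable borel" using f by measurable
  have lim: "\<forall>\<^sub>F n in sequentially. cut_off f n x = f x" for x
  proof -
    obtain k :: nat where "norm x < real k" using reals_Archimedean2 by blast
    then show ?thesis
      by (auto simp: eventually_sequentially cut_off_def indicator_def intro!: exI[of _ k])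
  qed
  have "(\<lambda>n. \<integral>x. (cmod (cut_off f n x - f x))\<^sup>2 \<partial>lborel) \<longlonglongrightarrow> (\<integral>x. 0 \<partial>(lborel :: (real^2) measure))"
  proof (rule integral_dominated_convergence)
    show "integrable lborel (\<lambda>x. (cmod (f x))\<^sup>2)" using f by (simp add: square_integrable_def)
    show "AE x in lborel. (\<lambda>n. (cmod (cut_off f n x - f x))\<^sup>2) \<longlonglongrightarrow> 0"
    proof (intro AE_I2 tendsto_eventually)
      fix x show "\<forall>\<^sub>F n in sequentially. (cmod (cut_off f n x - f x))\<^sup>2 = 0"
        using lim[of x] by eventually_elim simp
    qed
    show "(\<lambda>x. (cmod (cut_off f n x - f x))\<^sup>2) \<in> borel_measurable lborel" for n
      by measurable
    show "AE x in lborel. norm ((cmod (cut_off f n x - f x))\<^sup>2) \<le> (cmod (f x))\<^sup>2" for n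
      by (auto simp: cut_off_def indicator_def)
  qed simp
  then show ?thesis
    unfolding l2_norm_def using tendsto_real_sqrt by fastforce
qed

text \<open>Differences of truncations still have bounded support. The choice g = 0 covers a single
  truncation, and g = f the Cauchy differences.\<close>

lemma Plancherel_cut_off:
  fixes m n :: nat
  assumes f: "square_integrable f" and g: "square_integrable g"
  defines "u \<equiv> \<lambda>x. cut_off f m x - cut_off g n x"
  shows "square_integrable (fourier_L1 u)" "l2_norm (fourier_L1 u) = l2_norm u"
proof -
  have u: "square_integrable u"
    unfolding u_def by (intro square_integrable_diff square_integrable_cut_off f g)
  then have [measurable]: "u \<in> borel_measurable borel" by measurable
  have "(\<integral>\<^sup>+\<xi>. ennreal ((cmod (fourier_L1 u \<xi>))\<^sup>2) \<partial>lborel) = ennreal ((l2_norm u)\<^sup>2)"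
  proof (rule Plancherel_bounded_support[OF u])
    \<comment> \<open>The summand 1 keeps the side positive when both radii are 0.\<close>
    show "0 < 2 * (real m + real n + 1)" by simp
    show "norm x < 2 * (real m + real n + 1) / 2" if "u x \<noteq> 0" for x
    proof -
      have "norm x < real m \<or> norm x < real n"
        using that by (auto simp: u_def cut_off_def indicator_def)
      then show ?thesis by auto
    qed
  qed
  moreover from this show "square_integrable (fourier_L1 u)"
    by (intro square_integrableI_nn) (auto simp del: ennreal_power)
  ultimately show "l2_norm (fourier_L1 u) = l2_norm u"
    by (intro l2_norm_eqI_nn) auto
qed

section \<open>From truncations to the Fourier transform on L2\<close>

lemma l2_norm_Cauchy:
  assumes u: "\<And>n. square_integrable (u n)" and f: "square_integrable f"
    and lim: "(\<lambda>n. l2_norm (\<lambda>x. u n x - f x)) \<longlonglongrightarrow> 0" and "e > 0"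
  shows "\<exists>N. \<forall>m\<ge>N. \<forall>n\<ge>N. l2_norm (\<lambda>x. u m x - u n x) < e"
proof -
  have "0 < e / 2" using \<open>e > 0\<close> by simp
  from LIMSEQ_D[OF lim this] obtain N where N: "\<And>n. n \<ge> N \<Longrightarrow> l2_norm (\<lambda>x. u n x - f x) < e / 2"
    by auto
  have "l2_norm (\<lambda>x. u m x - u n x) < e" if "N \<le> m" "N \<le> n" for m n
    using l2_norm_triangle_diff[OF u[of m] f u[of n]] N[OF that(1)] N[OF that(2)]
      l2_norm_minus_commute[of f "u n"] by linarith
  then show ?thesis by blast
qed

text \<open>Because \<open>f\<close> is integrable, the transforms of its truncations converge
  pointwise; because truncations satisfy Plancherel's identity, these transforms are also Cauchy in
  L2. Fatou's lemma shows that the pointwise limit is the limit in norm.\<close>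

theorem Plancherel_L1_L2:
  assumes fi: "integrable lborel f" and f: "square_integrable f"
  shows "square_integrable (fourier_L1 f)" "l2_norm (fourier_L1 f) = l2_norm f"
proof -
  have [measurable]: "f \<in> borel_measurable borel" using f by measurable
  let ?u = "cut_off f"
  note u = square_integrable_cut_off[OF f] and ui = integrable_cut_off[OF f]
  have uhat: "square_integrable (fourier_L1 (?u n))" "l2_norm (fourier_L1 (?u n)) = l2_norm (?u n)" for n
    using Plancherel_cut_off[OF f square_integrable_zero, of n 0] by (simp_all add: cut_off_def[of "\<lambda>x. 0"])
  have diff: "l2_norm (\<lambda>\<xi>. fourier_L1 (?u m) \<xi> - fourier_L1 (?u n) \<xi>) = l2_norm (\<lambda>x. ?u m x - ?u n x)" for m n
    using Plancherel_cut_off(2)[OF f f, of m n] by (simp add: fourier_L1_diff[OF ui ui, abs_def])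
  have pointwise: "(\<lambda>n. fourier_L1 (?u n) \<xi>) \<longlonglongrightarrow> fourier_L1 f \<xi>" for \<xi>
    unfolding fourier_L1_char
  proof (rule integral_dominated_convergence)
    show "integrable lborel (\<lambda>x. cmod (f x))" using fi by simp
    show "AE x in lborel. (\<lambda>n. ?u n x * char_fun (- \<xi>) x) \<longlonglongrightarrow> f x * char_fun (- \<xi>) x"
    proof (intro AE_I2 tendsto_eventually)
      fix x :: "real^2"
      obtain k :: nat where "norm x < real k" using reals_Archimedean2 by blast
      then show "\<forall>\<^sub>F n in sequentially. ?u n x * char_fun (- \<xi>) x = f x * char_fun (- \<xi>) x"
        by (auto simp: eventually_sequentially cut_off_def indicator_def intro!: exI[of _ k])
    qed
    show "(\<lambda>x. ?u n x * char_fun (- \<xi>) x) \<in> borel_measurable lborel" for n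
      by measurable
    show "AE x in lborel. norm (?u n x * char_fun (- \<xi>) x) \<le> cmod (f x)" for n
      by (auto simp: cut_off_def norm_mult indicator_def)
  qed measurable
  have est: "square_integrable (fourier_L1 f) \<and> l2_norm (\<lambda>\<xi>. fourier_L1 f \<xi> - fourier_L1 (?u m) \<xi>) \<le> e"
    if N: "\<forall>m\<ge>N. \<forall>n\<ge>N. l2_norm (\<lambda>x. ?u m x - ?u n x) < e" and "N \<le> m" for N m e
  proof -
    have "\<forall>\<^sub>F n in sequentially. l2_norm (\<lambda>\<xi>. fourier_L1 (?u n) \<xi> - fourier_L1 (?u m) \<xi>) \<le> e"
      using eventually_ge_at_top[of N] by eventually_elim (use N \<open>N \<le> m\<close> in \<open>auto simp: diff less_imp_le\<close>)
    then show ?thesis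
      using square_integrable_Fatou[of "\<lambda>n. fourier_L1 (?u n)" "fourier_L1 f" "fourier_L1 (?u m)" e] uhat pointwise
      by simp
  qed
  note cauchy = l2_norm_Cauchy[OF u f cut_off_tendsto[OF f]]
  show s: "square_integrable (fourier_L1 f)"
    using cauchy[of 1] est by (meson order_refl zero_less_one)
  have "(\<lambda>n. l2_norm (\<lambda>\<xi>. fourier_L1 (?u n) \<xi> - fourier_L1 f \<xi>)) \<longlonglongrightarrow> 0"
  proof (rule LIMSEQ_I)
    fix e :: real assume "0 < e"
    then have "0 < e / 2" by simp
    from cauchy[OF this] obtain N where N: "\<forall>m\<ge>N. \<forall>n\<ge>N. l2_norm (\<lambda>x. ?u m x - ?u n x) < e / 2" by blast
    have "norm (l2_norm (\<lambda>\<xi>. fourier_L1 (?u n) \<xi> - fourier_L1 f \<xi>) - 0) < e" if "N \<le> n" for n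
    proof -
      have "l2_norm (\<lambda>\<xi>. fourier_L1 (?u n) \<xi> - fourier_L1 f \<xi>) \<le> e / 2"
        using est[OF N that] by (subst l2_norm_minus_commute) simp
      then show ?thesis using \<open>0 < e\<close> by simp
    qed
    then show "\<exists>N. \<forall>n\<ge>N. norm (l2_norm (\<lambda>\<xi>. fourier_L1 (?u n) \<xi> - fourier_L1 f \<xi>) - 0) < e" by blast
  qed
  from l2_norm_tendsto[OF uhat(1) s this]
  have "(\<lambda>n. l2_norm (?u n)) \<longlonglongrightarrow> l2_norm (fourier_L1 f)" by (simp add: uhat)
  moreover have "(\<lambda>n. l2_norm (?u n)) \<longlonglongrightarrow> l2_norm f"
    by (rule l2_norm_tendsto[OF u f cut_off_tendsto[OF f]])
  ultimately show "l2_norm (fourier_L1 f) = l2_norm f" by (rule LIMSEQ_unique)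
qed

text \<open>\<open>is_fourier_L2\<close> speaks of every approximating sequence, but one is enough:
  Plancherel's identity for \<open>v n - u n\<close> bounds the distance between the transforms of
  two sequences by the distance between the sequences.\<close>

lemma is_fourier_L2I:
  assumes f: "square_integrable f" and g: "square_integrable g"
    and ui: "\<And>n. integrable lborel (u n)" and u: "\<And>n. square_integrable (u n)"
    and lim: "(\<lambda>n. l2_norm (\<lambda>x. u n x - f x)) \<longlonglongrightarrow> 0"
    and lim': "(\<lambda>n. l2_norm (\<lambda>\<xi>. fourier_L1 (u n) \<xi> - g \<xi>)) \<longlonglongrightarrow> 0"
  shows "is_fourier_L2 f g"
  unfolding is_fourier_L2_def
proof (intro conjI allI impI g)
  fix v n
  assume "\<forall>n. integrable lborel (v n) \<and> square_integrable (v n)"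
  then show "square_integrable (fourier_L1 (v n))" by (intro Plancherel_L1_L2) auto
next
  fix v :: "nat \<Rightarrow> real^2 \<Rightarrow> complex"
  assume "\<forall>n. integrable lborel (v n) \<and> square_integrable (v n)"
    and vlim: "(\<lambda>n. l2_norm (\<lambda>x. v n x - f x)) \<longlonglongrightarrow> 0"
  then have vi: "integrable lborel (v n)" and v: "square_integrable (v n)" for n by auto
  have "(\<lambda>n. (l2_norm (\<lambda>x. v n x - f x) + l2_norm (\<lambda>x. u n x - f x)) +
      l2_norm (\<lambda>\<xi>. fourier_L1 (u n) \<xi> - g \<xi>)) \<longlonglongrightarrow> 0"
    using tendsto_add[OF tendsto_add[OF vlim lim] lim'] by simp
  then show "(\<lambda>n. l2_norm (\<lambda>\<xi>. fourier_L1 (v n) \<xi> - g \<xi>)) \<longlonglongrightarrow> 0"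
  proof (rule Lim_null_comparison[rotated], intro always_eventually allI)
    fix n
    note vn = Plancherel_L1_L2[OF vi v, of n] and un = Plancherel_L1_L2[OF ui u, of n]
    have "l2_norm (\<lambda>\<xi>. fourier_L1 (v n) \<xi> - g \<xi>) \<le>
        l2_norm (\<lambda>\<xi>. fourier_L1 (v n) \<xi> - fourier_L1 (u n) \<xi>) + l2_norm (\<lambda>\<xi>. fourier_L1 (u n) \<xi> - g \<xi>)"
      by (intro l2_norm_triangle_diff vn un g)
    also have "l2_norm (\<lambda>\<xi>. fourier_L1 (v n) \<xi> - fourier_L1 (u n) \<xi>) = l2_norm (\<lambda>x. v n x - u n x)"
      using Plancherel_L1_L2(2)[OF Bochner_Integration.integrable_diff[OF vi[of n] ui[of n]] square_integrable_diff[OF v u]]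
      by (simp add: fourier_L1_diff[OF vi ui, abs_def])
    also have "\<dots> \<le> l2_norm (\<lambda>x. v n x - f x) + l2_norm (\<lambda>x. u n x - f x)"
      using l2_norm_triangle_diff[OF v[of n] f u[of n]] l2_norm_minus_commute[of f "u n"] by simp
    finally show "norm (l2_norm (\<lambda>\<xi>. fourier_L1 (v n) \<xi> - g \<xi>)) \<le>
        (l2_norm (\<lambda>x. v n x - f x) + l2_norm (\<lambda>x. u n x - f x)) + l2_norm (\<lambda>\<xi>. fourier_L1 (u n) \<xi> - g \<xi>)"
      by simp
  qed
qed

lemma is_fourier_L2_cut_off:
  assumes "is_fourier_L2 f g" "square_integrable f"
  shows "(\<lambda>n. l2_norm (\<lambda>\<xi>. fourier_L1 (cut_off f n) \<xi> - g \<xi>)) \<longlonglongrightarrow> 0"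
  using assms cut_off_tendsto[OF assms(2)] square_integrable_cut_off[OF assms(2)] integrable_cut_off[OF assms(2)]
  unfolding is_fourier_L2_def by blast

lemma is_fourier_L2_square_integrable: "is_fourier_L2 f g \<Longrightarrow> square_integrable g"
  by (simp add: is_fourier_L2_def)

theorem is_fourier_L2_exists:
  assumes f: "square_integrable f"
  shows "\<exists>g. is_fourier_L2 f g"
proof -
  let ?u = "cut_off f"
  note u = square_integrable_cut_off[OF f] and ui = integrable_cut_off[OF f]
  note uhat = Plancherel_L1_L2[OF ui u]
  have diff: "l2_norm (\<lambda>\<xi>. fourier_L1 (?u m) \<xi> - fourier_L1 (?u n) \<xi>) = l2_norm (\<lambda>x. ?u m x - ?u n x)" for m n
    using Plancherel_cut_off(2)[OF f f, of m n] by (simp add: fourier_L1_diff[OF ui ui, abs_def])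
  obtain g where "square_integrable g" "(\<lambda>n. l2_norm (\<lambda>\<xi>. fourier_L1 (?u n) \<xi> - g \<xi>)) \<longlonglongrightarrow> 0"
  proof (rule l2_complete[of "\<lambda>n. fourier_L1 (?u n)"])
    show "square_integrable (fourier_L1 (?u n))" for n by (rule uhat(1))
    show "\<exists>N. \<forall>m\<ge>N. \<forall>n\<ge>N. l2_norm (\<lambda>\<xi>. fourier_L1 (?u m) \<xi> - fourier_L1 (?u n) \<xi>) < e" if "e > 0" for e
      unfolding diff by (rule l2_norm_Cauchy[OF u f cut_off_tendsto[OF f] that])
  qed
  then have "is_fourier_L2 f g"
    by (intro is_fourier_L2I[OF f _ ui u cut_off_tendsto[OF f]])
  then show ?thesis by blast
qed

corollary is_fourier_L2_fourier:
  "square_integrable f \<Longrightarrow> is_fourier_L2 f (fourier f)"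
  unfolding fourier_def using is_fourier_L2_exists by (rule someI_ex)

lemma is_fourier_L2_norm:
  assumes "is_fourier_L2 f g" "square_integrable f"
  shows "l2_norm g = l2_norm f"
proof (rule LIMSEQ_unique)
  note u = square_integrable_cut_off[OF assms(2)] and ui = integrable_cut_off[OF assms(2)]
  show "(\<lambda>n. l2_norm (fourier_L1 (cut_off f n))) \<longlonglongrightarrow> l2_norm g"
    by (rule l2_norm_tendsto[OF Plancherel_L1_L2(1)[OF ui u] is_fourier_L2_square_integrable[OF assms(1)]
        is_fourier_L2_cut_off[OF assms]])
  show "(\<lambda>n. l2_norm (fourier_L1 (cut_off f n))) \<longlonglongrightarrow> l2_norm f"
    unfolding Plancherel_L1_L2(2)[OF ui u]
    by (rule l2_norm_tendsto[OF u assms(2) cut_off_tendsto[OF assms(2)]])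
qed

lemma is_fourier_L2_cong_AE:
  assumes "is_fourier_L2 f g" "square_integrable f" "h \<in> borel_measurable borel" "AE \<xi> in lborel. g \<xi> = h \<xi>"
  shows "is_fourier_L2 f h"
proof (rule is_fourier_L2I[OF assms(2) _ integrable_cut_off[OF assms(2)] square_integrable_cut_off[OF assms(2)]
    cut_off_tendsto[OF assms(2)]])
  have g: "square_integrable g" using assms(1) by (rule is_fourier_L2_square_integrable)
  show "square_integrable h" by (rule square_integrable_cong_AE[OF g assms(3,4)])
  have [measurable]: "h \<in> borel_measurable borel" "g \<in> borel_measurable borel" "f \<in> borel_measurable borel"
    using assms g by measurable
  have "l2_norm (\<lambda>\<xi>. fourier_L1 (cut_off f n) \<xi> - h \<xi>) = l2_norm (\<lambda>\<xi>. fourier_L1 (cut_off f n) \<xi> - g \<xi>)" for n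
  proof (rule l2_norm_cong_AE)
    show "(\<lambda>\<xi>. fourier_L1 (cut_off f n) \<xi> - h \<xi>) \<in> borel_measurable borel"
      "(\<lambda>\<xi>. fourier_L1 (cut_off f n) \<xi> - g \<xi>) \<in> borel_measurable borel" by measurable
    show "AE \<xi> in lborel. fourier_L1 (cut_off f n) \<xi> - h \<xi> = fourier_L1 (cut_off f n) \<xi> - g \<xi>"
      using assms(4) by eventually_elim simp
  qed
  then show "(\<lambda>n. l2_norm (\<lambda>\<xi>. fourier_L1 (cut_off f n) \<xi> - h \<xi>)) \<longlonglongrightarrow> 0"
    using is_fourier_L2_cut_off[OF assms(1,2)] by simp
qed

lemma is_fourier_L2_add_cmult:
  assumes F: "is_fourier_L2 f f'" "square_integrable f" and G: "is_fourier_L2 g g'" "square_integrable g"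
  shows "is_fourier_L2 (\<lambda>x. f x + c * g x) (\<lambda>\<xi>. f' \<xi> + c * g' \<xi>)"
proof -
  note uf = square_integrable_cut_off[OF F(2)] and uif = integrable_cut_off[OF F(2)]
  note ug = square_integrable_cut_off[OF G(2)] and uig = integrable_cut_off[OF G(2)]
  note f' = is_fourier_L2_square_integrable[OF F(1)] and g' = is_fourier_L2_square_integrable[OF G(1)]
  have comb: "(\<lambda>n. l2_norm (\<lambda>x. (a n x + c * b n x) - (a' x + c * b' x))) \<longlonglongrightarrow> 0"
    if a: "\<And>n. square_integrable (a n)" "square_integrable a'" and b: "\<And>n. square_integrable (b n)" "square_integrable b'"
      and la: "(\<lambda>n. l2_norm (\<lambda>x. a n x - a' x)) \<longlonglongrightarrow> 0" and lb: "(\<lambda>n. l2_norm (\<lambda>x. b n x - b' x)) \<longlonglongrightarrow> 0"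
    for a b a' b'
  proof (rule Lim_null_comparison)
    show "(\<lambda>n. l2_norm (\<lambda>x. a n x - a' x) + cmod c * l2_norm (\<lambda>x. b n x - b' x)) \<longlonglongrightarrow> 0"
      using tendsto_add[OF la tendsto_mult_right_zero[OF lb]] by simp
    have "(\<lambda>x. (a n x + c * b n x) - (a' x + c * b' x)) = (\<lambda>x. (a n x - a' x) + c * (b n x - b' x))" for n
      by (simp add: algebra_simps)
    then show "\<forall>\<^sub>F n in sequentially. norm (l2_norm (\<lambda>x. (a n x + c * b n x) - (a' x + c * b' x))) \<le>
        l2_norm (\<lambda>x. a n x - a' x) + cmod c * l2_norm (\<lambda>x. b n x - b' x)"
      using l2_norm_triangle[OF square_integrable_diff[OF a] square_integrable_cmult[OF square_integrable_diff[OF b]]]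
      by (simp add: l2_norm_cmult)
  qed
  show ?thesis
  proof (rule is_fourier_L2I[where u = "\<lambda>n x. cut_off f n x + c * cut_off g n x"])
    show "square_integrable (\<lambda>x. f x + c * g x)" "square_integrable (\<lambda>\<xi>. f' \<xi> + c * g' \<xi>)"
      by (intro square_integrable_add square_integrable_cmult F G f' g')+
    show "integrable lborel (\<lambda>x. cut_off f n x + c * cut_off g n x)" for n
      using uif[of n] uig[of n] by simp
    show "square_integrable (\<lambda>x. cut_off f n x + c * cut_off g n x)" for n
      by (intro square_integrable_add square_integrable_cmult uf ug)
    show "(\<lambda>n. l2_norm (\<lambda>x. cut_off f n x + c * cut_off g n x - (f x + c * g x))) \<longlonglongrightarrow> 0"
      by (intro comb uf ug F G cut_off_tendsto)
    have "fourier_L1 (\<lambda>x. cut_off f n x + c * cut_off g n x) \<xi> =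
        fourier_L1 (cut_off f n) \<xi> + c * fourier_L1 (cut_off g n) \<xi>" for n \<xi>
      using fourier_L1_add[of "cut_off f n" "\<lambda>x. c * cut_off g n x"] uif[of n] uig[of n]
      by (simp add: fourier_L1_cmult)
    then show "(\<lambda>n. l2_norm (\<lambda>\<xi>. fourier_L1 (\<lambda>x. cut_off f n x + c * cut_off g n x) \<xi> - (f' \<xi> + c * g' \<xi>))) \<longlonglongrightarrow> 0"
      by (simp only:) (intro comb Plancherel_L1_L2 uf ug uif uig f' g' is_fourier_L2_cut_off F G)
  qed
qed

text \<open>Polarization: preserving the norm of f + c g means preserving the real part of <f, c g>.
  The choices c = 1 and c = \<i> give the real and the imaginary part of <f, g>.\<close>

theorem Parseval_L2:
  assumes F: "is_fourier_L2 f f'" "square_integrable f" and G: "is_fourier_L2 g g'" "square_integrable g"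
  shows "l2_inner f g = l2_inner f' g'"
proof -
  note f' = is_fourier_L2_square_integrable[OF F(1)] and g' = is_fourier_L2_square_integrable[OF G(1)]
  have re: "Re (l2_inner f (\<lambda>x. c * g x)) = Re (l2_inner f' (\<lambda>x. c * g' x))" for c
  proof -
    have "l2_norm (\<lambda>\<xi>. f' \<xi> + c * g' \<xi>) = l2_norm (\<lambda>x. f x + c * g x)"
      by (intro is_fourier_L2_norm is_fourier_L2_add_cmult F G square_integrable_add square_integrable_cmult)
    then have "(l2_norm (\<lambda>\<xi>. f' \<xi> + c * g' \<xi>))\<^sup>2 = (l2_norm (\<lambda>x. f x + c * g x))\<^sup>2" by simp
    then show ?thesis
      unfolding l2_norm_power2_add[OF F(2) square_integrable_cmult[OF G(2)]]
        l2_norm_power2_add[OF f' square_integrable_cmult[OF g']] l2_norm_cmult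
        is_fourier_L2_norm[OF F] is_fourier_L2_norm[OF G] by simp
  qed
  have right: "l2_inner h (\<lambda>x. \<i> * k x) = - \<i> * l2_inner h k" for h k
    by (subst l2_inner_commute, subst l2_inner_cmult_left, subst l2_inner_commute) simp
  show ?thesis
    using re[of 1] re[of \<i>] unfolding right by (simp add: complex_eq_iff)
qed


section \<open>One generation of wavepackets\<close>

lemma matrix_inv_mult:
  assumes "invertible M"
  shows "M ** matrix_inv M = mat 1" "matrix_inv M ** M = mat 1"
proof -
  have "M ** matrix_inv M = mat 1 \<and> matrix_inv M ** M = mat 1"
    unfolding matrix_inv_def using assms unfolding invertible_def by (rule someI_ex)
  then show "M ** matrix_inv M = mat 1" "matrix_inv M ** M = mat 1" by auto
qed

text \<open>It has two roles: \<open>dual_mat P\<close> generates the dual lattice of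
  \<open>lattice_of P\<close>, and \<open>dual_mat (A_mat j k)\<close> is
  \<open>B_mat j k\<close>.\<close>

definition dual_mat :: "real^2^2 \<Rightarrow> real^2^2" where
  "dual_mat A = matrix_inv (transpose A)"

lemma dual_mat:
  assumes "invertible A"
  shows "invertible (dual_mat A)" "transpose A ** dual_mat A = mat 1" "dual_mat A ** transpose A = mat 1"
    "\<bar>det (dual_mat A)\<bar> = 1 / \<bar>det A\<bar>"
proof -
  have "invertible (transpose A)"
    using assms by (simp add: invertible_det_nz)
  note inv = matrix_inv_mult[OF this]
  show 1: "transpose A ** dual_mat A = mat 1" "dual_mat A ** transpose A = mat 1"
    unfolding dual_mat_def by (rule inv)+
  then show "invertible (dual_mat A)" by (auto simp: invertible_def)
  have "det A * det (dual_mat A) = 1"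
    using arg_cong[OF 1(1), of det] by (simp add: det_mul)
  then have "\<bar>det A\<bar> * \<bar>det (dual_mat A)\<bar> = 1" by (metis abs_mult abs_one)
  moreover have "\<bar>det A\<bar> \<noteq> 0" using assms by (simp add: invertible_det_nz)
  ultimately show "\<bar>det (dual_mat A)\<bar> = 1 / \<bar>det A\<bar>"
    by (metis nonzero_mult_div_cancel_left)
qed

lemma dual_mat_inner:
  assumes "invertible A"
  shows "(A *v x) \<bullet> (dual_mat A *v y) = x \<bullet> y"
proof -
  have "(A *v x) \<bullet> (dual_mat A *v y) = x \<bullet> (transpose A *v (dual_mat A *v y))"
    by (metis dot_lmul_matrix inner_commute transpose_matrix_vector)
  then show ?thesis by (simp add: matrix_vector_mul_assoc dual_mat[OF assms])
qed

lemma char_fun_dual: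
  "invertible A \<Longrightarrow> char_fun (A *v z) (dual_mat A *v x) = char_fun z x"
  by (simp add: char_fun_def dual_mat_inner)

lemma l2_norm_affine:
  fixes A :: "real^2^2"
  assumes A: "invertible A" and f: "square_integrable f"
  shows "square_integrable (\<lambda>x. f (A *v x - l))" "l2_norm (\<lambda>x. f (A *v x - l)) = l2_norm f / sqrt \<bar>det A\<bar>"
proof -
  have [measurable]: "f \<in> borel_measurable borel" using f by measurable
  have d: "\<bar>det A\<bar> > 0" using A by (simp add: invertible_det_nz)
  have "ennreal \<bar>det A\<bar> * (\<integral>\<^sup>+x. ennreal ((cmod (f (A *v x - l)))\<^sup>2) \<partial>lborel) =
      (\<integral>\<^sup>+x. ennreal ((cmod (f (x - l)))\<^sup>2) \<partial>lborel)"
    by (rule nn_integral_matrix[OF A, symmetric]) measurable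
  also have "\<dots> = ennreal ((l2_norm f)\<^sup>2)"
    unfolding nn_integral_l2_norm[OF f, symmetric]
    using nn_integral_translation[of "\<lambda>x. ennreal ((cmod (f (x - l)))\<^sup>2)" l] by simp
  finally have "ennreal (1 / \<bar>det A\<bar>) * (ennreal \<bar>det A\<bar> * (\<integral>\<^sup>+x. ennreal ((cmod (f (A *v x - l)))\<^sup>2) \<partial>lborel)) =
      ennreal (1 / \<bar>det A\<bar>) * ennreal ((l2_norm f)\<^sup>2)" by (simp only:)
  moreover have "ennreal (1 / \<bar>det A\<bar>) * ennreal \<bar>det A\<bar> = 1"
    using d by (subst ennreal_mult[symmetric]) auto
  moreover have "ennreal (1 / \<bar>det A\<bar>) * ennreal ((l2_norm f)\<^sup>2) = ennreal ((l2_norm f / sqrt \<bar>det A\<bar>)\<^sup>2)"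
    using d by (subst ennreal_mult[symmetric]) (auto simp: power_divide)
  ultimately have eq: "(\<integral>\<^sup>+x. ennreal ((cmod (f (A *v x - l)))\<^sup>2) \<partial>lborel) = ennreal ((l2_norm f / sqrt \<bar>det A\<bar>)\<^sup>2)"
    by (simp only: mult.assoc[symmetric] mult_1_left)
  show s: "square_integrable (\<lambda>x. f (A *v x - l))"
    by (rule square_integrableI_nn) (simp_all add: eq del: ennreal_power)
  show "l2_norm (\<lambda>x. f (A *v x - l)) = l2_norm f / sqrt \<bar>det A\<bar>"
    by (rule l2_norm_eqI_nn[OF s eq]) simp
qed

lemmas l2_norm_linear = l2_norm_affine[where l = 0, simplified]

lemma fourier_L1_affine:
  fixes A :: "real^2^2"
  assumes A: "invertible A" and [measurable]: "u \<in> borel_measurable borel"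
  shows "fourier_L1 (\<lambda>x. u (A *v x - l)) \<xi> =
    of_real (1 / \<bar>det A\<bar>) * (fourier_L1 u (dual_mat A *v \<xi>) * char_fun (- l) (dual_mat A *v \<xi>))"
proof -
  let ?\<eta> = "dual_mat A *v \<xi>"
  have d: "\<bar>det A\<bar> > 0" using A by (simp add: invertible_det_nz)
  have "fourier_L1 u ?\<eta> = (\<integral>x. u (x - l) * char_fun (- ?\<eta>) (x - l) \<partial>lborel)"
    unfolding fourier_L1_char
    using integral_translation[of "\<lambda>x. u x * char_fun (- ?\<eta>) x" "- l"] by simp
  also have "\<dots> = of_real \<bar>det A\<bar> * (\<integral>x. u (A *v x - l) * char_fun (- ?\<eta>) (A *v x - l) \<partial>lborel)"
    using integral_matrix[OF A, of "\<lambda>x. u (x - l) * char_fun (- ?\<eta>) (x - l)"] by simp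
  also have "(\<lambda>x. u (A *v x - l) * char_fun (- ?\<eta>) (A *v x - l)) =
      (\<lambda>x. u (A *v x - l) * char_fun (- \<xi>) x * char_fun l ?\<eta>)"
  proof
    fix x
    have "(A *v x) \<bullet> ?\<eta> = x \<bullet> \<xi>" by (rule dual_mat_inner[OF A])
    then have "char_fun (- ?\<eta>) (A *v x - l) = char_fun (- \<xi>) x * char_fun l ?\<eta>"
      by (simp add: char_fun_def cis_mult inner_diff_right inner_commute algebra_simps)
    then show "u (A *v x - l) * char_fun (- ?\<eta>) (A *v x - l) = u (A *v x - l) * char_fun (- \<xi>) x * char_fun l ?\<eta>"
      by (simp add: mult.assoc)
  qed
  finally have "fourier_L1 u ?\<eta> = of_real \<bar>det A\<bar> * fourier_L1 (\<lambda>x. u (A *v x - l)) \<xi> * char_fun l ?\<eta>"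
    by (simp add: fourier_L1_char)
  moreover have "char_fun l ?\<eta> * char_fun (- l) ?\<eta> = 1"
    by (simp add: char_fun_add_left[symmetric])
  ultimately show ?thesis using d by (simp add: mult.assoc)
qed

text \<open>Truncating before substituting keeps the approximants integrable, so the integral
  formula applies to each; the substitutions on both sides merely rescale the L2 distance.\<close>

theorem is_fourier_L2_affine:
  fixes A :: "real^2^2"
  assumes A: "invertible A" and F: "is_fourier_L2 f g" "square_integrable f"
  shows "is_fourier_L2 (\<lambda>x. f (A *v x - l))
    (\<lambda>\<xi>. of_real (1 / \<bar>det A\<bar>) * (g (dual_mat A *v \<xi>) * char_fun (- l) (dual_mat A *v \<xi>)))"
proof -
  let ?B = "dual_mat A"
  note B = dual_mat(1)[OF A]
  note u = square_integrable_cut_off[OF F(2)] and ui = integrable_cut_off[OF F(2)]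
  note uhat = Plancherel_L1_L2(1)[OF ui u]
  have g: "square_integrable g" by (rule is_fourier_L2_square_integrable[OF F(1)])
  have [measurable]: "f \<in> borel_measurable borel" "g \<in> borel_measurable borel" using F g by measurable
  have norm_eq: "l2_norm (\<lambda>\<xi>. of_real (1 / \<bar>det A\<bar>) * (h (?B *v \<xi>) * char_fun (- l) (?B *v \<xi>))) =
      1 / \<bar>det A\<bar> * (l2_norm h / sqrt \<bar>det ?B\<bar>)" if "square_integrable h" for h
    unfolding l2_norm_cmult
    using l2_norm_linear(2)[OF B that] by (simp add: l2_norm_def norm_mult norm_divide)
  show ?thesis
  proof (rule is_fourier_L2I[where u = "\<lambda>n x. cut_off f n (A *v x - l)"])
    show "square_integrable (\<lambda>x. f (A *v x - l))" by (rule l2_norm_affine[OF A F(2)])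
    show "square_integrable (\<lambda>x. cut_off f n (A *v x - l))" for n by (rule l2_norm_affine[OF A u])
    show "square_integrable (\<lambda>\<xi>. of_real (1 / \<bar>det A\<bar>) * (g (?B *v \<xi>) * char_fun (- l) (?B *v \<xi>)))"
      by (rule square_integrable_mono[OF l2_norm_linear(1)[OF B g], where c = "1 / \<bar>det A\<bar>"])
         (auto simp: norm_mult norm_divide)
    show "integrable lborel (\<lambda>x. cut_off f n (A *v x - l))" for n
    proof -
      have "distr lborel borel ((+) (- l)) = (lborel :: (real^2) measure)" by (rule lborel_distr_plus)
      then have "integrable (distr lborel borel ((+) (- l))) (cut_off f n)" using ui by simp
      then have "integrable lborel (\<lambda>x. cut_off f n (- l + x))"
        by (subst (asm) integrable_distr_eq) auto
      from integrable_matrix[OF A this] show ?thesis by simp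
    qed
    have "l2_norm (\<lambda>x. cut_off f n (A *v x - l) - f (A *v x - l)) =
        l2_norm (\<lambda>x. cut_off f n x - f x) / sqrt \<bar>det A\<bar>" for n
      using l2_norm_affine(2)[OF A square_integrable_diff[OF u[of n] F(2)]] .
    then show "(\<lambda>n. l2_norm (\<lambda>x. cut_off f n (A *v x - l) - f (A *v x - l))) \<longlonglongrightarrow> 0"
      using tendsto_divide_zero[OF cut_off_tendsto[OF F(2)]] by simp
    have "l2_norm (\<lambda>\<xi>. fourier_L1 (\<lambda>x. cut_off f n (A *v x - l)) \<xi> -
        of_real (1 / \<bar>det A\<bar>) * (g (?B *v \<xi>) * char_fun (- l) (?B *v \<xi>))) =
        1 / \<bar>det A\<bar> * (l2_norm (\<lambda>\<xi>. fourier_L1 (cut_off f n) \<xi> - g \<xi>) / sqrt \<bar>det ?B\<bar>)" for n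
    proof -
      have "cut_off f n \<in> borel_measurable borel" by measurable
      note fourier_L1_affine[OF A this]
      then have "(\<lambda>\<xi>. fourier_L1 (\<lambda>x. cut_off f n (A *v x - l)) \<xi> -
          of_real (1 / \<bar>det A\<bar>) * (g (?B *v \<xi>) * char_fun (- l) (?B *v \<xi>))) =
          (\<lambda>\<xi>. of_real (1 / \<bar>det A\<bar>) * ((fourier_L1 (cut_off f n) (?B *v \<xi>) - g (?B *v \<xi>)) * char_fun (- l) (?B *v \<xi>)))"
        by (simp only: right_diff_distrib left_diff_distrib)
      then show ?thesis
        using norm_eq[OF square_integrable_diff[OF uhat[of n] g]] by simp
    qed
    then show "(\<lambda>n. l2_norm (\<lambda>\<xi>. fourier_L1 (\<lambda>x. cut_off f n (A *v x - l)) \<xi> -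
        of_real (1 / \<bar>det A\<bar>) * (g (?B *v \<xi>) * char_fun (- l) (?B *v \<xi>)))) \<longlonglongrightarrow> 0"
      by (simp only:) (intro tendsto_mult_right_zero tendsto_divide_zero is_fourier_L2_cut_off[OF F])
  qed
qed

text \<open>
  The Schur test: \<open>\<bar>F x\<bar> \<bar>F (x + g)\<bar>\<close> is bounded by the arithmetic mean of the two products with
  only one value of \<open>a\<close>, and the shift \<open>g \<mapsto> -g\<close> identifies the resulting two sums.
\<close>

lemma off_diagonal_Schur:
  fixes a p :: "real^2 \<Rightarrow> complex"
  assumes [measurable]: "a \<in> borel_measurable borel" "p \<in> borel_measurable borel"
    and bound: "\<And>x. (\<integral>\<^sup>+g. ennreal (cmod (p x) * cmod (p (x + g))) * indicator (- {0}) g \<partial>count_space int_lattice)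
      \<le> ennreal (v x)"
  shows "off_diagonal (\<lambda>x. a x * cnj (p x)) \<le> (\<integral>\<^sup>+x. ennreal ((cmod (a x))\<^sup>2) * ennreal (v x) \<partial>lborel)"
proof -
  let ?C = "count_space int_lattice"
  define q where "q = (\<lambda>g x. ennreal (cmod (p x) * cmod (p (x + g))) * indicator (- {0}) g)"
  define J where "J = (\<lambda>g. \<integral>\<^sup>+x. ennreal ((cmod (a x))\<^sup>2) * q g x \<partial>lborel)"
  have [measurable]: "q g \<in> borel_measurable borel" for g
    unfolding q_def by measurable
  have "off_diagonal (\<lambda>x. a x * cnj (p x)) =
      (\<integral>\<^sup>+x. \<integral>\<^sup>+g. ennreal (cmod (a x * cnj (p x))) * (ennreal (cmod (a (x + g) * cnj (p (x + g)))) * indicator (- {0}) g) \<partial>?C \<partial>lborel)"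
    unfolding off_diagonal_def by (intro nn_integral_cong nn_integral_cmult[symmetric]) simp
  also have "\<dots> \<le> (\<integral>\<^sup>+x. \<integral>\<^sup>+g. ennreal (1 / 2) * (ennreal ((cmod (a x))\<^sup>2) * q g x)
      + ennreal (1 / 2) * (ennreal ((cmod (a (x + g)))\<^sup>2) * q g x) \<partial>?C \<partial>lborel)"
  proof (intro nn_integral_mono)
    fix x g
    let ?a = "cmod (a x)" and ?b = "cmod (a (x + g))" and ?r = "cmod (p x) * cmod (p (x + g))"
    have "2 * (?a * ?b) \<le> ?a\<^sup>2 + ?b\<^sup>2"
      using sum_squares_bound[of ?a ?b] by simp
    then have "2 * (?a * ?b) * ?r \<le> (?a\<^sup>2 + ?b\<^sup>2) * ?r"
      by (rule mult_right_mono) simp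
    then have le: "?a * cmod (p x) * (?b * cmod (p (x + g))) \<le> 1 / 2 * (?a\<^sup>2 * ?r) + 1 / 2 * (?b\<^sup>2 * ?r)"
      by (simp add: algebra_simps)
    have m: "ennreal (s * t) = ennreal s * ennreal t" if "0 \<le> s" "0 \<le> t" for s t
      using that by (rule ennreal_mult)
    have "ennreal (?a * cmod (p x)) * ennreal (?b * cmod (p (x + g))) =
        ennreal (?a * cmod (p x) * (?b * cmod (p (x + g))))"
      by (rule m[symmetric]) auto
    also have "\<dots> \<le> ennreal (1 / 2 * (?a\<^sup>2 * ?r) + 1 / 2 * (?b\<^sup>2 * ?r))"
      by (rule ennreal_leI[OF le])
    also have "\<dots> = ennreal (1 / 2 * (?a\<^sup>2 * ?r)) + ennreal (1 / 2 * (?b\<^sup>2 * ?r))"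
      by (rule ennreal_plus) auto
    also have "\<dots> = ennreal (1 / 2) * (ennreal (?a\<^sup>2) * ennreal ?r) + ennreal (1 / 2) * (ennreal (?b\<^sup>2) * ennreal ?r)"
      using m[of "1 / 2" "?a\<^sup>2 * ?r"] m[of "?a\<^sup>2" ?r] m[of "1 / 2" "?b\<^sup>2 * ?r"] m[of "?b\<^sup>2" ?r]
      by (simp only: zero_le_power2 zero_le_mult_iff norm_ge_zero simp_thms zero_le_divide_1_iff zero_le_numeral)
    finally have "ennreal (?a * cmod (p x)) * ennreal (?b * cmod (p (x + g))) \<le>
        ennreal (1 / 2) * (ennreal (?a\<^sup>2) * ennreal ?r) + ennreal (1 / 2) * (ennreal (?b\<^sup>2) * ennreal ?r)" .
    then show "ennreal (cmod (a x * cnj (p x))) * (ennreal (cmod (a (x + g) * cnj (p (x + g)))) * indicator (- {0}) g)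
      \<le> ennreal (1 / 2) * (ennreal (?a\<^sup>2) * q g x) + ennreal (1 / 2) * (ennreal (?b\<^sup>2) * q g x)"
      by (cases "g = 0") (simp_all add: q_def norm_mult del: ennreal_power)
  qed
  also have "\<dots> = (\<integral>\<^sup>+g. \<integral>\<^sup>+x. ennreal (1 / 2) * (ennreal ((cmod (a x))\<^sup>2) * q g x)
      + ennreal (1 / 2) * (ennreal ((cmod (a (x + g)))\<^sup>2) * q g x) \<partial>lborel \<partial>?C)"
    by (rule nn_integral_count_space_nn_integral) simp_all
  also have "\<dots> = (\<integral>\<^sup>+g. ennreal (1 / 2) * J g + ennreal (1 / 2) * J (- g) \<partial>?C)"
  proof (rule nn_integral_cong)
    fix g
    have "(\<integral>\<^sup>+x. ennreal ((cmod (a (x + g)))\<^sup>2) * q g x \<partial>lborel) =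
        (\<integral>\<^sup>+x. ennreal ((cmod (a (x + g)))\<^sup>2) * q (- g) (x + g) \<partial>lborel)"
      by (intro nn_integral_cong) (simp add: q_def mult.commute indicator_def)
    also have "\<dots> = J (- g)"
      unfolding J_def using nn_integral_translation[of "\<lambda>x. ennreal ((cmod (a x))\<^sup>2) * q (- g) x" g] by simp
    finally show "(\<integral>\<^sup>+x. ennreal (1 / 2) * (ennreal ((cmod (a x))\<^sup>2) * q g x)
      + ennreal (1 / 2) * (ennreal ((cmod (a (x + g)))\<^sup>2) * q g x) \<partial>lborel) =
      ennreal (1 / 2) * J g + ennreal (1 / 2) * J (- g)"
      by (subst nn_integral_add) (simp_all add: nn_integral_cmult J_def)
  qed
  also have "\<dots> = ennreal (1 / 2) * (\<integral>\<^sup>+g. J g \<partial>?C) + ennreal (1 / 2) * (\<integral>\<^sup>+g. J (- g) \<partial>?C)"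
    by (subst nn_integral_add) (simp_all add: nn_integral_cmult)
  also have "(\<integral>\<^sup>+g. J (- g) \<partial>?C) = (\<integral>\<^sup>+g. J g \<partial>?C)"
  proof (rule nn_integral_bij_count_space)
    show "bij_betw uminus int_lattice int_lattice"
      by (rule bij_betw_byWitness[where f' = uminus]) auto
  qed
  also have "ennreal (1 / 2) * (\<integral>\<^sup>+g. J g \<partial>?C) + ennreal (1 / 2) * (\<integral>\<^sup>+g. J g \<partial>?C) = (\<integral>\<^sup>+g. J g \<partial>?C)"
  proof -
    have "ennreal (1 / 2) + ennreal (1 / 2) = 1"
      by (subst ennreal_plus[symmetric]) simp_all
    then show ?thesis by (simp only: distrib_right[symmetric] mult_1_left)
  qed
  also have "\<dots> = (\<integral>\<^sup>+x. \<integral>\<^sup>+g. ennreal ((cmod (a x))\<^sup>2) * q g x \<partial>?C \<partial>lborel)"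
    unfolding J_def by (rule nn_integral_count_space_nn_integral[symmetric]) simp_all
  also have "\<dots> \<le> (\<integral>\<^sup>+x. ennreal ((cmod (a x))\<^sup>2) * ennreal (v x) \<partial>lborel)"
  proof (rule nn_integral_mono)
    fix x
    have "(\<integral>\<^sup>+g. ennreal ((cmod (a x))\<^sup>2) * q g x \<partial>?C) = ennreal ((cmod (a x))\<^sup>2) * (\<integral>\<^sup>+g. q g x \<partial>?C)"
      by (rule nn_integral_cmult) simp
    also have "\<dots> \<le> ennreal ((cmod (a x))\<^sup>2) * ennreal (v x)"
      unfolding q_def by (rule mult_left_mono[OF bound]) simp
    finally show "(\<integral>\<^sup>+g. ennreal ((cmod (a x))\<^sup>2) * q g x \<partial>?C) \<le> ennreal ((cmod (a x))\<^sup>2) * ennreal (v x)" .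
  qed
  finally show ?thesis .
qed

text \<open>\<open>T\<close> is the diagonal energy of one generation and \<open>E\<close> the Schur
  majorant of its interactions across the dual lattice. The factor |det P| stays with
  \<open>S\<close>, so that \<open>T\<close>, and later the covering sum, is free of the lattice.
  The bound \<open>W\<close> makes the off-diagonal term finite, as periodization requires.\<close>

theorem packet_sum_bounds:
  fixes A P :: "real^2^2"
  assumes A: "invertible A" and P: "invertible P"
    and f: "square_integrable f" "is_fourier_L2 f f'"
    and \<psi>: "square_integrable \<psi>" "is_fourier_L2 \<psi> \<psi>'"
    and \<psi>_bound: "\<And>\<eta>. cmod (\<psi>' \<eta>) \<le> b"
    and w [measurable]: "w \<in> borel_measurable borel" and w0: "\<And>\<eta>. 0 \<le> w \<eta>" and w_bound: "\<And>\<eta>. w \<eta> \<le> W"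
    and off: "\<And>\<eta>. (\<integral>\<^sup>+g. ennreal (cmod (\<psi>' \<eta>) * cmod (\<psi>' (\<eta> + dual_mat P *v g))) * indicator (- {0}) g
        \<partial>count_space int_lattice) \<le> ennreal (w \<eta>)"
  defines "S \<equiv> \<integral>\<^sup>+z. ennreal ((cmod (l2_inner f (\<lambda>x. of_real (sqrt \<bar>det A\<bar>) * \<psi> (A *v x - P *v z))))\<^sup>2)
      \<partial>count_space int_lattice"
    and "T \<equiv> \<integral>\<^sup>+\<xi>. ennreal ((cmod (f' \<xi>))\<^sup>2) * ennreal ((cmod (\<psi>' (dual_mat A *v \<xi>)))\<^sup>2) \<partial>lborel"
    and "E \<equiv> \<integral>\<^sup>+\<xi>. ennreal ((cmod (f' \<xi>))\<^sup>2) * ennreal (w (dual_mat A *v \<xi>)) \<partial>lborel"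
  shows "ennreal \<bar>det P\<bar> * S \<le> T + E" "T \<le> ennreal \<bar>det P\<bar> * S + E"
proof -
  let ?C = "count_space int_lattice" and ?dA = "\<bar>det A\<bar>" and ?dP = "\<bar>det P\<bar>"
  have dA: "?dA > 0" and dP: "?dP > 0" using A P by (simp_all add: invertible_det_nz)
  have f': "square_integrable f'" and \<psi>': "square_integrable \<psi>'"
    using f \<psi> is_fourier_L2_square_integrable by blast+
  have [measurable]: "f' \<in> borel_measurable borel" "\<psi>' \<in> borel_measurable borel"
    using f' \<psi>' by measurable
  \<comment> \<open>Under \<xi> = M x the window is evaluated at \<open>dual_mat P *v x\<close>
    whatever \<open>A\<close> is, the characters of the lattice become those of the integer lattice,
    and shifts by integer vectors become shifts by the dual lattice.\<close>
  define M where "M = transpose A ** dual_mat P"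
  have M: "invertible M"
    unfolding M_def using A P dual_mat(1)[OF P] by (simp add: invertible_det_nz det_mul)
  have dM: "\<bar>det M\<bar> = ?dA / ?dP"
    unfolding M_def using dual_mat(4)[OF P] by (simp add: det_mul abs_mult)
  have BM: "dual_mat A *v (M *v x) = dual_mat P *v x" for x
    unfolding M_def by (simp add: matrix_vector_mul_assoc matrix_mul_assoc dual_mat[OF A])
  define a where "a = (\<lambda>x. f' (M *v x))"
  define p where "p = (\<lambda>x. \<psi>' (dual_mat P *v x))"
  have [measurable]: "a \<in> borel_measurable borel" "p \<in> borel_measurable borel"
    unfolding a_def p_def by measurable
  have a: "square_integrable a" and p: "square_integrable p"
    unfolding a_def p_def by (intro l2_norm_linear M f' \<psi>' dual_mat P)+
  define F where "F = (\<lambda>x. a x * cnj (p x))"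
  have Fi: "integrable lborel F" unfolding F_def by (rule integrable_l2_product[OF a p])
  have F: "square_integrable F"
  proof (rule square_integrable_mono[OF a])
    show "F \<in> borel_measurable borel" unfolding F_def by measurable
    show "AE x in lborel. cmod (F x) \<le> b * cmod (a x)"
      unfolding F_def p_def
    proof (intro AE_I2)
      fix x
      have "cmod (\<psi>' (dual_mat P *v x)) * cmod (a x) \<le> b * cmod (a x)"
        by (intro mult_right_mono \<psi>_bound) simp
      then show "cmod (a x * cnj (\<psi>' (dual_mat P *v x))) \<le> b * cmod (a x)"
        by (simp add: norm_mult mult.commute)
    qed
  qed
  have off_F: "off_diagonal F \<le> (\<integral>\<^sup>+x. ennreal ((cmod (a x))\<^sup>2) * ennreal (w (dual_mat P *v x)) \<partial>lborel)"
    unfolding F_def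
  proof (rule off_diagonal_Schur)
    fix x
    show "(\<integral>\<^sup>+g. ennreal (cmod (p x) * cmod (p (x + g))) * indicator (- {0}) g \<partial>?C) \<le> ennreal (w (dual_mat P *v x))"
      using off[of "dual_mat P *v x"] by (simp add: p_def matrix_vector_right_distrib)
  qed measurable
  have fin: "off_diagonal F < \<infinity>"
  proof -
    note off_F
    also have "(\<integral>\<^sup>+x. ennreal ((cmod (a x))\<^sup>2) * ennreal (w (dual_mat P *v x)) \<partial>lborel) \<le>
        (\<integral>\<^sup>+x. ennreal ((cmod (a x))\<^sup>2) * ennreal W \<partial>lborel)"
      by (intro nn_integral_mono mult_left_mono ennreal_leI w_bound) simp
    also have "\<dots> = ennreal ((l2_norm a)\<^sup>2) * ennreal W"
      by (subst nn_integral_multc) (simp_all only: nn_integral_l2_norm[OF a], measurable)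
    also have "\<dots> < \<infinity>" by (simp add: ennreal_mult_less_top del: ennreal_power)
    finally show ?thesis .
  qed
  \<comment> \<open>\<open>K\<close> is the Jacobian of \<open>M\<close>, and \<open>c\<close> is
    the factor between squared frame coefficients and squared Fourier coefficients of
    \<open>F\<close>; their quotient is the lattice volume.\<close>
  define K where "K = ennreal (?dA / ?dP)"
  define c where "c = ennreal (?dA / ?dP\<^sup>2)"
  have cK: "ennreal ?dP * c = K"
  proof -
    have "x * (y / x\<^sup>2) = y / x" if "x > 0" for x y :: real
      using that by (simp add: power2_eq_square)
    from this[OF dP, of ?dA] show ?thesis
      unfolding c_def K_def using dA dP by (subst ennreal_mult[symmetric]) (simp_all only: zero_le_divide_iff zero_le_power2 abs_ge_zero simp_thms)
  qed
  have inner: "(cmod (l2_inner f (\<lambda>x. of_real (sqrt ?dA) * \<psi> (A *v x - P *v z))))\<^sup>2 =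
      ?dA / ?dP\<^sup>2 * (cmod (\<integral>x. F x * char_fun z x \<partial>lborel))\<^sup>2" for z
  proof -
    let ?g' = "\<lambda>\<xi>. of_real (1 / ?dA) * (\<psi>' (dual_mat A *v \<xi>) * char_fun (- (P *v z)) (dual_mat A *v \<xi>))"
    have G: "is_fourier_L2 (\<lambda>x. \<psi> (A *v x - P *v z)) ?g'"
      by (rule is_fourier_L2_affine[OF A \<psi>(2,1)])
    have "l2_inner f (\<lambda>x. \<psi> (A *v x - P *v z)) = l2_inner f' ?g'"
      by (rule Parseval_L2[OF f(2,1) G l2_norm_affine(1)[OF A \<psi>(1)]])
    also have "\<dots> = (\<integral>\<xi>. of_real (1 / ?dA) * (f' \<xi> * cnj (\<psi>' (dual_mat A *v \<xi>)) * char_fun (P *v z) (dual_mat A *v \<xi>)) \<partial>lborel)"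
      unfolding l2_inner_def char_fun_uminus
      by (intro Bochner_Integration.integral_cong refl) (simp add: algebra_simps)
    also have "\<dots> = of_real (1 / ?dA) * (\<integral>\<xi>. f' \<xi> * cnj (\<psi>' (dual_mat A *v \<xi>)) * char_fun (P *v z) (dual_mat A *v \<xi>) \<partial>lborel)"
      by (rule integral_mult_right_zero)
    also have "(\<integral>\<xi>. f' \<xi> * cnj (\<psi>' (dual_mat A *v \<xi>)) * char_fun (P *v z) (dual_mat A *v \<xi>) \<partial>lborel) =
        of_real (?dA / ?dP) * (\<integral>x. F x * char_fun z x \<partial>lborel)"
      unfolding dM[symmetric]
      by (subst integral_matrix[OF M]) (simp_all add: BM F_def a_def p_def char_fun_dual[OF P])
    finally have eq: "l2_inner f (\<lambda>x. \<psi> (A *v x - P *v z)) =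
        of_real (1 / ?dA * (?dA / ?dP)) * (\<integral>x. F x * char_fun z x \<partial>lborel)"
      by (simp only: mult.assoc of_real_mult)
    have "cmod (l2_inner f (\<lambda>x. of_real (sqrt ?dA) * \<psi> (A *v x - P *v z))) =
        sqrt ?dA * cmod (l2_inner f (\<lambda>x. \<psi> (A *v x - P *v z)))"
      by (subst (1 2) l2_inner_commute, subst l2_inner_cmult_left) (simp add: norm_mult)
    also have "\<dots> = sqrt ?dA / ?dP * cmod (\<integral>x. F x * char_fun z x \<partial>lborel)"
      unfolding eq norm_mult norm_of_real using dA dP by simp
    finally show ?thesis
      using dA by (simp add: power_mult_distrib power_divide)
  qed
  define Z where "Z = (\<integral>\<^sup>+z. ennreal ((cmod (\<integral>x. F x * char_fun z x \<partial>lborel))\<^sup>2) \<partial>?C)"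
  have S: "S = c * Z"
  proof -
    have "S = (\<integral>\<^sup>+z. c * ennreal ((cmod (\<integral>x. F x * char_fun z x \<partial>lborel))\<^sup>2) \<partial>?C)"
      unfolding S_def c_def inner by (intro nn_integral_cong ennreal_mult) auto
    then show ?thesis by (simp add: nn_integral_cmult Z_def)
  qed
  have T: "T = K * ennreal ((l2_norm F)\<^sup>2)"
  proof -
    have "T = K * (\<integral>\<^sup>+x. ennreal ((cmod (f' (M *v x)))\<^sup>2) * ennreal ((cmod (\<psi>' (dual_mat A *v (M *v x))))\<^sup>2) \<partial>lborel)"
      unfolding T_def K_def dM[symmetric] by (rule nn_integral_matrix[OF M]) measurable
    also have "(\<integral>\<^sup>+x. ennreal ((cmod (f' (M *v x)))\<^sup>2) * ennreal ((cmod (\<psi>' (dual_mat A *v (M *v x))))\<^sup>2) \<partial>lborel) =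
        (\<integral>\<^sup>+x. ennreal ((cmod (F x))\<^sup>2) \<partial>lborel)"
      by (intro nn_integral_cong) (simp add: BM F_def a_def p_def norm_mult power_mult_distrib ennreal_mult del: ennreal_power)
    finally show ?thesis by (simp only: nn_integral_l2_norm[OF F])
  qed
  have E: "E = K * (\<integral>\<^sup>+x. ennreal ((cmod (a x))\<^sup>2) * ennreal (w (dual_mat P *v x)) \<partial>lborel)"
  proof -
    have "E = K * (\<integral>\<^sup>+x. ennreal ((cmod (f' (M *v x)))\<^sup>2) * ennreal (w (dual_mat A *v (M *v x))) \<partial>lborel)"
      unfolding E_def K_def dM[symmetric] by (rule nn_integral_matrix[OF M]) measurable
    then show ?thesis by (simp only: BM a_def)
  qed
  have KE: "K * off_diagonal F \<le> E"
    unfolding E by (rule mult_left_mono[OF off_F]) simp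
  note per = periodization_bounds[OF Fi F fin, folded Z_def]
  have "ennreal ?dP * S = K * Z" unfolding S by (simp only: cK mult.assoc[symmetric])
  then have dS: "K * Z = ennreal ?dP * S" by simp
  have "K * Z \<le> K * (ennreal ((l2_norm F)\<^sup>2) + off_diagonal F)"
    by (rule mult_left_mono[OF per(1)]) simp
  also have "\<dots> = T + K * off_diagonal F"
    unfolding T by (rule distrib_left)
  also have "\<dots> \<le> T + E" by (rule add_left_mono[OF KE])
  finally show "ennreal ?dP * S \<le> T + E" unfolding dS .
  have "T \<le> K * (Z + off_diagonal F)"
    unfolding T by (rule mult_left_mono[OF per(2)]) simp
  also have "\<dots> = ennreal ?dP * S + K * off_diagonal F"
    unfolding dS[symmetric] by (rule distrib_left)
  also have "\<dots> \<le> ennreal ?dP * S + E" by (rule add_left_mono[OF KE])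
  finally show "T \<le> ennreal ?dP * S + E" .
qed


section \<open>Sums of the window majorant over scales and rotations\<close>

text \<open>The absolute value is injective on the nonnegative and on the negative integers
  separately, hence the factor 2. The convention inverse 0 = 0 removes the zero term on both
  sides.\<close>

lemma sum_inverse_squares_int_bound:
  fixes M :: "int set"
  assumes "finite M"
  shows "(\<Sum>m\<in>M. inverse ((real_of_int m)\<^sup>2)) \<le> 2 * (\<Sum>n. inverse ((real n)\<^sup>2))"
proof -
  let ?f = "\<lambda>m::int. inverse ((real_of_int m)\<^sup>2)"
  have half: "sum ?f N \<le> (\<Sum>n. inverse ((real n)\<^sup>2))" if N: "finite N" "inj_on (\<lambda>m. nat \<bar>m\<bar>) N" for N
  proof -
    have "sum ?f N = (\<Sum>n\<in>(\<lambda>m. nat \<bar>m\<bar>) ` N. inverse ((real n)\<^sup>2))"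
      unfolding sum.reindex[OF N(2)] by (intro sum.cong) auto
    also have "\<dots> \<le> (\<Sum>n. inverse ((real n)\<^sup>2))"
      using N by (intro sum_le_suminf inverse_power_summable) auto
    finally show ?thesis .
  qed
  have "sum ?f M = sum ?f (M \<inter> {0..}) + sum ?f (M \<inter> {..<0})"
    using assms by (subst sum.union_disjoint[symmetric]) (auto intro!: sum.cong)
  also have "\<dots> \<le> (\<Sum>n. inverse ((real n)\<^sup>2)) + (\<Sum>n. inverse ((real n)\<^sup>2))"
    using assms by (intro add_mono half) (auto simp: inj_on_def)
  finally show ?thesis by simp
qed

lemma exp_minus_le_inverse: "x > 0 \<Longrightarrow> exp (- x) \<le> inverse (x :: real)"
  unfolding exp_minus using exp_ge_add_one_self[of x] by (intro le_imp_inverse_le) linarith+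

text \<open>Only m = 0 and m = -1 can bring f + m close to 0, and each contributes at most 1. For
  all other m the distance |f + m| is at least |m|/2, where exp(-x) <= 1/x leaves a sum of inverse
  squares.\<close>

lemma sum_Gauss_shifted_int_bound:
  fixes M :: "int set" and f \<nu> :: real
  assumes M: "finite M" and f: "0 \<le> f" "f < 1" and \<nu>: "\<nu> > 0"
  shows "(\<Sum>m\<in>M. exp (- (\<nu> * (f + m)\<^sup>2))) \<le> 2 + 8 / \<nu> * (\<Sum>n. inverse ((real n)\<^sup>2))"
proof -
  have bound: "exp (- (\<nu> * (f + m)\<^sup>2)) \<le> indicator {-1, 0} m + 4 / \<nu> * inverse ((real_of_int m)\<^sup>2)" for m
  proof (cases "m \<in> {-1, 0}")
    case True
    have "0 \<le> \<nu> * (f + m)\<^sup>2" using \<nu> by simp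
    then have "exp (- (\<nu> * (f + m)\<^sup>2)) \<le> 1" by simp
    moreover have "0 \<le> 4 / \<nu> * inverse ((real_of_int m)\<^sup>2)" using \<nu> by simp
    ultimately show ?thesis using True by (simp only: indicator_simps)
  next
    case False
    then have m: "m \<ge> 1 \<or> m \<le> -2" by auto
    then have "\<bar>real_of_int m\<bar> / 2 \<le> \<bar>f + m\<bar>" using f by auto
    then have "(\<bar>real_of_int m\<bar> / 2)\<^sup>2 \<le> \<bar>f + m\<bar>\<^sup>2" by (rule power_mono) simp
    then have "\<nu> * ((real_of_int m)\<^sup>2 / 4) \<le> \<nu> * (f + m)\<^sup>2"
      using \<nu> by (simp add: power_divide)
    then have "exp (- (\<nu> * (f + m)\<^sup>2)) \<le> exp (- (\<nu> * ((real_of_int m)\<^sup>2 / 4)))" by simp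
    also have "\<dots> \<le> inverse (\<nu> * ((real_of_int m)\<^sup>2 / 4))"
      using \<nu> m by (intro exp_minus_le_inverse) auto
    also have "\<dots> = 4 / \<nu> * inverse ((real_of_int m)\<^sup>2)"
      by (simp add: field_simps)
    finally show ?thesis using False by simp
  qed
  have "(\<Sum>m\<in>M. exp (- (\<nu> * (f + m)\<^sup>2))) \<le> (\<Sum>m\<in>M. indicator {-1, 0} m + 4 / \<nu> * inverse ((real_of_int m)\<^sup>2))"
    by (intro sum_mono bound)
  also have "\<dots> = (\<Sum>m\<in>M. indicator {-1, 0} m) + 4 / \<nu> * (\<Sum>m\<in>M. inverse ((real_of_int m)\<^sup>2))"
    by (simp add: sum.distrib sum_distrib_left)
  also have "(\<Sum>m\<in>M. indicator {-1, 0} m) = (\<Sum>m\<in>M. if m \<in> {-1, 0} then 1 else 0 :: real)"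
    by (intro sum.cong) (auto simp: indicator_def)
  also have "\<dots> = (\<Sum>m\<in>M \<inter> {-1, 0}. 1)"
    by (rule sum.inter_restrict[OF M, symmetric])
  also have "\<dots> = real (card (M \<inter> {-1, 0}))" by simp
  also have "\<dots> \<le> 2"
    using card_mono[of "{-1, 0 :: int}" "M \<inter> {-1, 0}"] by simp
  also have "4 / \<nu> * (\<Sum>m\<in>M. inverse ((real_of_int m)\<^sup>2)) \<le> 4 / \<nu> * (2 * (\<Sum>n. inverse ((real n)\<^sup>2)))"
    using \<nu> by (intro mult_left_mono sum_inverse_squares_int_bound M) auto
  finally show ?thesis by simp
qed

text \<open>Jordan's inequality: by concavity, sine lies above its chord from 0 to pi/2.\<close>

lemma abs_sin_ge:
  fixes x :: real
  assumes "\<bar>x\<bar> \<le> pi / 2"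
  shows "2 / pi * \<bar>x\<bar> \<le> \<bar>sin x\<bar>"
proof -
  have pos: "2 / pi * y \<le> sin y" if y: "0 \<le> y" "y \<le> pi / 2" for y
  proof -
    have "concave_on {0..pi} sin"
      unfolding concave_on_def
    proof (rule f''_ge0_imp_convex)
      show "convex {0..pi}" by simp
      show "((\<lambda>x. - sin x) has_real_derivative - cos x) (at x)" for x :: real
        by (auto intro!: derivative_eq_intros)
      show "((\<lambda>x. - cos x) has_real_derivative sin x) (at x)" for x :: real
        by (auto intro!: derivative_eq_intros)
      show "0 \<le> sin x" if "x \<in> {0..pi}" for x using that by (simp add: sin_ge_zero)
    qed
    from concave_onD[OF this, of "2 / pi * y" 0 "pi / 2"] y
    show ?thesis by (simp add: field_simps)
  qed
  show ?thesis
  proof (cases "0 \<le> x")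
    case True
    then show ?thesis using pos[of x] assms by simp
  next
    case False
    then show ?thesis using pos[of "- x"] assms by simp
  qed
qed

text \<open>
  The angles \<open>\<alpha> + k \<pi> / n\<close> are moved into \<open>[-\<pi>/2, \<pi>/2]\<close> by multiples of \<open>\<pi>\<close>; this is at most
  two-to-one, and there \<open>n \<bar>sin\<bar>\<close> is at least twice the distance of an integer from a fixed number.
\<close>

lemma sum_Gauss_sin_bound:
  fixes n :: nat and \<alpha> \<mu> t :: real
  assumes n: "n > 0" and \<mu>: "\<mu> > 0" and t: "t > 0"
  shows "(\<Sum>k<2 * n. exp (- (\<mu> * (2 * real n * t * sin (\<alpha> + pi * k / n))\<^sup>2)))
    \<le> 4 + (\<Sum>i. inverse ((real i)\<^sup>2)) / (\<mu> * t\<^sup>2)"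
proof -
  \<comment> \<open>Measured in units of pi/n the angles are y + k. Removing \<open>n * q k\<close>
    leaves f + m k with \<open>m k\<close> an integer and \<open>f\<close> the fractional part of
    \<open>y\<close>.\<close>
  define y where "y = real n * \<alpha> / pi"
  define q where "q = (\<lambda>k::nat. round ((y + k) / n))"
  define m where "m = (\<lambda>k::nat. \<lfloor>y\<rfloor> + int k - int n * q k)"
  define f where "f = frac y"
  have f: "0 \<le> f" "f < 1" by (simp_all add: f_def frac_lt_1)
  \<comment> \<open>Jordan's inequality gives 2 n t |sin| >= 4 t |f + m k|; the 16 comes from
    squaring.\<close>
  define \<nu> where "\<nu> = 16 * \<mu> * t\<^sup>2"
  have \<nu>: "\<nu> > 0" using \<mu> t by (simp add: \<nu>_def)
  have termwise: "exp (- (\<mu> * (2 * real n * t * sin (\<alpha> + pi * k / n))\<^sup>2)) \<le> exp (- (\<nu> * (f + m k)\<^sup>2))" for k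
  proof -
    define u where "u = f + m k"
    have u: "u = y + k - n * q k"
      by (simp add: u_def f_def m_def frac_def)
    have "\<bar>(y + k) / n - q k\<bar> \<le> 1 / 2"
      using of_int_round_abs_le[of "(y + k) / n"] by (simp add: q_def abs_minus_commute)
    moreover have "(y + k) / n - q k = u / n"
      using n by (simp add: u field_simps)
    ultimately have "\<bar>u / n\<bar> \<le> 1 / 2" by simp
    then have un: "\<bar>pi * (u / n)\<bar> \<le> pi / 2"
      using mult_left_mono[of "\<bar>u / n\<bar>" "1 / 2" pi] by (simp add: abs_mult)
    have "\<alpha> + pi * k / n = pi * (u / n) + of_int (q k) * pi"
      using n by (simp add: u y_def field_simps)
    moreover have s0: "sin (of_int (q k) * pi) = 0" by (simp add: sin_times_pi_eq_0)
    moreover have "\<bar>cos (of_int (q k) * pi)\<bar> = 1" by (rule sin_zero_abs_cos_one[OF s0])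
    ultimately have "\<bar>sin (\<alpha> + pi * k / n)\<bar> = \<bar>sin (pi * (u / n))\<bar>"
      by (simp only: sin_add abs_mult mult_zero_right add_0_right mult_1_right)
    then have "2 * \<bar>u\<bar> / n \<le> \<bar>sin (\<alpha> + pi * k / n)\<bar>"
      using abs_sin_ge[OF un] n by (simp add: abs_mult)
    then have "(2 * real n * t) * (2 * \<bar>u\<bar> / n) \<le> (2 * real n * t) * \<bar>sin (\<alpha> + pi * k / n)\<bar>"
      using t by (intro mult_left_mono) auto
    then have "4 * t * \<bar>u\<bar> \<le> 2 * real n * t * \<bar>sin (\<alpha> + pi * k / n)\<bar>"
      using n by simp
    then have "(4 * t * \<bar>u\<bar>)\<^sup>2 \<le> (2 * real n * t * \<bar>sin (\<alpha> + pi * k / n)\<bar>)\<^sup>2"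
      using t by (intro power_mono) auto
    then have "16 * t\<^sup>2 * u\<^sup>2 \<le> (2 * real n * t * sin (\<alpha> + pi * k / n))\<^sup>2"
      by (simp add: power_mult_distrib)
    then have "\<mu> * (16 * t\<^sup>2 * u\<^sup>2) \<le> \<mu> * (2 * real n * t * sin (\<alpha> + pi * k / n))\<^sup>2"
      using \<mu> by (intro mult_left_mono) auto
    then show ?thesis by (simp add: \<nu>_def u_def ac_simps)
  qed
  \<comment> \<open>Equal values of \<open>m\<close> force congruent indices modulo
    \<open>n\<close>, so \<open>m\<close> is injective on a block of \<open>n\<close> consecutive
    indices; two blocks exhaust the sum.\<close>
  have part: "(\<Sum>k\<in>{l..<l + n}. exp (- (\<nu> * (f + m k)\<^sup>2))) \<le> 2 + 8 / \<nu> * (\<Sum>i. inverse ((real i)\<^sup>2))" for l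
  proof -
    have inj: "inj_on m {l..<l + n}"
    proof (rule inj_onI)
      fix i j assume ij: "i \<in> {l..<l + n}" "j \<in> {l..<l + n}" "m i = m j"
      then have "int i - int j = int n * (q i - q j)"
        by (simp add: m_def algebra_simps)
      then have "int n dvd (int i - int j)" by simp
      moreover have "\<bar>int i - int j\<bar> < int n" using ij by auto
      ultimately have "int i - int j = 0"
        using dvd_imp_le_int[of "int i - int j" "int n"] by fastforce
      then show "i = j" by simp
    qed
    have "(\<Sum>k\<in>{l..<l + n}. exp (- (\<nu> * (f + m k)\<^sup>2))) = (\<Sum>i\<in>m ` {l..<l + n}. exp (- (\<nu> * (f + i)\<^sup>2)))"
      by (simp add: sum.reindex[OF inj])
    also have "\<dots> \<le> 2 + 8 / \<nu> * (\<Sum>i. inverse ((real i)\<^sup>2))"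
      by (rule sum_Gauss_shifted_int_bound) (use f \<nu> in auto)
    finally show ?thesis .
  qed
  have "(\<Sum>k<2 * n. exp (- (\<mu> * (2 * real n * t * sin (\<alpha> + pi * k / n))\<^sup>2))) \<le> (\<Sum>k<2 * n. exp (- (\<nu> * (f + m k)\<^sup>2)))"
    by (intro sum_mono termwise)
  also have "\<dots> = (\<Sum>k\<in>{0..<0 + n}. exp (- (\<nu> * (f + m k)\<^sup>2))) + (\<Sum>k\<in>{n..<n + n}. exp (- (\<nu> * (f + m k)\<^sup>2)))"
    using sum.atLeastLessThan_concat[of 0 n "2 * n" "\<lambda>k. exp (- (\<nu> * (f + m k)\<^sup>2))"]
    by (simp add: lessThan_atLeast0 mult_2)
  also have "\<dots> \<le> (2 + 8 / \<nu> * (\<Sum>i. inverse ((real i)\<^sup>2))) + (2 + 8 / \<nu> * (\<Sum>i. inverse ((real i)\<^sup>2)))"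
    by (intro add_mono part)
  also have "\<dots> = 4 + (\<Sum>i. inverse ((real i)\<^sup>2)) / (\<mu> * t\<^sup>2)"
    by (simp add: \<nu>_def field_simps)
  finally show ?thesis .
qed

text \<open>The terms decay geometrically on both sides of the index at which \<rho> q^j crosses 1,
  so moving that index by changing \<rho> does not affect the bound.\<close>

lemma sum_min_geometric_bound:
  fixes \<rho> q :: real
  assumes q: "0 < q" "q < 1" and "\<rho> > 0"
  shows "(\<Sum>j<J. min (\<rho> * q ^ j) (1 / (\<rho> * q ^ j))) \<le> 2 / (1 - q)"
proof -
  have small: "(\<Sum>j<J. min (\<rho> * q ^ j) (1 / (\<rho> * q ^ j))) \<le> 1 / (1 - q)" if "0 < \<rho>" "\<rho> \<le> 1" for \<rho> J
  proof -
    have "(\<Sum>j<J. min (\<rho> * q ^ j) (1 / (\<rho> * q ^ j))) \<le> (\<Sum>j<J. q ^ j)"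
    proof (rule sum_mono)
      fix j
      have "\<rho> * q ^ j \<le> 1 * q ^ j" using that q by (intro mult_right_mono) auto
      then show "min (\<rho> * q ^ j) (1 / (\<rho> * q ^ j)) \<le> q ^ j" by simp
    qed
    also have "\<dots> \<le> (\<Sum>j. q ^ j)"
      using q by (intro sum_le_suminf summable_geometric) auto
    also have "\<dots> = 1 / (1 - q)" using q by (intro suminf_geometric) auto
    finally show ?thesis .
  qed
  \<comment> \<open>The subtracted term strengthens the induction hypothesis: passing from \<rho> q
    to \<rho>, it absorbs exactly the new summand 1/\<rho>.\<close>
  have large: "(\<Sum>j<J. min (\<rho> * q ^ j) (1 / (\<rho> * q ^ j))) \<le> 2 / (1 - q) - q / (1 - q) / \<rho>" if "1 < \<rho>" for \<rho> J
    using that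
  proof (induction J arbitrary: \<rho>)
    case 0
    have "q / (1 - q) / \<rho> \<le> q / (1 - q) / 1"
      using 0 q by (intro divide_left_mono) auto
    also have "\<dots> \<le> 2 / (1 - q)" using q by (simp add: divide_right_mono)
    finally show ?case by simp
  next
    case (Suc J)
    have "(\<Sum>j<Suc J. min (\<rho> * q ^ j) (1 / (\<rho> * q ^ j))) =
        min \<rho> (1 / \<rho>) + (\<Sum>j<J. min ((\<rho> * q) * q ^ j) (1 / ((\<rho> * q) * q ^ j)))"
      unfolding sum.lessThan_Suc_shift by (simp add: mult.assoc)
    also have "min \<rho> (1 / \<rho>) \<le> 1 / \<rho>" by simp
    also have "1 / \<rho> + (\<Sum>j<J. min ((\<rho> * q) * q ^ j) (1 / ((\<rho> * q) * q ^ j))) \<le> 2 / (1 - q) - q / (1 - q) / \<rho>"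
    proof (cases "1 < \<rho> * q")
      case True
      have e1: "q / (1 - q) / (\<rho> * q) = 1 / (1 - q) / \<rho>" using q by simp
      have e2: "1 / (1 - q) = 1 + q / (1 - q)" using q by (simp add: field_simps)
      have "1 / \<rho> + (2 / (1 - q) - q / (1 - q) / (\<rho> * q)) = 2 / (1 - q) - q / (1 - q) / \<rho>"
        unfolding e1 e2 by (simp add: add_divide_distrib)
      then show ?thesis using Suc.IH[OF True] by linarith
    next
      case False
      have "(1 + q / (1 - q)) / \<rho> \<le> (1 + q / (1 - q)) / 1"
        using Suc.prems q by (intro divide_left_mono) auto
      also have "\<dots> = 1 / (1 - q)" using q by (simp add: field_simps)
      finally have "1 / \<rho> + 1 / (1 - q) \<le> 2 / (1 - q) - q / (1 - q) / \<rho>"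
        by (simp add: add_divide_distrib)
      then show ?thesis using small[of "\<rho> * q" J] False Suc.prems q by simp
    qed
    finally show ?case by simp
  qed
  show ?thesis
  proof (cases "\<rho> \<le> 1")
    case True
    have "1 / (1 - q) \<le> 2 / (1 - q)" using q by (simp add: divide_right_mono)
    then show ?thesis using small[OF \<open>\<rho> > 0\<close> True, of J] by linarith
  next
    case False
    have "0 \<le> q / (1 - q) / \<rho>" using q \<open>\<rho> > 0\<close> by simp
    then show ?thesis using large[of \<rho> J] False by linarith
  qed
qed

section \<open>The dilated and rotated frequencies and the window majorant\<close>

lemma A_mat_entries:
  fixes j k :: nat
  defines "\<theta> \<equiv> 2 * real k * pi / 2 ^ j"
  shows "A_mat j k $ 1 $ 1 = 4 ^ j * cos \<theta>" "A_mat j k $ 1 $ 2 = - (4 ^ j * sin \<theta>)"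
    "A_mat j k $ 2 $ 1 = 2 ^ j * sin \<theta>" "A_mat j k $ 2 $ 2 = 2 ^ j * cos \<theta>"
  by (simp_all add: A_mat_def dil_mat_def rot_mat_def matrix_matrix_mult_def sum_2 \<theta>_def)

lemma det_A_mat: "det (A_mat j k) = 8 ^ j"
proof -
  have "det (A_mat j k) = 4 ^ j * 2 ^ j * ((cos (2 * real k * pi / 2 ^ j))\<^sup>2 + (sin (2 * real k * pi / 2 ^ j))\<^sup>2)"
    unfolding det_2 A_mat_entries power2_eq_square by algebra
  then show ?thesis by (simp flip: power_mult_distrib)
qed

lemma invertible_A_mat: "invertible (A_mat j k)"
  by (simp add: invertible_det_nz det_A_mat)

lemma B_mat_components:
  fixes j k :: nat
  defines "\<theta> \<equiv> 2 * real k * pi / 2 ^ j"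
  shows "(B_mat j k *v x) $ 1 = (cos \<theta> * x $ 1 - sin \<theta> * x $ 2) / 4 ^ j"
    "(B_mat j k *v x) $ 2 = (sin \<theta> * x $ 1 + cos \<theta> * x $ 2) / 2 ^ j"
proof -
  define N :: "real^2^2" where "N = vector [vector [cos \<theta> / 4 ^ j, - sin \<theta> / 4 ^ j], vector [sin \<theta> / 2 ^ j, cos \<theta> / 2 ^ j]]"
  have cs: "cos \<theta> * cos \<theta> + sin \<theta> * sin \<theta> = 1" "sin \<theta> * sin \<theta> + cos \<theta> * cos \<theta> = 1"
    using sin_cos_squared_add3[of \<theta>] by (simp_all add: add.commute)
  have "transpose (A_mat j k) ** N = mat 1"
    by (simp add: vec_eq_iff forall_2 matrix_matrix_mult_def sum_2 transpose_def mat_def N_def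
        A_mat_entries \<theta>_def[symmetric] cs)
  then have "B_mat j k ** (transpose (A_mat j k) ** N) = B_mat j k" by simp
  then have "B_mat j k = N"
    using dual_mat(3)[OF invertible_A_mat[of j k]]
    by (simp add: matrix_mul_assoc B_mat_def dual_mat_def)
  then show "(B_mat j k *v x) $ 1 = (cos \<theta> * x $ 1 - sin \<theta> * x $ 2) / 4 ^ j"
    "(B_mat j k *v x) $ 2 = (sin \<theta> * x $ 1 + cos \<theta> * x $ 2) / 2 ^ j"
    by (simp_all add: N_def matrix_vector_mult_def sum_2 diff_divide_distrib add_divide_distrib)
qed

text \<open>The part of a window bound left over by the off-diagonal estimate: half of the exponent
  \<delta> and a single factor min 1 (|x_1|^\<sigma>), taken at one of the two interacting points.
  Up to a constant it also dominates the squared window.\<close>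

definition window_majorant :: "real \<Rightarrow> real \<Rightarrow> real^2 \<Rightarrow> real" where
  "window_majorant \<sigma> \<delta> x = min 1 (\<bar>x $ 1\<bar> powr \<sigma>) * exp (- (\<delta> / 2 * (norm x)\<^sup>2))"

lemma window_majorant_nonneg [simp]: "0 \<le> window_majorant \<sigma> \<delta> x"
  by (simp add: window_majorant_def)

lemma norm_vec2_power2: "(norm (x :: real^2))\<^sup>2 = (x $ 1)\<^sup>2 + (x $ 2)\<^sup>2"
  unfolding power2_norm_eq_inner by (simp add: inner_vec_def sum_2 power2_eq_square)

text \<open>In polar coordinates \<open>B_mat j k *v x\<close> is (t cos s, 2^j t sin s) with
  equally spaced angles s, and the sum over the angles costs a multiple of 1 + 1/t^2. For t <= 1 the
  factor t^\<sigma> leaves t^(\<sigma>-2); for t > 1 a further Gaussian factor in t leaves 1/t^2.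
  The exponent \<open>p\<close> is the smaller of these two rates.\<close>

lemma window_majorant_scale_sum:
  fixes x :: "real^2"
  assumes \<delta>: "\<delta> > 0" and \<sigma>: "\<sigma> > 2" and j: "j \<ge> 1"
    and x: "x $ 1 = r * cos \<alpha>" "x $ 2 = r * sin \<alpha>" "r > 0"
  defines "t \<equiv> r / 4 ^ j" and "Z \<equiv> 4 + 4 / \<delta> * (\<Sum>i. inverse ((real i)\<^sup>2))" and "p \<equiv> min (\<sigma> - 2) 2"
  shows "(\<Sum>k = 0..2 ^ j - 1. window_majorant \<sigma> \<delta> (B_mat j k *v x))
     \<le> Z * max 1 (4 / \<delta>) * min (t powr p) (1 / (t powr p))"
proof -
  have t: "t > 0" using x by (simp add: t_def)
  \<comment> \<open>As j >= 1, the angles 2 pi k / 2^j are multiples of pi/n and the range of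
    \<open>k\<close> has 2n elements, the form of \<open>sum_Gauss_sin_bound\<close>.\<close>
  define n :: nat where "n = 2 ^ (j - 1)"
  have n: "n > 0" "2 * n = 2 ^ j" using j by (simp_all add: n_def flip: power_Suc)
  have n': "2 * real n = 2 ^ j" using n(2) by (metis of_nat_mult of_nat_numeral of_nat_power)
  define s where "s = (\<lambda>k::nat. \<alpha> + pi * k / n)"
  have \<theta>: "2 * real k * pi / 2 ^ j = pi * k / n" for k
    unfolding n'[symmetric] by simp
  have two4: "(2::real) ^ j * 2 ^ j = 4 ^ j" by (simp flip: power_mult_distrib)
  have comp: "(B_mat j k *v x) $ 1 = t * cos (s k)" "(B_mat j k *v x) $ 2 = 2 * real n * t * sin (s k)" for k
  proof -
    have r2: "r / 2 ^ j = 2 * real n * t" by (simp add: n' t_def two4[symmetric])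
    have "(B_mat j k *v x) $ 1 = r / 4 ^ j * (cos \<alpha> * cos (pi * k / n) - sin \<alpha> * sin (pi * k / n))"
      unfolding B_mat_components \<theta> x by (simp add: field_simps)
    then show "(B_mat j k *v x) $ 1 = t * cos (s k)" by (simp only: t_def s_def cos_add)
    have "(B_mat j k *v x) $ 2 = r / 2 ^ j * (sin \<alpha> * cos (pi * k / n) + cos \<alpha> * sin (pi * k / n))"
      unfolding B_mat_components \<theta> x by (simp add: field_simps)
    then show "(B_mat j k *v x) $ 2 = 2 * real n * t * sin (s k)" by (simp only: r2 s_def sin_add)
  qed
  have "1 \<le> 2 * real n" using n by simp
  \<comment> \<open>The exponent \<delta>/2 is divided: \<delta>/4 goes to t^2 for decay in scale,
    \<delta>/4 to the second coordinate for the sum over angles. This is possible because 2n >= 1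
    gives t^2 + d^2 <= 2 (c^2 + d^2) for the two coordinates c, d.\<close>
  have termwise: "window_majorant \<sigma> \<delta> (B_mat j k *v x) \<le>
      min 1 (t powr \<sigma>) * exp (- (\<delta> / 4 * t\<^sup>2)) * exp (- (\<delta> / 4 * (2 * real n * t * sin (s k))\<^sup>2))" for k
  proof -
    let ?c = "t * cos (s k)" and ?d = "2 * real n * t * sin (s k)"
    have "\<bar>?c\<bar> \<le> t" using t by (simp add: abs_mult mult_left_le)
    then have 1: "\<bar>?c\<bar> powr \<sigma> \<le> t powr \<sigma>" using \<sigma> by (intro powr_mono2) auto
    have "(t * sin (s k))\<^sup>2 \<le> (2 * real n)\<^sup>2 * (t * sin (s k))\<^sup>2"
      using mult_right_mono[of 1 "(2 * real n)\<^sup>2" "(t * sin (s k))\<^sup>2"] \<open>1 \<le> 2 * real n\<close>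
      by (simp only: one_le_power mult_1_left zero_le_power2)
    then have "(t * sin (s k))\<^sup>2 \<le> ?d\<^sup>2" by (simp add: power_mult_distrib mult.assoc)
    moreover have "?c\<^sup>2 + (t * sin (s k))\<^sup>2 = t\<^sup>2"
      by (simp add: power_mult_distrib distrib_left[symmetric])
    moreover have "0 \<le> ?c\<^sup>2" by simp
    moreover have "T + v \<le> 2 * (c + v)" if "w \<le> v" "c + w = T" "0 \<le> c" for T v w c :: real
      using that by simp
    ultimately have "t\<^sup>2 + ?d\<^sup>2 \<le> 2 * (?c\<^sup>2 + ?d\<^sup>2)" by blast
    then have "\<delta> / 4 * (t\<^sup>2 + ?d\<^sup>2) \<le> \<delta> / 4 * (2 * (?c\<^sup>2 + ?d\<^sup>2))"
      using \<delta> by (intro mult_left_mono) auto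
    then have "- (\<delta> / 2 * (?c\<^sup>2 + ?d\<^sup>2)) \<le> - (\<delta> / 4 * t\<^sup>2) + - (\<delta> / 4 * ?d\<^sup>2)"
      by (simp add: algebra_simps)
    then have 2: "exp (- (\<delta> / 2 * (?c\<^sup>2 + ?d\<^sup>2))) \<le> exp (- (\<delta> / 4 * t\<^sup>2)) * exp (- (\<delta> / 4 * ?d\<^sup>2))"
      unfolding exp_add[symmetric] by simp
    show ?thesis
      unfolding window_majorant_def norm_vec2_power2 comp mult.assoc
      using 1 2 by (intro mult_mono) (auto simp: mult.assoc)
  qed
  have "(\<Sum>k = 0..2 ^ j - 1. window_majorant \<sigma> \<delta> (B_mat j k *v x)) =
      (\<Sum>k<2 * n. window_majorant \<sigma> \<delta> (B_mat j k *v x))"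
    unfolding n(2) by (intro sum.cong) (auto simp: Suc_diff_1 less_Suc_eq_le[symmetric])
  also have "\<dots> \<le> (\<Sum>k<2 * n. min 1 (t powr \<sigma>) * exp (- (\<delta> / 4 * t\<^sup>2)) *
      exp (- (\<delta> / 4 * (2 * real n * t * sin (s k))\<^sup>2)))"
    by (intro sum_mono termwise)
  also have "\<dots> = min 1 (t powr \<sigma>) * exp (- (\<delta> / 4 * t\<^sup>2)) *
      (\<Sum>k<2 * n. exp (- (\<delta> / 4 * (2 * real n * t * sin (\<alpha> + pi * k / n))\<^sup>2)))"
    by (simp add: sum_distrib_left s_def)
  also have "\<dots> \<le> min 1 (t powr \<sigma>) * exp (- (\<delta> / 4 * t\<^sup>2)) *
      (4 + (\<Sum>i. inverse ((real i)\<^sup>2)) / (\<delta> / 4 * t\<^sup>2))"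
    using n t \<delta> by (intro mult_left_mono sum_Gauss_sin_bound) auto
  also have "\<dots> \<le> Z * max 1 (4 / \<delta>) * min (t powr p) (1 / (t powr p))"
  proof -
    have I: "0 \<le> (\<Sum>i. inverse ((real i)\<^sup>2))"
      by (intro suminf_nonneg inverse_power_summable) auto
    have Z: "Z > 0" using I \<delta> by (simp add: Z_def add_pos_nonneg)
    have p: "0 < p" "p \<le> \<sigma> - 2" "p \<le> 2" using \<sigma> by (auto simp: p_def)
    have Zt: "4 + (\<Sum>i. inverse ((real i)\<^sup>2)) / (\<delta> / 4 * t\<^sup>2) = 4 + 4 / \<delta> * (\<Sum>i. inverse ((real i)\<^sup>2)) / t\<^sup>2"
      using \<delta> t by (simp add: field_simps)
    show ?thesis
    proof (cases "t \<le> 1")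
      case True
      have "t\<^sup>2 \<le> 1" using True t by (simp add: power_le_one)
      then have "4 \<le> 4 / t\<^sup>2" using t by (simp add: field_simps)
      then have "4 + (\<Sum>i. inverse ((real i)\<^sup>2)) / (\<delta> / 4 * t\<^sup>2) \<le> Z / t\<^sup>2"
        unfolding Zt Z_def add_divide_distrib by simp
      moreover have "min 1 (t powr \<sigma>) * exp (- (\<delta> / 4 * t\<^sup>2)) \<le> t powr \<sigma> * 1"
        using \<delta> by (intro mult_mono) auto
      ultimately have "min 1 (t powr \<sigma>) * exp (- (\<delta> / 4 * t\<^sup>2)) * (4 + (\<Sum>i. inverse ((real i)\<^sup>2)) / (\<delta> / 4 * t\<^sup>2))
          \<le> t powr \<sigma> * 1 * (Z / t\<^sup>2)"
        using I \<delta> t by (intro mult_mono) auto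
      also have "\<dots> = Z * t powr (\<sigma> - 2)"
        using t by (simp add: powr_diff powr_numeral)
      also have "\<dots> \<le> Z * t powr p"
        using Z p True t by (intro mult_left_mono powr_mono') auto
      also have "t powr p = min (t powr p) (1 / (t powr p))"
      proof -
        have "t powr p \<le> 1" using True t p by (intro powr_le1) auto
        moreover have "0 < t powr p" using t by simp
        ultimately have "t powr p \<le> 1 / t powr p"
          by (simp add: pos_le_divide_eq mult_le_one)
        then show ?thesis by simp
      qed
      also have "Z * \<dots> \<le> Z * max 1 (4 / \<delta>) * min (t powr p) (1 / (t powr p))"
        using Z t by (intro mult_right_mono) auto
      finally show ?thesis .
    next
      case False
      then have t1: "1 \<le> t" by simp
      have t2: "1 \<le> t\<^sup>2" using t1 by (simp add: one_le_power)
      have "4 / \<delta> * (\<Sum>i. inverse ((real i)\<^sup>2)) / t\<^sup>2 \<le> 4 / \<delta> * (\<Sum>i. inverse ((real i)\<^sup>2)) / 1"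
        using t2 I \<delta> by (intro divide_left_mono) auto
      then have le_Z: "4 + (\<Sum>i. inverse ((real i)\<^sup>2)) / (\<delta> / 4 * t\<^sup>2) \<le> Z"
        unfolding Zt Z_def by simp
      have "min 1 (t powr \<sigma>) * exp (- (\<delta> / 4 * t\<^sup>2)) \<le> 1 * inverse (\<delta> / 4 * t\<^sup>2)"
        using \<delta> t by (intro mult_mono exp_minus_le_inverse) auto
      then have "min 1 (t powr \<sigma>) * exp (- (\<delta> / 4 * t\<^sup>2)) * (4 + (\<Sum>i. inverse ((real i)\<^sup>2)) / (\<delta> / 4 * t\<^sup>2))
          \<le> 1 * inverse (\<delta> / 4 * t\<^sup>2) * Z"
        by (rule mult_mono[OF _ le_Z]) (use I \<delta> t in simp_all)
      also have "\<dots> = Z * (4 / \<delta>) * (1 / t powr 2)"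
        using t \<delta> by (simp add: powr_numeral field_simps)
      also have "\<dots> \<le> Z * max 1 (4 / \<delta>) * (1 / t powr p)"
        using Z \<delta> t1 p by (intro mult_mono divide_left_mono powr_mono) auto
      also have "1 / t powr p = min (t powr p) (1 / (t powr p))"
      proof -
        have "1 \<le> t powr p" using t1 p by (intro ge_one_powr_ge_zero) auto
        then have "1 / t powr p \<le> 1" by (simp add: divide_le_eq_1)
        then show ?thesis using \<open>1 \<le> t powr p\<close> by simp
      qed
      finally show ?thesis .
    qed
  qed
  finally show ?thesis .
qed

text \<open>The quantities (r/4^j)^p form a geometric progression in j with ratio 4^(-p), so the sum
  over scales is bounded independently of r. At the origin every term vanishes because 0 powr
  \<sigma> = 0.\<close>

theorem window_majorant_sum_bounded:
  assumes \<delta>: "\<delta> > 0" and \<sigma>: "\<sigma> > 2"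
  obtains K where "K > 0"
    "\<And>x J. (\<Sum>j = 1..J. \<Sum>k = 0..2 ^ j - 1. window_majorant \<sigma> \<delta> (B_mat j k *v x)) \<le> K"
proof -
  define Z where "Z = (4 + 4 / \<delta> * (\<Sum>i. inverse ((real i)\<^sup>2))) * max 1 (4 / \<delta>)"
  have "0 \<le> (\<Sum>i. inverse ((real i)\<^sup>2))"
    by (intro suminf_nonneg inverse_power_summable) auto
  then have Z: "Z > 0" using \<delta> by (simp add: Z_def add_pos_nonneg)
  define p where "p = min (\<sigma> - 2) 2"
  have p: "p > 0" using \<sigma> by (simp add: p_def)
  define q :: real where "q = 4 powr (- p)"
  have q: "0 < q" "q < 1" using p powr_less_mono[of "- p" 0 4] by (auto simp: q_def)
  show thesis
  proof (rule that)
    show "0 < Z * (2 / (1 - q))" using Z q by simp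
    fix x :: "real^2" and J :: nat
    obtain r \<alpha> where r: "0 \<le> r" "x $ 1 = r * cos \<alpha>" "x $ 2 = r * sin \<alpha>"
    proof -
      have "Complex (x $ 1) (x $ 2) = rcis (cmod (Complex (x $ 1) (x $ 2))) (Arg (Complex (x $ 1) (x $ 2)))"
        by (simp add: rcis_cmod_Arg)
      then show ?thesis
        using that[of "cmod (Complex (x $ 1) (x $ 2))" "Arg (Complex (x $ 1) (x $ 2))"]
        by (metis Re_rcis Im_rcis complex.sel norm_ge_zero)
    qed
    show "(\<Sum>j = 1..J. \<Sum>k = 0..2 ^ j - 1. window_majorant \<sigma> \<delta> (B_mat j k *v x)) \<le> Z * (2 / (1 - q))"
    proof (cases "r = 0")
      case True
      then have "x = 0" using r by (simp add: vec_eq_iff forall_2)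
      then show ?thesis using Z q by (simp add: window_majorant_def)
    next
      case False
      then have r0: "r > 0" using r by simp
      \<comment> \<open>The extra factor \<open>q\<close> accounts for scales starting at 1 while
        the geometric sum starts at 0.\<close>
      define \<rho> where "\<rho> = r powr p * q"
      have \<rho>: "\<rho> > 0" using r0 q by (simp add: \<rho>_def)
      have tp: "(r / 4 ^ Suc j) powr p = \<rho> * q ^ j" for j
      proof -
        have "(4::real) ^ n = 4 powr n" "(4 powr p) ^ n = (4 powr p) powr n" for n :: nat
          by (simp_all add: powr_realpow)
        then have "(4 ^ Suc j) powr p = (4 powr p) ^ Suc j"
          by (simp only: powr_powr mult.commute)
        then have "(r / 4 ^ Suc j) powr p = r powr p / (4 powr p) ^ Suc j"
          using r0 by (simp add: powr_divide)
        also have "\<dots> = r powr p * q ^ Suc j"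
          by (simp add: q_def powr_minus power_inverse divide_inverse)
        finally show ?thesis by (simp add: \<rho>_def)
      qed
      have "(\<Sum>j = 1..J. \<Sum>k = 0..2 ^ j - 1. window_majorant \<sigma> \<delta> (B_mat j k *v x)) \<le>
          (\<Sum>j = 1..J. Z * min ((r / 4 ^ j) powr p) (1 / ((r / 4 ^ j) powr p)))"
        unfolding Z_def p_def
        by (intro sum_mono window_majorant_scale_sum[OF \<delta> \<sigma> _ r(2,3) r0]) auto
      also have "\<dots> = (\<Sum>j<J. Z * min (\<rho> * q ^ j) (1 / (\<rho> * q ^ j)))"
        unfolding tp[symmetric] by (rule sum.reindex_bij_witness[of _ Suc "\<lambda>j. j - 1"]) auto
      also have "\<dots> = Z * (\<Sum>j<J. min (\<rho> * q ^ j) (1 / (\<rho> * q ^ j)))"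
        by (simp add: sum_distrib_left)
      also have "\<dots> \<le> Z * (2 / (1 - q))"
        using Z by (intro mult_left_mono sum_min_geometric_bound q \<rho>) auto
      finally show ?thesis .
    qed
  qed
qed


section \<open>The dual lattice\<close>

lemma nn_integral_int_exp_finite:
  assumes \<mu>: "\<mu> > 0"
  shows "(\<integral>\<^sup>+m. ennreal (exp (- (\<mu> * \<bar>real_of_int m\<bar>))) \<partial>count_space UNIV) < \<infinity>"
proof -
  let ?e = "\<lambda>m::int. ennreal (exp (- (\<mu> * \<bar>real_of_int m\<bar>)))"
  define I where "I = (\<Sum>n. ennreal (exp (- \<mu>) ^ n))"
  have I_nat: "(\<integral>\<^sup>+n. ennreal (exp (- (\<mu> * real n))) \<partial>count_space UNIV) = I"
    unfolding nn_integral_count_space_nat I_def exp_of_nat_mult[symmetric] by (simp add: mult.commute)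
  have "I = ennreal (\<Sum>n. exp (- \<mu>) ^ n)"
    unfolding I_def using \<mu> by (intro suminf_ennreal2 summable_geometric) auto
  then have fin: "I < \<infinity>" by simp
  have pos: "(\<integral>\<^sup>+m. ?e m \<partial>count_space {0..}) = I"
  proof -
    have "bij_betw int UNIV {0..}"
      by (rule bij_betw_byWitness[where f' = nat]) auto
    from nn_integral_bij_count_space[OF this, of ?e] show ?thesis by (simp add: I_nat)
  qed
  have neg: "(\<integral>\<^sup>+m. ?e m \<partial>count_space {..0}) = I"
  proof -
    have "bij_betw (\<lambda>n. - int n) UNIV {..0}"
      by (rule bij_betw_byWitness[where f' = "\<lambda>m. nat (- m)"]) auto
    from nn_integral_bij_count_space[OF this, of ?e] show ?thesis by (simp add: I_nat)
  qed
  have "(\<integral>\<^sup>+m. ?e m \<partial>count_space UNIV) \<le>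
      (\<integral>\<^sup>+m. ?e m * indicator {0..} m + ?e m * indicator {..0} m \<partial>count_space UNIV)"
    by (intro nn_integral_mono) (simp add: indicator_def)
  also have "\<dots> = I + I"
    by (subst nn_integral_add) (simp_all add: nn_integral_count_space_indicator[symmetric] pos neg)
  also have "\<dots> < \<infinity>" using fin by simp
  finally show ?thesis .
qed

text \<open>Integers satisfy |m| <= m^2, so the Gaussian is dominated by a product of two convergent
  two-sided geometric series.\<close>

lemma lattice_Gauss_sum_finite:
  assumes \<mu>: "\<mu> > 0"
  obtains Z where "Z > 0"
    "(\<integral>\<^sup>+z. ennreal (exp (- (\<mu> * (norm z)\<^sup>2))) \<partial>count_space int_lattice) \<le> ennreal Z"
proof -
  let ?e = "\<lambda>m::int. ennreal (exp (- (\<mu> * \<bar>real_of_int m\<bar>)))"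
  let ?v = "\<lambda>p :: int \<times> int. vector [of_int (fst p), of_int (snd p)] :: real^2"
  have sq: "\<bar>real_of_int m\<bar> \<le> (real_of_int m)\<^sup>2" for m
  proof -
    have "\<bar>m\<bar> * 1 \<le> \<bar>m\<bar> * \<bar>m\<bar>"
    proof (cases "m = 0")
      case False
      then show ?thesis by (intro mult_left_mono) linarith+
    qed simp
    then have "\<bar>m\<bar> \<le> m\<^sup>2" by (simp add: power2_eq_square flip: abs_mult)
    then show ?thesis by (metis of_int_abs of_int_le_iff of_int_power)
  qed
  have "bij_betw ?v UNIV int_lattice"
    unfolding bij_betw_def int_lattice_image
    by (auto simp: inj_on_def vec_eq_iff forall_2)
  from nn_integral_bij_count_space[OF this, of "\<lambda>z. ennreal (exp (- (\<mu> * (norm z)\<^sup>2)))"]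
  have "(\<integral>\<^sup>+z. ennreal (exp (- (\<mu> * (norm z)\<^sup>2))) \<partial>count_space int_lattice) =
      (\<integral>\<^sup>+p. ennreal (exp (- (\<mu> * (norm (?v p))\<^sup>2))) \<partial>count_space UNIV)" by simp
  also have "\<dots> \<le> (\<integral>\<^sup>+p. ?e (fst p) * ?e (snd p) \<partial>count_space UNIV)"
  proof (rule nn_integral_mono)
    fix p :: "int \<times> int"
    have "\<mu> * (\<bar>real_of_int (fst p)\<bar> + \<bar>real_of_int (snd p)\<bar>) \<le> \<mu> * (norm (?v p))\<^sup>2"
      using \<mu> add_mono[OF sq sq] by (intro mult_left_mono) (auto simp: norm_vec2_power2)
    then have "exp (- (\<mu> * (norm (?v p))\<^sup>2)) \<le>
        exp (- (\<mu> * \<bar>real_of_int (fst p)\<bar>)) * exp (- (\<mu> * \<bar>real_of_int (snd p)\<bar>))"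
      unfolding exp_add[symmetric] by (simp add: distrib_left)
    from ennreal_leI[OF this] show "ennreal (exp (- (\<mu> * (norm (?v p))\<^sup>2))) \<le> ?e (fst p) * ?e (snd p)"
      by (simp add: ennreal_mult)
  qed
  also have "\<dots> = (\<integral>\<^sup>+m. \<integral>\<^sup>+n. ?e m * ?e n \<partial>count_space UNIV \<partial>count_space UNIV)"
    by (subst nn_integral_fst_count_space[symmetric]) simp
  also have "\<dots> = (\<integral>\<^sup>+m. ?e m \<partial>count_space UNIV) * (\<integral>\<^sup>+n. ?e n \<partial>count_space UNIV)"
    by (simp add: nn_integral_cmult nn_integral_multc)
  also have "\<dots> < \<infinity>"
    using nn_integral_int_exp_finite[OF \<mu>] by (simp add: ennreal_mult_less_top)
  finally obtain Z where Z: "Z \<ge> 0"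
    "(\<integral>\<^sup>+z. ennreal (exp (- (\<mu> * (norm z)\<^sup>2))) \<partial>count_space int_lattice) = ennreal Z"
    by (metis enn2real_nonneg ennreal_enn2real infinity_ennreal_def)
  show thesis
    by (rule that[of "Z + 1"]) (use Z in \<open>auto intro: ennreal_leI\<close>)
qed

text \<open>With v = \<open>dual_mat P *v g\<close>, so that g = P^T v, the difference of the two
  sides is the quadratic form of I - m P P^T at v. Its eigenvalues are 1 - m a^2 and 1 - m b^2; for
  a symmetric 2 x 2 matrix, semidefiniteness follows from nonnegative trace and determinant.\<close>

lemma dual_mat_norm_ge:
  assumes P: "invertible P" and sv: "singular_values P a b"
    and m: "0 \<le> m" "m * a\<^sup>2 \<le> 1" "m * b\<^sup>2 \<le> 1"
  shows "m * (norm g)\<^sup>2 \<le> (norm (dual_mat P *v g))\<^sup>2"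
proof -
  define p q r s where e: "p = P $ 1 $ 1" "q = P $ 1 $ 2" "r = P $ 2 $ 1" "s = P $ 2 $ 2"
  have cp: "(x - (p * p + r * r)) * (x - (q * q + s * s)) - (p * q + r * s) * (q * p + s * r) = (x - a\<^sup>2) * (x - b\<^sup>2)" for x
  proof -
    have h1: "det (mat x - transpose P ** P) = (x - a\<^sup>2) * (x - b\<^sup>2)"
      using sv by (simp add: singular_values_def)
    have h2: "det (mat x - transpose P ** P) =
        (x - (p * p + r * r)) * (x - (q * q + s * s)) - (0 - (p * q + r * s)) * (0 - (q * p + s * r))"
      by (simp add: det_2 mat_def transpose_def matrix_matrix_mult_def sum_2 e)
    have neg: "(0 - y) * (0 - z) = y * z" for y z :: real by simp
    show ?thesis using h1 h2 unfolding neg by simp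
  qed
  \<comment> \<open>Evaluating the characteristic polynomial at 0 and at 1 recovers determinant and
    trace.\<close>
  have det: "(p * s - q * r)\<^sup>2 = a\<^sup>2 * b\<^sup>2"
    using cp[of 0] by (simp add: power2_eq_square algebra_simps)
  have tr: "p\<^sup>2 + q\<^sup>2 + r\<^sup>2 + s\<^sup>2 = a\<^sup>2 + b\<^sup>2"
    using cp[of 0] cp[of 1] by (simp add: power2_eq_square algebra_simps)
  \<comment> \<open>The diagonal entries and the off-diagonal entry of I - m P P^T.\<close>
  define \<alpha> \<beta> \<omega> where c: "\<alpha> = 1 - m * (p\<^sup>2 + q\<^sup>2)" "\<beta> = 1 - m * (r\<^sup>2 + s\<^sup>2)" "\<omega> = - (m * (p * r + q * s))"
  have "\<alpha> * \<beta> - \<omega>\<^sup>2 = 1 - m * (p\<^sup>2 + q\<^sup>2 + r\<^sup>2 + s\<^sup>2) + m\<^sup>2 * (p * s - q * r)\<^sup>2"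
    unfolding c power2_eq_square by algebra
  also have "\<dots> = (1 - m * a\<^sup>2) * (1 - m * b\<^sup>2)"
    unfolding det tr by (simp add: algebra_simps power2_eq_square)
  finally have disc: "\<omega>\<^sup>2 \<le> \<alpha> * \<beta>"
    using m mult_nonneg_nonneg[of "1 - m * a\<^sup>2" "1 - m * b\<^sup>2"] by linarith
  have "\<alpha> + \<beta> = (1 - m * a\<^sup>2) + (1 - m * b\<^sup>2)"
    using arg_cong[OF tr, of "\<lambda>x. m * x"] unfolding c by (simp add: algebra_simps)
  then have sum: "0 \<le> \<alpha> + \<beta>" using m by linarith
  have ab: "0 \<le> \<alpha> * \<beta>" using disc zero_le_power2[of \<omega>] by linarith
  then have \<alpha>: "0 \<le> \<alpha>" and \<beta>: "0 \<le> \<beta>"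
    using sum by (auto simp: zero_le_mult_iff)
  define v where "v = dual_mat P *v g"
  have "transpose P *v v = g"
    unfolding v_def by (simp add: matrix_vector_mul_assoc dual_mat[OF P])
  then have g: "g $ 1 = p * v $ 1 + r * v $ 2" "g $ 2 = q * v $ 1 + s * v $ 2"
    by (auto simp: matrix_vector_mult_def transpose_def sum_2 e)
  have form: "(v $ 1)\<^sup>2 + (v $ 2)\<^sup>2 - m * ((g $ 1)\<^sup>2 + (g $ 2)\<^sup>2) =
      \<alpha> * (v $ 1)\<^sup>2 + 2 * \<omega> * (v $ 1) * (v $ 2) + \<beta> * (v $ 2)\<^sup>2"
    unfolding c g power2_eq_square by algebra
  have "0 \<le> \<alpha> * (v $ 1)\<^sup>2 + 2 * \<omega> * (v $ 1) * (v $ 2) + \<beta> * (v $ 2)\<^sup>2"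
  proof (cases "\<alpha> = 0")
    case True
    then have "\<omega> = 0" using disc by simp
    then show ?thesis using True \<beta> by simp
  next
    case False
    have "\<alpha> * (\<alpha> * (v $ 1)\<^sup>2 + 2 * \<omega> * (v $ 1) * (v $ 2) + \<beta> * (v $ 2)\<^sup>2) =
        (\<alpha> * v $ 1 + \<omega> * v $ 2)\<^sup>2 + (\<alpha> * \<beta> - \<omega>\<^sup>2) * (v $ 2)\<^sup>2"
      by (simp add: power2_eq_square algebra_simps)
    also have "\<dots> \<ge> 0" using disc by (intro add_nonneg_nonneg mult_nonneg_nonneg) auto
    finally show ?thesis using False \<alpha> by (simp add: zero_le_mult_iff)
  qed
  then show ?thesis
    using form unfolding norm_vec2_power2 v_def[symmetric] by linarith
qed

lemma norm_int_lattice_ge_1: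
  assumes "g \<in> int_lattice" "g \<noteq> 0"
  shows "1 \<le> (norm g)\<^sup>2"
proof -
  obtain i where i: "g $ i \<noteq> 0" using assms(2) by (auto simp: vec_eq_iff)
  then have "1 \<le> \<bar>g $ i\<bar>"
    using assms(1) by (intro Ints_nonzero_abs_ge1) (auto simp: int_lattice_def)
  also have "\<dots> \<le> norm g" by (rule component_le_norm_cart)
  finally show ?thesis by (rule one_le_power)
qed

text \<open>The Gaussian exponents at \<eta> and \<eta> + Q g are split into a factor depending on
  \<open>m\<close> alone, a Gaussian in \<open>g\<close> with sum at most \<open>Z\<close>, and half
  of the exponent at \<eta>. The factor \<open>u\<close> is kept at \<eta> and bounded by 1 at the
  other point, so the result is again a multiple of the majorant.\<close>

lemma window_off_diagonal_bound:
  fixes h :: "real^2 \<Rightarrow> complex"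
  assumes \<delta>: "\<delta> > 0" and c: "c \<ge> 0" and u: "0 \<le> u \<eta>" "\<And>x. u x \<le> 1"
    and h: "\<And>x. cmod (h x) \<le> c * (u x * exp (- \<delta> * (norm x)\<^sup>2))"
    and Z: "(\<integral>\<^sup>+z. ennreal (exp (- (\<delta> / 8 * (norm z)\<^sup>2))) \<partial>count_space int_lattice) \<le> ennreal Z" "Z \<ge> 0"
    and m: "m \<ge> 1" "\<And>g. m * (norm g)\<^sup>2 \<le> (norm (Q *v g))\<^sup>2"
  shows "(\<integral>\<^sup>+g. ennreal (cmod (h \<eta>) * cmod (h (\<eta> + Q *v g))) * indicator (- {0}) g \<partial>count_space int_lattice)
    \<le> ennreal (c\<^sup>2 * Z * exp (- (\<delta> / 8 * m)) * (u \<eta> * exp (- (\<delta> / 2 * (norm \<eta>)\<^sup>2))))"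
proof -
  let ?C = "c\<^sup>2 * exp (- (\<delta> / 8 * m)) * (u \<eta> * exp (- (\<delta> / 2 * (norm \<eta>)\<^sup>2)))"
  have C: "0 \<le> ?C" using u by simp
  have "(\<integral>\<^sup>+g. ennreal (cmod (h \<eta>) * cmod (h (\<eta> + Q *v g))) * indicator (- {0}) g \<partial>count_space int_lattice)
      \<le> (\<integral>\<^sup>+g. ennreal ?C * ennreal (exp (- (\<delta> / 8 * (norm g)\<^sup>2))) \<partial>count_space int_lattice)"
  proof (rule nn_integral_mono)
    fix g assume "g \<in> space (count_space int_lattice)"
    then have g: "g \<in> int_lattice" by simp
    show "ennreal (cmod (h \<eta>) * cmod (h (\<eta> + Q *v g))) * indicator (- {0}) g \<le>
        ennreal ?C * ennreal (exp (- (\<delta> / 8 * (norm g)\<^sup>2)))"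
    proof (cases "g = 0")
      case False
      let ?x = "norm \<eta>" and ?y = "norm (\<eta> + Q *v g)" and ?z = "norm (Q *v g)"
      have "?z \<le> ?x + ?y"
        using norm_triangle_ineq4[of "\<eta> + Q *v g" \<eta>] by simp
      then have "?z\<^sup>2 \<le> (?x + ?y)\<^sup>2" by (rule power_mono) simp
      also have "\<dots> \<le> 2 * ?x\<^sup>2 + 2 * ?y\<^sup>2"
        using sum_squares_bound[of ?x ?y] by (simp add: power2_sum)
      finally have z: "?z\<^sup>2 \<le> 2 * ?x\<^sup>2 + 2 * ?y\<^sup>2" .
      have g1: "1 \<le> (norm g)\<^sup>2" by (rule norm_int_lattice_ge_1[OF g False])
      \<comment> \<open>These two facts separate \<open>m\<close> from \<open>g\<close>: the first
        says (m - 1)(|g|^2 - 1) >= 0, the second m |g|^2 >= 1. Both use that a nonzero integer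
        vector has norm at least 1.\<close>
      have "(m - 1) * 1 \<le> (m - 1) * (norm g)\<^sup>2" "1 * 1 \<le> m * (norm g)\<^sup>2"
        using m(1) g1 by (intro mult_left_mono mult_mono; simp)+
      then have "m + (norm g)\<^sup>2 \<le> 2 * (m * (norm g)\<^sup>2)"
        by (simp add: left_diff_distrib)
      with m(2)[of g] z have "m + (norm g)\<^sup>2 \<le> 4 * ?x\<^sup>2 + 4 * ?y\<^sup>2" by linarith
      \<comment> \<open>The added 4 |\<eta>|^2 becomes the retained exponent \<delta>/2 once
        everything is multiplied by \<delta>/8.\<close>
      then have "m + (norm g)\<^sup>2 + 4 * ?x\<^sup>2 \<le> 8 * ?x\<^sup>2 + 8 * ?y\<^sup>2" using zero_le_power2[of ?y] by linarith
      then have "\<delta> / 8 * (m + (norm g)\<^sup>2 + 4 * ?x\<^sup>2) \<le> \<delta> / 8 * (8 * ?x\<^sup>2 + 8 * ?y\<^sup>2)"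
        using \<delta> by (intro mult_left_mono) auto
      then have ex: "exp (- \<delta> * ?x\<^sup>2) * exp (- \<delta> * ?y\<^sup>2) \<le>
          exp (- (\<delta> / 8 * m)) * exp (- (\<delta> / 2 * ?x\<^sup>2)) * exp (- (\<delta> / 8 * (norm g)\<^sup>2))"
        unfolding exp_add[symmetric] by (simp add: algebra_simps)
      have "cmod (h (\<eta> + Q *v g)) \<le> c * (1 * exp (- \<delta> * ?y\<^sup>2))"
        by (rule order_trans[OF h]) (intro mult_left_mono mult_right_mono u c; simp)
      then have "cmod (h \<eta>) * cmod (h (\<eta> + Q *v g)) \<le> c * (u \<eta> * exp (- \<delta> * ?x\<^sup>2)) * (c * (1 * exp (- \<delta> * ?y\<^sup>2)))"
        using c u(1) by (intro mult_mono h) auto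
      also have "\<dots> = c\<^sup>2 * u \<eta> * (exp (- \<delta> * ?x\<^sup>2) * exp (- \<delta> * ?y\<^sup>2))"
        by (simp add: power2_eq_square)
      also have "\<dots> \<le> c\<^sup>2 * u \<eta> * (exp (- (\<delta> / 8 * m)) * exp (- (\<delta> / 2 * ?x\<^sup>2)) * exp (- (\<delta> / 8 * (norm g)\<^sup>2)))"
        using u by (intro mult_left_mono ex) auto
      also have "\<dots> = ?C * exp (- (\<delta> / 8 * (norm g)\<^sup>2))" by simp
      finally have "ennreal (cmod (h \<eta>) * cmod (h (\<eta> + Q *v g))) \<le> ennreal (?C * exp (- (\<delta> / 8 * (norm g)\<^sup>2)))"
        by (rule ennreal_leI)
      also have "\<dots> = ennreal ?C * ennreal (exp (- (\<delta> / 8 * (norm g)\<^sup>2)))"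
        by (rule ennreal_mult[OF C]) simp
      finally show ?thesis using False by simp
    qed simp
  qed
  also have "\<dots> = ennreal ?C * (\<integral>\<^sup>+g. ennreal (exp (- (\<delta> / 8 * (norm g)\<^sup>2))) \<partial>count_space int_lattice)"
    by (rule nn_integral_cmult) simp
  also have "\<dots> \<le> ennreal ?C * ennreal Z" by (intro mult_left_mono Z) simp
  also have "\<dots> = ennreal (?C * Z)" by (rule ennreal_mult[symmetric, OF C Z(2)])
  also have "?C * Z = c\<^sup>2 * Z * exp (- (\<delta> / 8 * m)) * (u \<eta> * exp (- (\<delta> / 2 * (norm \<eta>)\<^sup>2)))"
    by simp
  finally show ?thesis .
qed

section \<open>Unordered sums as integrals over counting measure\<close>

lemma nn_integral_count_space_Sigma:
  "(\<integral>\<^sup>+p. f p \<partial>count_space (Sigma A B)) = (\<integral>\<^sup>+x. \<integral>\<^sup>+y. f (x, y) \<partial>count_space (B x) \<partial>count_space A)"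
proof -
  have "(\<integral>\<^sup>+p. f p \<partial>count_space (Sigma A B)) = (\<integral>\<^sup>+p. f p * indicator (Sigma A B) p \<partial>count_space UNIV)"
    by (rule nn_integral_count_space_indicator) simp
  also have "\<dots> = (\<integral>\<^sup>+x. \<integral>\<^sup>+y. f (x, y) * indicator (Sigma A B) (x, y) \<partial>count_space UNIV \<partial>count_space UNIV)"
    by (rule nn_integral_fst_count_space[symmetric])
  also have "\<dots> = (\<integral>\<^sup>+x. (\<integral>\<^sup>+y. f (x, y) * indicator (B x) y \<partial>count_space UNIV) * indicator A x \<partial>count_space UNIV)"
    by (intro nn_integral_cong) (simp add: indicator_def split: if_splits)
  also have "\<dots> = (\<integral>\<^sup>+x. \<integral>\<^sup>+y. f (x, y) * indicator (B x) y \<partial>count_space UNIV \<partial>count_space A)"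
    by (cases "A = UNIV") (simp_all add: nn_integral_count_space_indicator)
  also have "\<dots> = (\<integral>\<^sup>+x. \<integral>\<^sup>+y. f (x, y) \<partial>count_space (B x) \<partial>count_space A)"
  proof (rule nn_integral_cong)
    fix x
    show "(\<integral>\<^sup>+y. f (x, y) * indicator (B x) y \<partial>count_space UNIV) = (\<integral>\<^sup>+y. f (x, y) \<partial>count_space (B x))"
      by (cases "B x = UNIV") (simp_all add: nn_integral_count_space_indicator)
  qed
  finally show ?thesis .
qed

lemma nn_integral_count_space_infsum:
  fixes f :: "'i \<Rightarrow> real"
  assumes "f summable_on I" "\<And>i. i \<in> I \<Longrightarrow> 0 \<le> f i"
  shows "(\<integral>\<^sup>+i. ennreal (f i) \<partial>count_space I) = ennreal (infsum f I)"
proof -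
  have "(\<lambda>i. norm (f i)) summable_on I"
    using assms summable_on_cong[of I "\<lambda>i. norm (f i)" f] by simp
  then have "Infinite_Set_Sum.abs_summable_on f I" by (simp only: abs_summable_equivalent)
  then show ?thesis
    by (simp add: nn_integral_conv_infsetsum[OF _ assms(2)] infsetsum_infsum)
qed

lemma summable_on_nn_integral:
  fixes f :: "'i \<Rightarrow> real"
  assumes "(\<integral>\<^sup>+i. ennreal (f i) \<partial>count_space I) < \<infinity>" "\<And>i. i \<in> I \<Longrightarrow> 0 \<le> f i"
  shows "f summable_on I"
proof -
  have "(\<integral>\<^sup>+i. ennreal (norm (f i)) \<partial>count_space I) = (\<integral>\<^sup>+i. ennreal (f i) \<partial>count_space I)"
    by (intro nn_integral_cong) (simp add: assms(2))
  then have "integrable (count_space I) f"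
    using assms(1) by (intro integrableI_bounded) simp_all
  then have "Infinite_Set_Sum.abs_summable_on f I"
    unfolding abs_summable_on_def .
  then have "(\<lambda>i. norm (f i)) summable_on I" by (simp only: abs_summable_equivalent)
  then show ?thesis
    using assms(2) summable_on_cong[of I "\<lambda>i. norm (f i)" f] by simp
qed


section \<open>The frame bounds\<close>

lemma lattice_of_image: "lattice_of P = (\<lambda>z. P *v z) ` int_lattice"
  by (auto simp: lattice_of_def int_lattice_def)

lemma countable_wp_indices: "countable (wp_indices (lattice_of P))"
proof (rule countable_subset)
  show "wp_indices (lattice_of P) \<subseteq> Coarse ` lattice_of P \<union>
      (\<lambda>(j, k, l). Fine j k l) ` (UNIV \<times> UNIV \<times> lattice_of P)"
    by (force simp: wp_indices_def)
  have "countable (lattice_of P)" by (simp add: lattice_of_image)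
  then show "countable (Coarse ` lattice_of P \<union> (\<lambda>(j, k, l). Fine j k l) ` (UNIV \<times> UNIV \<times> lattice_of P))"
    by (intro countable_Un countable_image countable_SIGMA) auto
qed

text \<open>The coarse contribution plus the sum over scales and rotations. Values in
  \<open>ennreal\<close> make additivity, scaling and the exchange with integrals
  unconditional.\<close>

definition packet_total :: "ennreal \<Rightarrow> (nat \<Rightarrow> nat \<Rightarrow> ennreal) \<Rightarrow> ennreal" where
  "packet_total x y = x + (\<integral>\<^sup>+j. (\<Sum>k = 0..2 ^ j - 1. y j k) \<partial>count_space {1..})"

lemma packet_total_mono:
  assumes "x \<le> x'" "\<And>j k. y j k \<le> y' j k"
  shows "packet_total x y \<le> packet_total x' y'"
  unfolding packet_total_def by (intro add_mono assms nn_integral_mono sum_mono)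

lemma packet_total_add:
  "packet_total (x + x') (\<lambda>j k. y j k + y' j k) = packet_total x y + packet_total x' y'"
  unfolding packet_total_def by (simp add: sum.distrib nn_integral_add ac_simps)

lemma packet_total_cmult:
  "packet_total (c * x) (\<lambda>j k. c * y j k) = c * packet_total x y"
  unfolding packet_total_def by (simp add: sum_distrib_left[symmetric] nn_integral_cmult distrib_left)

lemma packet_total_integral:
  assumes [measurable]: "q \<in> borel_measurable borel" "v \<in> borel_measurable borel"
    "\<And>j k. w j k \<in> borel_measurable borel"
  shows "packet_total (\<integral>\<^sup>+x. q x * v x \<partial>lborel) (\<lambda>j k. \<integral>\<^sup>+x. q x * w j k x \<partial>lborel) =
    (\<integral>\<^sup>+x. q x * packet_total (v x) (\<lambda>j k. w j k x) \<partial>(lborel :: (real^2) measure))"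
proof -
  have swap: "(\<integral>\<^sup>+j. (\<Sum>k = 0..2 ^ j - 1. \<integral>\<^sup>+x. q x * w j k x \<partial>lborel) \<partial>count_space {1..}) =
      (\<integral>\<^sup>+x. \<integral>\<^sup>+j. (\<Sum>k = 0..2 ^ j - 1. q x * w j k x) \<partial>count_space {1..} \<partial>lborel)"
    by (subst nn_integral_count_space_nn_integral) (simp_all add: nn_integral_sum)
  have eq: "(\<lambda>x. \<integral>\<^sup>+j. (\<Sum>k = 0..2 ^ j - 1. q x * w j k x) \<partial>count_space {1..}) =
      (\<lambda>x. \<Sum>j. (\<Sum>k = 0..2 ^ j - 1. q x * w j k x) * indicator {1..} j)"
    by (simp add: nn_integral_count_space_indicator nn_integral_count_space_nat)
  have [measurable]: "(\<lambda>x. \<integral>\<^sup>+j. (\<Sum>k = 0..2 ^ j - 1. q x * w j k x) \<partial>count_space {1..}) \<in> borel_measurable borel"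
    unfolding eq by measurable
  have "(\<integral>\<^sup>+x. q x * v x \<partial>lborel) +
      (\<integral>\<^sup>+x. \<integral>\<^sup>+j. (\<Sum>k = 0..2 ^ j - 1. q x * w j k x) \<partial>count_space {1..} \<partial>lborel) =
      (\<integral>\<^sup>+x. q x * v x + (\<integral>\<^sup>+j. (\<Sum>k = 0..2 ^ j - 1. q x * w j k x) \<partial>count_space {1..}) \<partial>lborel)"
    by (rule nn_integral_add[symmetric]) measurable
  also have "\<dots> = (\<integral>\<^sup>+x. q x * packet_total (v x) (\<lambda>j k. w j k x) \<partial>lborel)"
    by (simp add: packet_total_def distrib_left nn_integral_cmult[symmetric] sum_distrib_left)
  finally show ?thesis
    unfolding packet_total_def swap .
qed

lemma nn_integral_wp_indices:
  assumes P: "invertible P"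
  shows "(\<integral>\<^sup>+i. F i \<partial>count_space (wp_indices (lattice_of P))) =
    packet_total (\<integral>\<^sup>+z. F (Coarse (P *v z)) \<partial>count_space int_lattice)
      (\<lambda>j k. \<integral>\<^sup>+z. F (Fine j k (P *v z)) \<partial>count_space int_lattice)"
proof -
  have inj: "P *v x = P *v y \<longleftrightarrow> x = y" for x y
    using P matrix_inv_mult(2)[OF P] by (metis matrix_vector_mul_assoc matrix_vector_mul_lid)
  define C where "C = Coarse ` lattice_of P"
  define S where "S = Sigma {1..} (\<lambda>j::nat. {0..2 ^ j - 1 :: nat} \<times> int_lattice)"
  define G where "G = (\<lambda>(j, k, z). Fine j k (P *v z)) ` S"
  have W: "wp_indices (lattice_of P) = C \<union> G"
  proof (intro equalityI subsetI)
    fix i assume "i \<in> wp_indices (lattice_of P)"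
    then consider l where "i = Coarse l" "l \<in> lattice_of P"
      | j k z where "i = Fine j k (P *v z)" "1 \<le> j" "k \<le> 2 ^ j - 1" "z \<in> int_lattice"
      by (auto simp: wp_indices_def lattice_of_image)
    then show "i \<in> C \<union> G"
    proof cases
      case 2
      then have "i \<in> G" unfolding G_def S_def by (intro image_eqI[of _ _ "(j, k, z)"]) auto
      then show ?thesis by simp
    qed (simp add: C_def)
  qed (auto simp: wp_indices_def lattice_of_image C_def G_def S_def)
  have disj: "C \<inter> G = {}" by (auto simp: C_def G_def)
  have "(\<integral>\<^sup>+i. F i \<partial>count_space (C \<union> G)) = (\<integral>\<^sup>+i. F i * indicator (C \<union> G) i \<partial>count_space UNIV)"
    by (rule nn_integral_count_space_indicator) simp
  also have "\<dots> = (\<integral>\<^sup>+i. F i * indicator C i + F i * indicator G i \<partial>count_space UNIV)"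
    using disj by (intro nn_integral_cong) (auto simp: indicator_def)
  also have "\<dots> = (\<integral>\<^sup>+i. F i * indicator C i \<partial>count_space UNIV) + (\<integral>\<^sup>+i. F i * indicator G i \<partial>count_space UNIV)"
    by (rule nn_integral_add) simp_all
  also have "(\<integral>\<^sup>+i. F i * indicator C i \<partial>count_space UNIV) = (\<integral>\<^sup>+i. F i \<partial>count_space C)"
    by (rule nn_integral_count_space_indicator[symmetric]) simp
  also have "\<dots> = (\<integral>\<^sup>+z. F (Coarse (P *v z)) \<partial>count_space int_lattice)"
    by (rule nn_integral_bij_count_space[symmetric, where g = "\<lambda>z. Coarse (P *v z)"])
       (auto simp: bij_betw_def inj_on_def inj C_def lattice_of_image)
  also have "(\<integral>\<^sup>+i. F i * indicator G i \<partial>count_space UNIV) = (\<integral>\<^sup>+i. F i \<partial>count_space G)"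
    by (rule nn_integral_count_space_indicator[symmetric]) simp
  also have "\<dots> = (\<integral>\<^sup>+p. F ((\<lambda>(j, k, z). Fine j k (P *v z)) p) \<partial>count_space S)"
    by (rule nn_integral_bij_count_space[symmetric]) (auto simp: bij_betw_def inj_on_def inj G_def)
  also have "\<dots> = (\<integral>\<^sup>+j. \<integral>\<^sup>+k. \<integral>\<^sup>+z. F (Fine j k (P *v z)) \<partial>count_space int_lattice \<partial>count_space {0..2 ^ j - 1} \<partial>count_space {1..})"
    unfolding S_def nn_integral_count_space_Sigma by simp
  finally show ?thesis
    unfolding W packet_total_def by (simp add: nn_integral_count_space_finite)
qed

lemma packet_total_window_majorant:
  assumes K: "\<And>x J. (\<Sum>j = 1..J. \<Sum>k = 0..2 ^ j - 1. window_majorant \<sigma> \<delta> (B_mat j k *v x)) \<le> K"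
    and y: "y \<le> 1" "0 \<le> y"
  shows "packet_total (ennreal y) (\<lambda>j k. ennreal (window_majorant \<sigma> \<delta> (B_mat j k *v x))) \<le> ennreal (1 + K)"
proof -
  have K0: "0 \<le> K" using K[where J = 0] by simp
  have "(\<integral>\<^sup>+j. (\<Sum>k = 0..2 ^ j - 1. ennreal (window_majorant \<sigma> \<delta> (B_mat j k *v x))) \<partial>count_space {1..}) =
      (\<Sum>j. (\<Sum>k = 0..2 ^ j - 1. ennreal (window_majorant \<sigma> \<delta> (B_mat j k *v x))) * indicator {1..} j)"
    by (simp add: nn_integral_count_space_indicator nn_integral_count_space_nat)
  also have "\<dots> \<le> ennreal K"
  proof (rule suminf_le_const)
    fix n
    have "(\<Sum>j<n. (\<Sum>k = 0..2 ^ j - 1. ennreal (window_majorant \<sigma> \<delta> (B_mat j k *v x))) * indicator {1..} j) \<le>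
        (\<Sum>j\<in>insert 0 {1..n}. (\<Sum>k = 0..2 ^ j - 1. ennreal (window_majorant \<sigma> \<delta> (B_mat j k *v x))) * indicator {1..} j)"
      by (intro sum_mono2) auto
    also have "\<dots> = (\<Sum>j = 1..n. (\<Sum>k = 0..2 ^ j - 1. ennreal (window_majorant \<sigma> \<delta> (B_mat j k *v x))) * indicator {1..} j)"
      by (subst sum.insert) auto
    also have "\<dots> = (\<Sum>j = 1..n. ennreal (\<Sum>k = 0..2 ^ j - 1. window_majorant \<sigma> \<delta> (B_mat j k *v x)))"
      by (intro sum.cong refl) (simp add: sum_ennreal)
    also have "\<dots> = ennreal (\<Sum>j = 1..n. \<Sum>k = 0..2 ^ j - 1. window_majorant \<sigma> \<delta> (B_mat j k *v x))"
      by (intro sum_ennreal sum_nonneg window_majorant_nonneg)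
    also have "\<dots> \<le> ennreal K" by (rule ennreal_leI[OF K])
    finally show "(\<Sum>j<n. (\<Sum>k = 0..2 ^ j - 1. ennreal (window_majorant \<sigma> \<delta> (B_mat j k *v x))) * indicator {1..} j) \<le> ennreal K" .
  qed simp
  finally have "packet_total (ennreal y) (\<lambda>j k. ennreal (window_majorant \<sigma> \<delta> (B_mat j k *v x))) \<le> ennreal 1 + ennreal K"
    unfolding packet_total_def using y by (intro add_mono ennreal_leI)
  then show ?thesis using K0 by (simp add: ennreal_plus)
qed

lemma dual_mat_mat_1: "dual_mat (mat 1) = mat 1"
  using dual_mat(2)[of "mat 1"] by (simp add: invertible_det_nz transpose_mat)

lemma sqrt_det_A_mat: "sqrt \<bar>det (A_mat j k)\<bar> = 8 powr (real j / 2)"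
proof -
  have "sqrt (8 ^ j) = (8 powr real j) powr (1 / 2)"
    by (simp add: powr_half_sqrt powr_realpow)
  then show ?thesis by (simp add: det_A_mat powr_powr)
qed

lemma square_integrable_wavepacket:
  assumes "square_integrable \<phi>0" "square_integrable \<phi>"
  shows "square_integrable (wavepacket \<phi>0 \<phi> i)"
proof (cases i)
  case (Coarse l)
  have "square_integrable (\<lambda>x. \<phi>0 (mat 1 *v x - l))"
    by (rule l2_norm_affine[OF _ assms(1)]) (simp add: invertible_det_nz)
  moreover have "wavepacket \<phi>0 \<phi> i = (\<lambda>x. \<phi>0 (mat 1 *v x - l))"
    using Coarse by (simp add: fun_eq_iff)
  ultimately show ?thesis by (simp only:)
next
  case (Fine j k l)
  have "square_integrable (\<lambda>x. of_real (8 powr (real j / 2)) * \<phi> (A_mat j k *v x - l))"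
    by (intro square_integrable_cmult l2_norm_affine[OF invertible_A_mat assms(2)])
  moreover have "wavepacket \<phi>0 \<phi> i = (\<lambda>x. of_real (8 powr (real j / 2)) * \<phi> (A_mat j k *v x - l))"
    using Fine by (simp add: fun_eq_iff)
  ultimately show ?thesis by (simp only:)
qed

text \<open>
  The decay bounds on the windows hold only almost everywhere; clipping yields a representative
  of the Fourier transform that satisfies them everywhere.
\<close>

definition clip :: "(real^2 \<Rightarrow> real) \<Rightarrow> (real^2 \<Rightarrow> complex) \<Rightarrow> real^2 \<Rightarrow> complex" where
  "clip b h \<xi> = (if cmod (h \<xi>) \<le> b \<xi> then h \<xi> else 0)"

lemma is_fourier_L2_clip:
  assumes "square_integrable f" "AE \<xi> in lborel. cmod (fourier f \<xi>) \<le> b \<xi>" and [measurable]: "b \<in> borel_measurable borel"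
  shows "is_fourier_L2 f (clip b (fourier f))" "AE \<xi> in lborel. fourier f \<xi> = clip b (fourier f) \<xi>"
proof -
  note F = is_fourier_L2_fourier[OF assms(1)]
  have [measurable]: "fourier f \<in> borel_measurable borel"
    using is_fourier_L2_square_integrable[OF F] by measurable
  show ae: "AE \<xi> in lborel. fourier f \<xi> = clip b (fourier f) \<xi>"
    using assms(2) by eventually_elim (simp add: clip_def)
  have "clip b (fourier f) \<in> borel_measurable borel"
    unfolding clip_def[abs_def] by measurable
  from is_fourier_L2_cong_AE[OF F assms(1) this ae] show "is_fourier_L2 f (clip b (fourier f))" .
qed

lemma norm_clip_le: "0 \<le> b \<xi> \<Longrightarrow> cmod (clip b h \<xi>) \<le> b \<xi>"
  by (simp add: clip_def)

text \<open>\<open>K\<close> is a parameter, not a constant obtained inside, because the final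
  constants must be fixed before the windows are.\<close>

locale wavepacket_system =
  fixes \<phi>0 \<phi> :: "real^2 \<Rightarrow> complex" and A B \<delta> \<sigma> c K :: real
  assumes window: "window_assumptions \<phi>0 \<phi> A B \<delta> \<sigma> c"
    and \<delta>: "\<delta> > 0" and \<sigma>: "\<sigma> > 2" and c: "c > 0"
    and K: "\<And>x J. (\<Sum>j = 1..J. \<Sum>k = 0..2 ^ j - 1. window_majorant \<sigma> \<delta> (B_mat j k *v x)) \<le> K"
begin

definition u :: "real^2 \<Rightarrow> real" where "u \<xi> = min 1 (\<bar>\<xi> $ 1\<bar> powr \<sigma>)"
text \<open>The factor 1 stands in the place of \<open>u\<close>, so that both windows meet
  \<open>window_off_diagonal_bound\<close> in the same shape.\<close>

definition \<psi>0 :: "real^2 \<Rightarrow> complex" where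
  "\<psi>0 = clip (\<lambda>\<xi>. c * (1 * exp (- \<delta> * (norm \<xi>)\<^sup>2))) (fourier \<phi>0)"
definition \<psi> :: "real^2 \<Rightarrow> complex" where
  "\<psi> = clip (\<lambda>\<xi>. c * (u \<xi> * exp (- \<delta> * (norm \<xi>)\<^sup>2))) (fourier \<phi>)"

lemma u: "0 \<le> u \<xi>" "u \<xi> \<le> 1" by (simp_all add: u_def)

lemma u_measurable [measurable]: "u \<in> borel_measurable borel"
  unfolding u_def[abs_def] by measurable

lemma \<phi>: "square_integrable \<phi>0" "square_integrable \<phi>"
  using window by (simp_all add: window_assumptions_def)

lemma \<psi>: "is_fourier_L2 \<phi>0 \<psi>0" "is_fourier_L2 \<phi> \<psi>"
    "AE \<xi> in lborel. fourier \<phi>0 \<xi> = \<psi>0 \<xi>" "AE \<xi> in lborel. fourier \<phi> \<xi> = \<psi> \<xi>"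
  unfolding \<psi>0_def \<psi>_def
  by (intro is_fourier_L2_clip \<phi>; use window in \<open>simp add: window_assumptions_def u_def\<close>)+

lemma \<psi>_measurable [measurable]: "\<psi>0 \<in> borel_measurable borel" "\<psi> \<in> borel_measurable borel"
  using \<psi>(1,2)[THEN is_fourier_L2_square_integrable] by measurable

lemma \<psi>_le: "cmod (\<psi>0 \<xi>) \<le> c * (1 * exp (- \<delta> * (norm \<xi>)\<^sup>2))"
    "cmod (\<psi> \<xi>) \<le> c * (u \<xi> * exp (- \<delta> * (norm \<xi>)\<^sup>2))"
  unfolding \<psi>0_def \<psi>_def using c u by (intro norm_clip_le; simp)+

lemma \<psi>_bounded: "cmod (\<psi>0 \<xi>) \<le> c" "cmod (\<psi> \<xi>) \<le> c"
proof -
  have e: "exp (- \<delta> * (norm \<xi>)\<^sup>2) \<le> 1" using \<delta> by simp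
  have "c * (1 * exp (- \<delta> * (norm \<xi>)\<^sup>2)) \<le> c * (1 * 1)" "c * (u \<xi> * exp (- \<delta> * (norm \<xi>)\<^sup>2)) \<le> c * (1 * 1)"
    using c e u by (intro mult_left_mono mult_mono; simp)+
  then show "cmod (\<psi>0 \<xi>) \<le> c" "cmod (\<psi> \<xi>) \<le> c" using \<psi>_le[of \<xi>] by simp_all
qed

lemma K_nonneg: "0 \<le> K" using K[where J = 0] by simp

definition cover :: "real^2 \<Rightarrow> ennreal" where
  "cover \<xi> = packet_total (ennreal ((cmod (\<psi>0 \<xi>))\<^sup>2)) (\<lambda>j k. ennreal ((cmod (\<psi> (B_mat j k *v \<xi>)))\<^sup>2))"

text \<open>Each of the countably many invertible maps \<open>B_mat j k\<close> pulls null sets back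
  to null sets, so almost everywhere all values of the transforms may be replaced by clipped ones
  simultaneously.\<close>

lemma cover_bounds: "AE \<xi> in lborel. ennreal A \<le> cover \<xi> \<and> cover \<xi> \<le> ennreal B"
proof -
  have "AE \<xi> in lborel. fourier \<phi> (B_mat j k *v \<xi>) = \<psi> (B_mat j k *v \<xi>)" for j k
    unfolding B_mat_def dual_mat_def[symmetric]
    by (intro AE_matrix dual_mat invertible_A_mat \<psi>)
  then have "AE \<xi> in lborel. \<forall>j k. fourier \<phi> (B_mat j k *v \<xi>) = \<psi> (B_mat j k *v \<xi>)"
    by (simp add: AE_all_countable)
  moreover have "AE \<xi> in lborel.
      (\<lambda>j. \<Sum>k = 0..2 ^ j - 1. (cmod (fourier \<phi> (B_mat j k *v \<xi>)))\<^sup>2) summable_on {1..} \<and>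
      A \<le> (cmod (fourier \<phi>0 \<xi>))\<^sup>2 +
        (\<Sum>\<^sub>\<infinity>j\<in>{1..}. \<Sum>k = 0..2 ^ j - 1. (cmod (fourier \<phi> (B_mat j k *v \<xi>)))\<^sup>2) \<and>
      (cmod (fourier \<phi>0 \<xi>))\<^sup>2 +
        (\<Sum>\<^sub>\<infinity>j\<in>{1..}. \<Sum>k = 0..2 ^ j - 1. (cmod (fourier \<phi> (B_mat j k *v \<xi>)))\<^sup>2) \<le> B"
    using window by (simp add: window_assumptions_def)
  ultimately show ?thesis using \<psi>(3)
  proof eventually_elim
    case (elim \<xi>)
    let ?s = "\<lambda>j. \<Sum>k = 0..2 ^ j - 1. (cmod (fourier \<phi> (B_mat j k *v \<xi>)))\<^sup>2"
    have "cover \<xi> = ennreal ((cmod (fourier \<phi>0 \<xi>))\<^sup>2) + (\<integral>\<^sup>+j. ennreal (?s j) \<partial>count_space {1..})"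
      unfolding cover_def packet_total_def using elim by (simp add: sum_ennreal del: ennreal_power)
    also have "(\<integral>\<^sup>+j. ennreal (?s j) \<partial>count_space {1..}) = ennreal (infsum ?s {1..})"
      using elim by (intro nn_integral_count_space_infsum) (auto intro: sum_nonneg)
    also have "ennreal ((cmod (fourier \<phi>0 \<xi>))\<^sup>2) + \<dots> = ennreal ((cmod (fourier \<phi>0 \<xi>))\<^sup>2 + infsum ?s {1..})"
      by (rule ennreal_plus[symmetric]) (auto intro!: infsum_nonneg sum_nonneg)
    finally show ?case using elim by (auto intro!: ennreal_leI)
  qed
qed

text \<open>Squaring a window squares \<open>u\<close>, which is at most 1, and doubles the Gaussian
  exponent, so squared windows lie below c^2 times the majorant.\<close>

lemma cover_le: "cover \<xi> \<le> ennreal (c\<^sup>2 * (1 + K))"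
proof -
  have sq: "(cmod (\<psi> \<eta>))\<^sup>2 \<le> c\<^sup>2 * window_majorant \<sigma> \<delta> \<eta>" for \<eta>
  proof -
    have "(cmod (\<psi> \<eta>))\<^sup>2 \<le> (c * (u \<eta> * exp (- \<delta> * (norm \<eta>)\<^sup>2)))\<^sup>2"
      by (rule power_mono[OF \<psi>_le(2)]) simp
    also have "\<dots> = c\<^sup>2 * ((u \<eta> * u \<eta>) * (exp (- \<delta> * (norm \<eta>)\<^sup>2) * exp (- \<delta> * (norm \<eta>)\<^sup>2)))"
      by (simp add: power2_eq_square)
    also have "\<dots> \<le> c\<^sup>2 * ((u \<eta> * 1) * exp (- (\<delta> / 2 * (norm \<eta>)\<^sup>2)))"
      using u[of \<eta>] \<delta> by (intro mult_left_mono mult_mono) (auto simp: exp_add[symmetric])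
    finally show ?thesis by (simp add: window_majorant_def u_def)
  qed
  have "cover \<xi> \<le> packet_total (ennreal (c\<^sup>2) * ennreal 1) (\<lambda>j k. ennreal (c\<^sup>2) * ennreal (window_majorant \<sigma> \<delta> (B_mat j k *v \<xi>)))"
    unfolding cover_def
  proof (rule packet_total_mono)
    show "ennreal ((cmod (\<psi>0 \<xi>))\<^sup>2) \<le> ennreal (c\<^sup>2) * ennreal 1"
      using power_mono[OF \<psi>_bounded(1) norm_ge_zero, of \<xi> 2] by (simp add: ennreal_leI del: ennreal_power)
    show "ennreal ((cmod (\<psi> (B_mat j k *v \<xi>)))\<^sup>2) \<le> ennreal (c\<^sup>2) * ennreal (window_majorant \<sigma> \<delta> (B_mat j k *v \<xi>))" for j k
      using ennreal_leI[OF sq] by (simp add: ennreal_mult del: ennreal_power)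
  qed
  also have "\<dots> \<le> ennreal (c\<^sup>2) * ennreal (1 + K)"
    unfolding packet_total_cmult by (intro mult_left_mono packet_total_window_majorant K) auto
  also have "\<dots> = ennreal (c\<^sup>2 * (1 + K))"
    using K_nonneg by (intro ennreal_mult[symmetric]) auto
  finally show ?thesis .
qed

text \<open>The plane is not a null set, so some point satisfies the covering bound and
  \<open>cover_le\<close> at once. This is how a condition of the form \<kappa> <= C A becomes an
  absolute bound on \<kappa>.\<close>

lemma A_le: "A \<le> c\<^sup>2 * (1 + K)"
proof (rule ccontr)
  assume "\<not> A \<le> c\<^sup>2 * (1 + K)"
  then have lt: "ennreal (c\<^sup>2 * (1 + K)) < ennreal A"
    using K_nonneg by (intro ennreal_lessI) (auto simp: not_le intro: le_less_trans[rotated])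
  have "AE \<xi> in (lborel :: (real^2) measure). False"
    using cover_bounds
  proof eventually_elim
    case (elim \<xi>)
    then show ?case using cover_le[of \<xi>] lt by (meson leD order_trans)
  qed
  then have "UNIV \<in> null_sets (lborel :: (real^2) measure)" by (simp add: AE_iff_null)
  then show False by (simp add: null_sets_def emeasure_lborel_UNIV)
qed

text \<open>The inequalities for single generations are added up. The diagonal terms integrate the
  squared transform of \<open>f\<close> against \<open>cover\<close>; the errors integrate it
  against the Schur weights, whose sum is at most \<open>e\<close> times 1 for the coarse part plus
  K for the fine part. The error \<epsilon> sees the lattice only through \<open>m\<close>.\<close>

lemma frame_bounds:
  assumes P: "invertible P" and m: "m \<ge> 1" "\<And>g. m * (norm g)\<^sup>2 \<le> (norm (dual_mat P *v g))\<^sup>2"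
    and Z: "(\<integral>\<^sup>+z. ennreal (exp (- (\<delta> / 8 * (norm z)\<^sup>2))) \<partial>count_space int_lattice) \<le> ennreal Z" "Z \<ge> 0"
  defines "\<epsilon> \<equiv> c\<^sup>2 * Z * (1 + K) * exp (- (\<delta> / 8 * m))"
  shows "has_frame_bounds (wp_indices (lattice_of P)) (wavepacket \<phi>0 \<phi>)
    (inverse \<bar>det P\<bar> * (A - \<epsilon>)) (inverse \<bar>det P\<bar> * (B + \<epsilon>))"
  unfolding has_frame_bounds_def
proof (intro conjI allI impI ballI countable_wp_indices square_integrable_wavepacket \<phi>)
  let ?I = "wp_indices (lattice_of P)" and ?D = "\<bar>det P\<bar>"
  have D: "?D > 0" using P by (simp add: invertible_det_nz)
  have AB: "0 < A" "A \<le> B" using window by (simp_all add: window_assumptions_def)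
  have \<epsilon>: "0 \<le> \<epsilon>" using K_nonneg Z by (simp add: \<epsilon>_def)
  define e where "e = c\<^sup>2 * Z * exp (- (\<delta> / 8 * m))"
  have e: "0 \<le> e" using Z by (simp add: e_def)
  have e\<epsilon>: "e * (1 + K) = \<epsilon>" by (simp add: e_def \<epsilon>_def)
  define w0 where "w0 = (\<lambda>\<eta>::real^2. e * (1 * exp (- (\<delta> / 2 * (norm \<eta>)\<^sup>2))))"
  define w1 where "w1 = (\<lambda>\<eta>::real^2. e * (u \<eta> * exp (- (\<delta> / 2 * (norm \<eta>)\<^sup>2))))"
  have w_meas [measurable]: "w0 \<in> borel_measurable borel" "w1 \<in> borel_measurable borel"
    unfolding w0_def w1_def by measurable
  have w_nonneg: "0 \<le> w0 \<eta>" "0 \<le> w1 \<eta>" for \<eta> using e u by (simp_all add: w0_def w1_def)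
  have w_le: "w0 \<eta> \<le> e" "w1 \<eta> \<le> e" for \<eta>
  proof -
    have "exp (- (\<delta> / 2 * (norm \<eta>)\<^sup>2)) \<le> 1" using \<delta> by simp
    then have "e * (1 * exp (- (\<delta> / 2 * (norm \<eta>)\<^sup>2))) \<le> e * (1 * 1)" "e * (u \<eta> * exp (- (\<delta> / 2 * (norm \<eta>)\<^sup>2))) \<le> e * (1 * 1)"
      using e u[of \<eta>] by (intro mult_left_mono mult_mono; simp)+
    then show "w0 \<eta> \<le> e" "w1 \<eta> \<le> e" by (simp_all add: w0_def w1_def)
  qed
  fix f assume f: "square_integrable f"
  define f' where "f' = fourier f"
  have F: "is_fourier_L2 f f'" unfolding f'_def by (rule is_fourier_L2_fourier[OF f])
  have f': "square_integrable f'" by (rule is_fourier_L2_square_integrable[OF F])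
  have [measurable]: "f' \<in> borel_measurable borel" using f' by measurable
  define N where "N = (l2_norm f)\<^sup>2"
  have N: "(\<integral>\<^sup>+\<xi>. ennreal ((cmod (f' \<xi>))\<^sup>2) \<partial>lborel) = ennreal N"
    unfolding N_def nn_integral_l2_norm[OF f'] is_fourier_L2_norm[OF F f] ..
  have N0: "0 \<le> N" by (simp add: N_def)
  let ?q = "\<lambda>\<xi>. ennreal ((cmod (f' \<xi>))\<^sup>2)"
  let ?c = "\<lambda>i. (cmod (l2_inner f (wavepacket \<phi>0 \<phi> i)))\<^sup>2"
  define S0 where "S0 = (\<integral>\<^sup>+z. ennreal (?c (Coarse (P *v z))) \<partial>count_space int_lattice)"
  define S1 where "S1 = (\<lambda>j k. \<integral>\<^sup>+z. ennreal (?c (Fine j k (P *v z))) \<partial>count_space int_lattice)"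
  define T0 where "T0 = (\<integral>\<^sup>+\<xi>. ?q \<xi> * ennreal ((cmod (\<psi>0 \<xi>))\<^sup>2) \<partial>lborel)"
  define T1 where "T1 = (\<lambda>j k. \<integral>\<^sup>+\<xi>. ?q \<xi> * ennreal ((cmod (\<psi> (B_mat j k *v \<xi>)))\<^sup>2) \<partial>lborel)"
  define E0 where "E0 = (\<integral>\<^sup>+\<xi>. ?q \<xi> * ennreal (w0 \<xi>) \<partial>lborel)"
  define E1 where "E1 = (\<lambda>j k. \<integral>\<^sup>+\<xi>. ?q \<xi> * ennreal (w1 (B_mat j k *v \<xi>)) \<partial>lborel)"
  have coarse: "ennreal ?D * S0 \<le> T0 + E0" "T0 \<le> ennreal ?D * S0 + E0"
  proof -
    \<comment> \<open>The coarse generation is the case of the identity dilation.\<close>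
    have I: "invertible (mat 1 :: real^2^2)" by (simp add: invertible_det_nz)
    have off: "(\<integral>\<^sup>+g. ennreal (cmod (\<psi>0 \<eta>) * cmod (\<psi>0 (\<eta> + dual_mat P *v g))) * indicator (- {0}) g
        \<partial>count_space int_lattice) \<le> ennreal (w0 \<eta>)" for \<eta>
      unfolding w0_def e_def
      by (rule window_off_diagonal_bound[OF \<delta> _ _ _ \<psi>_le(1) Z m]) (use c in auto)
    have "(\<lambda>x. of_real (sqrt \<bar>det (mat 1 :: real^2^2)\<bar>) * \<phi>0 (mat 1 *v x - P *v z)) = wavepacket \<phi>0 \<phi> (Coarse (P *v z))" for z
      by (simp add: fun_eq_iff)
    with packet_sum_bounds[OF I P f F \<phi>(1) \<psi>(1) \<psi>_bounded(1) w_meas(1) w_nonneg(1) w_le(1) off]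
    show "ennreal ?D * S0 \<le> T0 + E0" "T0 \<le> ennreal ?D * S0 + E0"
      by (simp_all add: S0_def T0_def E0_def dual_mat_mat_1 del: ennreal_power)
  qed
  have fine: "ennreal ?D * S1 j k \<le> T1 j k + E1 j k" "T1 j k \<le> ennreal ?D * S1 j k + E1 j k" for j k
  proof -
    have off: "(\<integral>\<^sup>+g. ennreal (cmod (\<psi> \<eta>) * cmod (\<psi> (\<eta> + dual_mat P *v g))) * indicator (- {0}) g
        \<partial>count_space int_lattice) \<le> ennreal (w1 \<eta>)" for \<eta>
      unfolding w1_def e_def
      by (rule window_off_diagonal_bound[OF \<delta> _ _ _ \<psi>_le(2) Z m]) (use c u in auto)
    have "(\<lambda>x. of_real (sqrt \<bar>det (A_mat j k)\<bar>) * \<phi> (A_mat j k *v x - P *v z)) = wavepacket \<phi>0 \<phi> (Fine j k (P *v z))" for z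
      by (simp add: fun_eq_iff sqrt_det_A_mat)
    with packet_sum_bounds[OF invertible_A_mat P f F \<phi>(2) \<psi>(2) \<psi>_bounded(2) w_meas(2) w_nonneg(2) w_le(2) off, of j k]
    show "ennreal ?D * S1 j k \<le> T1 j k + E1 j k" "T1 j k \<le> ennreal ?D * S1 j k + E1 j k"
      by (simp_all add: S1_def T1_def E1_def B_mat_def dual_mat_def del: ennreal_power)
  qed
  define S where "S = (\<integral>\<^sup>+i. ennreal (?c i) \<partial>count_space ?I)"
  have S: "S = packet_total S0 S1"
    unfolding S_def S0_def S1_def by (rule nn_integral_wp_indices[OF P])
  have T: "packet_total T0 T1 = (\<integral>\<^sup>+\<xi>. ?q \<xi> * cover \<xi> \<partial>lborel)"
    unfolding T0_def T1_def cover_def by (rule packet_total_integral) measurable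
  have T_up: "packet_total T0 T1 \<le> ennreal (B * N)"
  proof -
    have "packet_total T0 T1 \<le> (\<integral>\<^sup>+\<xi>. ?q \<xi> * ennreal B \<partial>lborel)"
      unfolding T
    proof (rule nn_integral_mono_AE)
      show "AE \<xi> in lborel. ?q \<xi> * cover \<xi> \<le> ?q \<xi> * ennreal B"
        using cover_bounds by eventually_elim (intro mult_left_mono; simp)
    qed
    also have "\<dots> = ennreal N * ennreal B"
      by (subst nn_integral_multc) (simp_all only: N, measurable)
    also have "\<dots> = ennreal (B * N)"
      using AB N0 by (simp add: ennreal_mult[symmetric] mult.commute)
    finally show ?thesis .
  qed
  have T_low: "ennreal (A * N) \<le> packet_total T0 T1"
  proof -
    have "ennreal (A * N) = ennreal N * ennreal A"
      using AB N0 by (simp add: ennreal_mult[symmetric] mult.commute)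
    also have "\<dots> = (\<integral>\<^sup>+\<xi>. ?q \<xi> * ennreal A \<partial>lborel)"
      by (subst nn_integral_multc) (simp_all only: N, measurable)
    also have "\<dots> \<le> packet_total T0 T1"
      unfolding T
    proof (rule nn_integral_mono_AE)
      show "AE \<xi> in lborel. ?q \<xi> * ennreal A \<le> ?q \<xi> * cover \<xi>"
        using cover_bounds by eventually_elim (intro mult_left_mono; simp)
    qed
    finally show ?thesis .
  qed
  have E: "packet_total E0 E1 \<le> ennreal (\<epsilon> * N)"
  proof -
    have "packet_total E0 E1 = (\<integral>\<^sup>+\<xi>. ?q \<xi> * packet_total (ennreal (w0 \<xi>)) (\<lambda>j k. ennreal (w1 (B_mat j k *v \<xi>))) \<partial>lborel)"
      unfolding E0_def E1_def by (rule packet_total_integral) measurable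
    also have "\<dots> \<le> (\<integral>\<^sup>+\<xi>. ?q \<xi> * ennreal \<epsilon> \<partial>lborel)"
    proof (intro nn_integral_mono mult_left_mono)
      fix \<xi>
      have w0: "ennreal (w0 \<xi>) = ennreal e * ennreal (exp (- (\<delta> / 2 * (norm \<xi>)\<^sup>2)))"
        using e by (simp add: w0_def ennreal_mult)
      have w1: "ennreal (w1 \<eta>) = ennreal e * ennreal (window_majorant \<sigma> \<delta> \<eta>)" for \<eta>
        using e by (simp add: w1_def ennreal_mult window_majorant_def u_def)
      have "packet_total (ennreal (w0 \<xi>)) (\<lambda>j k. ennreal (w1 (B_mat j k *v \<xi>))) \<le> ennreal e * ennreal (1 + K)"
        unfolding w0 w1 packet_total_cmult using \<delta>
        by (intro mult_left_mono packet_total_window_majorant K) auto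
      also have "\<dots> = ennreal \<epsilon>"
        unfolding e\<epsilon>[symmetric] by (rule ennreal_mult[symmetric]) (use e K_nonneg in auto)
      finally show "packet_total (ennreal (w0 \<xi>)) (\<lambda>j k. ennreal (w1 (B_mat j k *v \<xi>))) \<le> ennreal \<epsilon>" .
    qed simp
    also have "\<dots> = ennreal N * ennreal \<epsilon>"
      by (subst nn_integral_multc) (simp_all only: N, measurable)
    also have "\<dots> = ennreal (\<epsilon> * N)"
      using \<epsilon> N0 by (simp add: ennreal_mult[symmetric] mult.commute)
    finally show ?thesis .
  qed
  have up: "ennreal ?D * S \<le> ennreal (B * N) + ennreal (\<epsilon> * N)"
  proof -
    have "ennreal ?D * S \<le> packet_total (T0 + E0) (\<lambda>j k. T1 j k + E1 j k)"
      unfolding S packet_total_cmult[symmetric] by (rule packet_total_mono[OF coarse(1) fine(1)])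
    also have "\<dots> \<le> ennreal (B * N) + ennreal (\<epsilon> * N)"
      unfolding packet_total_add by (rule add_mono[OF T_up E])
    finally show ?thesis .
  qed
  have low: "ennreal (A * N) \<le> ennreal ?D * S + ennreal (\<epsilon> * N)"
  proof -
    note T_low
    also have "packet_total T0 T1 \<le> packet_total (ennreal ?D * S0 + E0) (\<lambda>j k. ennreal ?D * S1 j k + E1 j k)"
      by (rule packet_total_mono[OF coarse(2) fine(2)])
    also have "\<dots> \<le> ennreal ?D * S + ennreal (\<epsilon> * N)"
      unfolding packet_total_add packet_total_cmult S by (rule add_left_mono[OF E])
    finally show ?thesis .
  qed
  \<comment> \<open>The upper estimate itself shows that the coefficients are square summable, which
    permits the return to real sums.\<close>
  have "ennreal ?D * S < \<infinity>"
    by (rule order.strict_trans1[OF up]) simp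
  then have S_fin: "S < \<infinity>"
    using D by (auto simp: ennreal_mult_less_top ennreal_eq_0_iff)
  show summ: "?c summable_on ?I"
    by (rule summable_on_nn_integral) (use S_fin in \<open>auto simp: S_def\<close>)
  define s where "s = infsum ?c ?I"
  have s0: "0 \<le> s" unfolding s_def by (rule infsum_nonneg) simp
  have Ss: "S = ennreal s"
    unfolding S_def s_def by (rule nn_integral_count_space_infsum[OF summ]) simp
  have Ds: "ennreal ?D * S = ennreal (?D * s)"
    unfolding Ss by (rule ennreal_mult[symmetric]) (use s0 in auto)
  have "?D * s \<le> B * N + \<epsilon> * N"
    using up AB N0 \<epsilon> s0 unfolding Ds by (simp add: ennreal_plus[symmetric] del: ennreal_plus)
  then show "infsum ?c ?I \<le> inverse ?D * (B + \<epsilon>) * (l2_norm f)\<^sup>2"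
    using D unfolding s_def[symmetric] N_def[symmetric] by (simp add: field_simps)
  have "A * N \<le> ?D * s + \<epsilon> * N"
    using low AB N0 \<epsilon> s0 unfolding Ds by (simp add: ennreal_plus[symmetric] del: ennreal_plus)
  then show "inverse ?D * (A - \<epsilon>) * (l2_norm f)\<^sup>2 \<le> infsum ?c ?I"
    using D unfolding s_def[symmetric] N_def[symmetric] by (simp add: field_simps)
qed

end

section \<open>Choice of the constants\<close>

lemma has_frame_bounds_weaken:
  assumes "has_frame_bounds I g c1 c2" "c1' \<le> c1" "c2 \<le> c2'"
  shows "has_frame_bounds I g c1' c2'"
proof -
  have "c1' * (l2_norm f)\<^sup>2 \<le> c1 * (l2_norm f)\<^sup>2" "c2 * (l2_norm f)\<^sup>2 \<le> c2' * (l2_norm f)\<^sup>2" for f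
    using assms(2,3) by (auto intro: mult_right_mono)
  then show ?thesis
    using assms(1) unfolding has_frame_bounds_def by (meson order_trans)
qed

theorem theorem3p6:
  fixes \<delta> \<sigma> :: real
  assumes "\<delta> > 0" and "\<sigma> > 2"
  shows "\<exists>\<tau>>0. \<forall>c>0. \<exists>C>0.
    \<forall>(\<phi>0 :: real^2 \<Rightarrow> complex) (\<phi> :: real^2 \<Rightarrow> complex) (A :: real) (B :: real).
      window_assumptions \<phi>0 \<phi> A B \<delta> \<sigma> c \<longrightarrow>
      (\<forall>(P :: real^2^2) a b.
         invertible P \<longrightarrow> a > 0 \<longrightarrow> b > 0 \<longrightarrow> singular_values P a b \<longrightarrow>
         (let \<kappa> = exp (- \<tau> / a\<^sup>2) + exp (- \<tau> / b\<^sup>2) in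
            \<kappa> \<le> C * A \<longrightarrow>
            is_frame (wp_indices (lattice_of P)) (wavepacket \<phi>0 \<phi>) \<and>
            has_frame_bounds (wp_indices (lattice_of P)) (wavepacket \<phi>0 \<phi>)
              (inverse (lattice_volume P) * (A - inverse C * \<kappa>))
              (inverse (lattice_volume P) * (B + inverse C * \<kappa>))))"
proof -
  \<comment> \<open>The exponent with which \<open>m\<close> appears in the error of
    \<open>frame_bounds\<close>.\<close>
  define \<tau> where "\<tau> = \<delta> / 8"
  have \<tau>: "\<tau> > 0" using assms(1) by (simp add: \<tau>_def)
  \<comment> \<open>\<open>Z\<close> and \<open>K\<close> come from \<delta> and \<sigma> alone; the
    implied constant \<open>c\<close> of the decay bounds enters only through \<open>M\<close>
    below.\<close>
  obtain Z where Z: "Z > 0"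
    "(\<integral>\<^sup>+z. ennreal (exp (- (\<delta> / 8 * (norm z)\<^sup>2))) \<partial>count_space int_lattice) \<le> ennreal Z"
    using lattice_Gauss_sum_finite[of "\<delta> / 8"] assms(1) by auto
  obtain K where K: "K > 0"
    "\<And>x J. (\<Sum>j = 1..J. \<Sum>k = 0..2 ^ j - 1. window_majorant \<sigma> \<delta> (B_mat j k *v x)) \<le> K"
    using window_majorant_sum_bounded[OF assms] by blast
  show ?thesis
  proof (rule exI[of _ \<tau>], intro conjI allI impI \<tau>)
    fix c :: real assume c: "c > 0"
    \<comment> \<open>The upper bound for \<open>A\<close> from \<open>A_le\<close>; Z M is then the
      constant in front of the exponential in the error.\<close>
    define M where "M = c\<^sup>2 * (1 + K)"
    have M: "M > 0" using c K by (simp add: M_def)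
    have ZM: "Z * M > 0" using Z M by simp
    \<comment> \<open>The first entry gives \<kappa> <= C A <= C M <= exp(-\<tau>), which forces a
      and b to be at most 1. The second makes the error Z M \<kappa> at most A/2.\<close>
    define C where "C = min (exp (- \<tau>) / M) (1 / (2 * (Z * M)))"
    have C: "C > 0" using M ZM by (simp add: C_def)
    have CM: "C * M \<le> exp (- \<tau>)"
      using mult_right_mono[of C "exp (- \<tau>) / M" M] M by (simp add: C_def)
    have CZM: "2 * (Z * M) * C \<le> 1"
    proof -
      have "C \<le> 1 / (2 * (Z * M))" by (simp add: C_def)
      then show ?thesis
        using ZM by (subst (asm) pos_le_divide_eq) (simp_all add: mult.commute)
    qed
    have invC: "2 * (Z * M) \<le> inverse C"
      using CZM C by (simp add: field_simps)
    show "\<exists>C>0. \<forall>(\<phi>0 :: real^2 \<Rightarrow> complex) (\<phi> :: real^2 \<Rightarrow> complex) (A :: real) (B :: real).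
      window_assumptions \<phi>0 \<phi> A B \<delta> \<sigma> c \<longrightarrow>
      (\<forall>(P :: real^2^2) a b.
         invertible P \<longrightarrow> a > 0 \<longrightarrow> b > 0 \<longrightarrow> singular_values P a b \<longrightarrow>
         (let \<kappa> = exp (- \<tau> / a\<^sup>2) + exp (- \<tau> / b\<^sup>2) in
            \<kappa> \<le> C * A \<longrightarrow>
            is_frame (wp_indices (lattice_of P)) (wavepacket \<phi>0 \<phi>) \<and>
            has_frame_bounds (wp_indices (lattice_of P)) (wavepacket \<phi>0 \<phi>)
              (inverse (lattice_volume P) * (A - inverse C * \<kappa>))
              (inverse (lattice_volume P) * (B + inverse C * \<kappa>))))"
      unfolding Let_def
    proof (rule exI[of _ C], intro conjI allI impI C)
      fix \<phi>0 \<phi> :: "real^2 \<Rightarrow> complex" and A B :: real and P :: "real^2^2" and a b :: real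
      assume win: "window_assumptions \<phi>0 \<phi> A B \<delta> \<sigma> c" and P: "invertible P"
        and ab: "a > 0" "b > 0" and sv: "singular_values P a b"
        and small: "exp (- \<tau> / a\<^sup>2) + exp (- \<tau> / b\<^sup>2) \<le> C * A"
      interpret wavepacket_system \<phi>0 \<phi> A B \<delta> \<sigma> c K
        by unfold_locales (use win assms c K in auto)
      define \<kappa> where "\<kappa> = exp (- \<tau> / a\<^sup>2) + exp (- \<tau> / b\<^sup>2)"
      have AB: "0 < A" "A \<le> B" using win by (simp_all add: window_assumptions_def)
      have D: "lattice_volume P > 0" using P by (simp add: lattice_volume_def invertible_det_nz)
      have "C * A \<le> C * M" using C A_le by (simp add: M_def)
      then have "\<kappa> \<le> exp (- \<tau>)" using small CM by (simp add: \<kappa>_def)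
      then have "exp (- \<tau> / a\<^sup>2) \<le> exp (- \<tau>)" "exp (- \<tau> / b\<^sup>2) \<le> exp (- \<tau>)"
        using exp_gt_zero[of "- \<tau> / a\<^sup>2"] exp_gt_zero[of "- \<tau> / b\<^sup>2"] unfolding \<kappa>_def by linarith+
      then have ge1: "1 \<le> 1 / a\<^sup>2" "1 \<le> 1 / b\<^sup>2"
        using \<tau> ab by (simp_all add: field_simps)
      \<comment> \<open>With this choice \<open>exp (- (\<tau> * m))\<close> is the larger of the
        two summands of \<kappa>.\<close>
      define m where "m = min (1 / a\<^sup>2) (1 / b\<^sup>2)"
      have m: "m \<ge> 1" using ge1 by (simp add: m_def)
      have ma: "m * a\<^sup>2 \<le> 1" "m * b\<^sup>2 \<le> 1"
        using mult_right_mono[of m "1 / a\<^sup>2" "a\<^sup>2"] mult_right_mono[of m "1 / b\<^sup>2" "b\<^sup>2"] ab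
        by (simp_all add: m_def)
      have m_dual: "m * (norm g)\<^sup>2 \<le> (norm (dual_mat P *v g))\<^sup>2" for g
        by (rule dual_mat_norm_ge[OF P sv _ ma]) (use m in simp)
      have "exp (- (\<delta> / 8 * m)) \<le> \<kappa>"
      proof (cases "1 / a\<^sup>2 \<le> 1 / b\<^sup>2")
        case True
        then have "m = 1 / a\<^sup>2" by (simp add: m_def)
        then show ?thesis by (simp add: \<kappa>_def \<tau>_def)
      next
        case False
        then have "m = 1 / b\<^sup>2" by (simp add: m_def)
        then show ?thesis by (simp add: \<kappa>_def \<tau>_def)
      qed
      then have "Z * M * exp (- (\<delta> / 8 * m)) \<le> Z * M * \<kappa>"
        using ZM by (intro mult_left_mono) auto
      then have \<epsilon>: "c\<^sup>2 * Z * (1 + K) * exp (- (\<delta> / 8 * m)) \<le> Z * M * \<kappa>"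
        by (simp add: M_def ac_simps)
      have \<kappa>: "\<kappa> > 0" by (simp add: \<kappa>_def add_pos_pos)
      have "2 * (Z * M) * \<kappa> \<le> 2 * (Z * M) * (C * A)"
        using small ZM unfolding \<kappa>_def by (intro mult_left_mono) auto
      also have "\<dots> \<le> 1 * A"
        using mult_right_mono[OF CZM, of A] AB by (simp add: ac_simps)
      finally have half: "2 * (Z * M * \<kappa>) \<le> A" by simp
      have "2 * (Z * M) * \<kappa> \<le> inverse C * \<kappa>"
        using invC \<kappa> by (intro mult_right_mono) auto
      then have strong: "Z * M * \<kappa> \<le> inverse C * \<kappa>"
        using mult_pos_pos[OF ZM \<kappa>] by simp
      note fb = frame_bounds[OF P m m_dual Z(2) less_imp_le[OF Z(1)], folded lattice_volume_def]
      \<comment> \<open>With Z M in place of \<open>inverse C\<close> the lower bound is at least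
        half of A divided by the lattice volume, hence positive. The bounds of the statement follow
        by weakening, but their lower one is 0 when \<kappa> = C A, so they cannot supply the frame
        property.\<close>
      have fb1: "has_frame_bounds (wp_indices (lattice_of P)) (wavepacket \<phi>0 \<phi>)
          (inverse (lattice_volume P) * (A - Z * M * \<kappa>)) (inverse (lattice_volume P) * (B + Z * M * \<kappa>))"
        by (rule has_frame_bounds_weaken[OF fb]) (use D \<epsilon> in \<open>auto intro!: mult_left_mono\<close>)
      have "A - Z * M * \<kappa> \<le> B + Z * M * \<kappa>"
        using AB(2) mult_pos_pos[OF ZM \<kappa>] by linarith
      then have le: "inverse (lattice_volume P) * (A - Z * M * \<kappa>) \<le> inverse (lattice_volume P) * (B + Z * M * \<kappa>)"
        by (rule mult_left_mono) (use D in simp)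
      have "0 < inverse (lattice_volume P) * (A - Z * M * \<kappa>)"
        using D half AB by simp
      with le fb1 show "is_frame (wp_indices (lattice_of P)) (wavepacket \<phi>0 \<phi>)"
        unfolding is_frame_def by blast
      show "has_frame_bounds (wp_indices (lattice_of P)) (wavepacket \<phi>0 \<phi>)
          (inverse (lattice_volume P) * (A - inverse C * (exp (- \<tau> / a\<^sup>2) + exp (- \<tau> / b\<^sup>2))))
          (inverse (lattice_volume P) * (B + inverse C * (exp (- \<tau> / a\<^sup>2) + exp (- \<tau> / b\<^sup>2))))"
        unfolding \<kappa>_def[symmetric]
        by (rule has_frame_bounds_weaken[OF fb1]) (use D strong in \<open>auto intro!: mult_left_mono\<close>)
    qed
  qed
qed

end
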